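(* Let $P\subset\mathbb S^2$ be a geodesic polygon in the unit sphere, and for $z\in P$ let $h_z(l)$ be the position complexity of the billiard flow in $P$. Then for (Lebesgue) almost every point $z\in P$ there is a constant $C=C(z)$ and there are arbitrarily large $l$ such that $h_z(l)\le Cl$.
   Context: A geodesic polygon $P$ is a compact connected region bounded by finitely many geodesic sides, not necessarily simply connected. The billiard flow moves a point with unit speed along geodesics in $P$, reflecting at the sides by the law of geometric optics; an orbit is regular if it does not hit a corner of $P$. For $z\in P$ let $R_z$ be the set of unit vectors at $z$ (directed into $P$) and let $O_z(l)$ be the set of regular billiard orbits of length $l$ starting from $R_z$. Two orbits in $O_z(l)$ are homotopic if they can be joined by a continuous family of orbits in $O_z(l)$. The position complexity $h_z(l)$ is the number of homotopy classes in $O_z(l)$, i.e. the number of connected components of the set of initial directions at $z$ whose billiard orbit hits no corner up to time $l$. *)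

theory Defs
  imports "HOL-Analysis.Analysis" "HOL-Library.Extended_Nat"
begin

abbreviation S2 :: "(real^3) set" where
  "S2 \<equiv> sphere 0 1"

text \<open>
  Lebesgue surface measure on the unit sphere, as the normalised cone measure: a Borel set
  \<open>A \<subseteq> S2\<close> gets three times the volume of \<open>{r *\<^sub>R x | r x. 0 < r \<and> r < 1 \<and> x \<in> A}\<close>,
  so that the whole sphere has area \<open>4 * pi\<close>.
\<close>

definition sphere_measure :: "(real^3) measure" where
  "sphere_measure =
     scale_measure 3 (distr (restrict_space lborel (ball 0 1 - {0})) (restrict_space borel S2)
                        (\<lambda>x. x /\<^sub>R norm x))"

definition unit_tangent :: "real^3 \<Rightarrow> real^3 \<Rightarrow> bool" where
  "unit_tangent x v \<longleftrightarrow> norm v = 1 \<and> v \<bullet> x = 0"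

definition geodesic :: "real^3 \<Rightarrow> real^3 \<Rightarrow> real \<Rightarrow> real^3" where
  "geodesic x v t = cos t *\<^sub>R x + sin t *\<^sub>R v"

definition geodesic_segment :: "(real^3) set \<Rightarrow> bool" where
  "geodesic_segment A \<longleftrightarrow>
     (\<exists>x v L. x \<in> S2 \<and> unit_tangent x v \<and> 0 < L \<and> A = geodesic x v ` {0..L})"

abbreviation sphere_interior :: "(real^3) set \<Rightarrow> (real^3) set" where
  "sphere_interior P \<equiv> top_of_set S2 interior_of P"

abbreviation sphere_frontier :: "(real^3) set \<Rightarrow> (real^3) set" where
  "sphere_frontier P \<equiv> top_of_set S2 frontier_of P"

text \<open>
  \<open>x\<close> is an inner point of a side of \<open>P\<close>: near \<open>x\<close>, the set \<open>P\<close> is the hemisphere bounded by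
  the great circle through \<open>x\<close> with unit normal \<open>n\<close>, and \<open>n\<close> points into \<open>P\<close>.
\<close>

definition inner_normal :: "(real^3) set \<Rightarrow> real^3 \<Rightarrow> real^3 \<Rightarrow> bool" where
  "inner_normal P x n \<longleftrightarrow> unit_tangent x n \<and>
     (\<exists>\<epsilon>>0. \<forall>y\<in>S2. dist x y < \<epsilon> \<longrightarrow> (y \<in> P \<longleftrightarrow> 0 \<le> n \<bullet> y))"

text \<open>
  \<open>V\<close> is the set of corners of the polygon \<open>P\<close>. It has to contain every boundary point at which
  the boundary is not locally a single geodesic with \<open>P\<close> on one side of it. It may in addition
  contain finitely many corners of angle \<open>pi\<close>.
\<close>

definition geodesic_polygon :: "(real^3) set \<Rightarrow> (real^3) set \<Rightarrow> bool" where
  "geodesic_polygon P V \<longleftrightarrow>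
     P \<subseteq> S2 \<and> P \<noteq> {} \<and> compact P \<and> connected P \<and>
     top_of_set S2 closure_of (sphere_interior P) = P \<and>
     (\<exists>\<S>. finite \<S> \<and> (\<forall>A\<in>\<S>. geodesic_segment A) \<and> sphere_frontier P = \<Union>\<S>) \<and>
     finite V \<and> V \<subseteq> sphere_frontier P \<and>
     (\<forall>x \<in> sphere_frontier P - V. \<exists>n. inner_normal P x n)"

text \<open>
  Regular billiard orbits of length \<open>l\<close>, parametrised by arc length on \<open>{0..l}\<close>. The condition is
  local in the time \<open>t\<close>: \<open>v\<close> and \<open>w\<close> are the velocities just before and just after \<open>t\<close>. At
  \<open>t = 0\<close> the incoming and at \<open>t = l\<close> the outgoing condition is vacuous (it only concerns
  \<open>s = t\<close>), so there the law of reflection is no restriction. Since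
  \<open>{0..l}\<close> is compact, the orbit is a geodesic polyline with finitely many reflections.
\<close>

definition regular_orbit ::
    "(real^3) set \<Rightarrow> (real^3) set \<Rightarrow> real \<Rightarrow> (real \<Rightarrow> real^3) \<Rightarrow> bool" where
  "regular_orbit P V l \<gamma> \<longleftrightarrow>
     (\<forall>t\<in>{0..l}. \<gamma> t \<in> P - V \<and>
        (\<exists>v w. unit_tangent (\<gamma> t) v \<and> unit_tangent (\<gamma> t) w \<and>
           (\<exists>\<epsilon>>0. (\<forall>s\<in>{0..l}. t - \<epsilon> < s \<and> s \<le> t \<longrightarrow> \<gamma> s = geodesic (\<gamma> t) v (s - t)) \<and>
                  (\<forall>s\<in>{0..l}. t \<le> s \<and> s < t + \<epsilon> \<longrightarrow> \<gamma> s = geodesic (\<gamma> t) w (s - t))) \<and>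
           (\<gamma> t \<in> sphere_interior P \<longrightarrow> w = v) \<and>
           (\<gamma> t \<in> sphere_frontier P \<longrightarrow>
              (\<exists>n. inner_normal P (\<gamma> t) n \<and> w = v - (2 * (v \<bullet> n)) *\<^sub>R n))))"

text \<open>
  The initial velocity of such an orbit is not prescribed: it is an arbitrary unit tangent vector
  at \<open>z\<close> pointing into \<open>P\<close>.
\<close>

definition orbits_from ::
    "(real^3) set \<Rightarrow> (real^3) set \<Rightarrow> real^3 \<Rightarrow> real \<Rightarrow> (real \<Rightarrow> real^3) set" where
  "orbits_from P V z l = {\<gamma>. regular_orbit P V l \<gamma> \<and> \<gamma> 0 = z}"

text \<open>
  Homotopies run through orbits in \<open>orbits_from P V z l\<close>. Only the values on \<open>{0..l}\<close> matter, so
  orbits that agree there are homotopic.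
\<close>

definition orbit_homotopy ::
    "(real^3) set \<Rightarrow> (real^3) set \<Rightarrow> real^3 \<Rightarrow> real
      \<Rightarrow> ((real \<Rightarrow> real^3) \<times> (real \<Rightarrow> real^3)) set" where
  "orbit_homotopy P V z l =
     {(\<gamma>, \<gamma>'). homotopic_with_canon (\<lambda>\<beta>. \<beta> \<in> orbits_from P V z l) {0..l} P \<gamma> \<gamma>'}"

definition position_complexity ::
    "(real^3) set \<Rightarrow> (real^3) set \<Rightarrow> real^3 \<Rightarrow> real \<Rightarrow> enat" where
  "position_complexity P V z l =
     (let \<H> = orbits_from P V z l // orbit_homotopy P V z l
      in if finite \<H> then enat (card \<H>) else \<infinity>)"

end

theory Submission
  imports Defs
begin

text \<open>
  A direction at \<open>z\<close> whose orbit meets a corner \<open>q\<close> at time \<open>T\<close> is, read backwards, an orbit that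
  starts at \<open>q\<close> and ends at \<open>z\<close>. As long as no direction is blocked, orbits depend continuously on
  their direction, so \<open>h_z(l)\<close> is at most one more than the number of blocked directions. Unfolding
  the reflections, the end point of an orbit from \<open>q\<close> is locally an isometric image of the end
  point of the free geodesic from \<open>q\<close> with the same direction and length. The free geodesics of
  length between \<open>k * pi\<close> and \<open>(k + 1) * pi\<close> cover the sphere once, so the orbits from \<open>q\<close> with
  such lengths cover almost every \<open>z\<close> on average at most once. Hence the integral over \<open>z\<close> of the
  number of directions blocked before time \<open>n * pi\<close> is at most \<open>n\<close> times the number of corners
  times the area of the sphere, and Fatou's lemma gives the claim.
\<close>

section \<open>Geodesics and reflections on the sphere\<close>

text \<open>A regular orbit is defined locally in time, so three pathologies have to be dealt with:
  an orbit could run along a side, it could reflect infinitely often before reaching a corner, and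
  its reflections could change abruptly with the direction. The first is excluded by an initial
  piece in the interior, the second by a conserved quantity near the corner, the third by writing
  the orbit near a point as the image of one geodesic under a continuous folding map. The free
  geodesics from \<open>q\<close> focus at \<open>q\<close> and \<open>-q\<close> at multiples of
  \<open>pi\<close>, which is why lengths are cut there; orbits with exactly such a length reach
  only countably many \<open>z\<close>, since countably many unfoldings suffice. The domains of
  these unfoldings overlap, so the free end points are cut into disjoint pieces, one for each
  unfolding. The bound on the average holds for every \<open>n\<close>, but Fatou's lemma controls a
  lower limit; this is where the arbitrarily large lengths come from.\<close>

lemma geodesic_0 [simp]: "geodesic x v 0 = x"
  by (simp add: geodesic_def)

definition velocity :: "real^3 \<Rightarrow> real^3 \<Rightarrow> real \<Rightarrow> real^3" where
  "velocity x v t = cos t *\<^sub>R v - sin t *\<^sub>R x"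

lemma velocity_0 [simp]: "velocity x v 0 = v"
  by (simp add: velocity_def)

lemma unit_tangent_velocity:
  assumes "x \<in> S2" "unit_tangent x v"
  shows "geodesic x v t \<in> S2" "unit_tangent (geodesic x v t) (velocity x v t)"
proof -
  have xx: "x \<bullet> x = 1" "v \<bullet> v = 1" "x \<bullet> v = 0" "v \<bullet> x = 0"
    using assms by (auto simp: unit_tangent_def norm_eq_1 inner_commute)
  have 1: "geodesic x v t \<bullet> geodesic x v t = 1"
    unfolding geodesic_def using xx sin_cos_squared_add3[of t]
    by (simp add: inner_simps algebra_simps)
  then show "geodesic x v t \<in> S2" by (simp add: norm_eq_1)
  have 2: "velocity x v t \<bullet> velocity x v t = 1"
    unfolding velocity_def using xx sin_cos_squared_add3[of t]
    by (simp add: inner_simps algebra_simps)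
  have 3: "velocity x v t \<bullet> geodesic x v t = 0"
    unfolding velocity_def geodesic_def using xx
    by (simp add: inner_simps algebra_simps)
  show "unit_tangent (geodesic x v t) (velocity x v t)"
    using 2 3 by (simp add: unit_tangent_def norm_eq_1)
qed

lemma geodesic_add: "geodesic (geodesic x v a) (velocity x v a) b = geodesic x v (a + b)"
  by (simp add: geodesic_def velocity_def cos_add sin_add algebra_simps)

lemma velocity_add: "velocity (geodesic x v a) (velocity x v a) b = velocity x v (a + b)"
  by (simp add: geodesic_def velocity_def cos_add sin_add algebra_simps)

lemma geodesic_shift: "geodesic x v s = geodesic (geodesic x v t) (velocity x v t) (s - t)"
  by (simp add: geodesic_add)

lemma geodesic_minus: "geodesic x (- v) s = geodesic x v (- s)"
  by (simp add: geodesic_def)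

lemma inner_geodesic: "n \<bullet> geodesic x v t = cos t * (n \<bullet> x) + sin t * (n \<bullet> v)"
  by (simp add: geodesic_def inner_simps)

lemma dist_geodesic:
  assumes "x \<in> S2" "unit_tangent x v"
  shows "dist (geodesic x v a) (geodesic x v b) \<le> \<bar>a - b\<bar>"
proof -
  have xx: "x \<bullet> x = 1" "v \<bullet> v = 1" "x \<bullet> v = 0" "v \<bullet> x = 0"
    using assms by (auto simp: unit_tangent_def norm_eq_1 inner_commute)
  have "(dist (geodesic x v a) (geodesic x v b))\<^sup>2 = (cos a - cos b)\<^sup>2 + (sin a - sin b)\<^sup>2"
    unfolding dist_norm power2_norm_eq_inner geodesic_def using xx
    by (simp add: inner_simps algebra_simps power2_eq_square)
  also have "\<dots> = 2 - 2 * cos (a - b)"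
    using sin_cos_squared_add[of a] sin_cos_squared_add[of b]
    by (simp add: cos_diff power2_diff algebra_simps)
  also have "\<dots> = (2 * sin ((a - b) / 2))\<^sup>2"
    using cos_double_sin[of "(a - b) / 2"] by (simp add: power2_eq_square diff_divide_distrib)
  also have "\<dots> \<le> (a - b)\<^sup>2"
    using abs_sin_x_le_abs_x[of "(a - b) / 2"] by (subst abs_le_square_iff[symmetric]) (simp add: abs_mult)
  finally show ?thesis
    using abs_le_square_iff[of "dist (geodesic x v a) (geodesic x v b)" "a - b"] by simp
qed

lemma dist_geodesic_dir: "dist (geodesic x u s) (geodesic x u' s) \<le> dist u u'"
proof -
  have "dist (geodesic x u s) (geodesic x u' s) = \<bar>sin s\<bar> * dist u u'"
    by (simp add: geodesic_def dist_norm flip: scaleR_diff_right)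
  then show ?thesis
    using mult_right_mono[OF abs_sin_le_one, of "dist u u'" s] by simp
qed

lemma linear_geodesic: "linear g \<Longrightarrow> g (geodesic x v s) = geodesic (g x) (g v) s"
  by (simp add: geodesic_def linear_add linear_cmul)

lemma continuous_on_geodesic [continuous_intros]:
  fixes f :: "'a::metric_space \<Rightarrow> real^3" and h :: "'a \<Rightarrow> real"
  assumes "continuous_on A f" "continuous_on A g" "continuous_on A h"
  shows "continuous_on A (\<lambda>a. geodesic (f a) (g a) (h a))"
  unfolding geodesic_def by (intro continuous_intros assms)

text \<open>Read as linear equations for \<open>x - y\<close> and \<open>v - w\<close>, the two
  hypotheses have determinant \<open>sin (a - b)\<close> up to sign.\<close>

lemma geodesic_eqD:
  assumes "geodesic x v a = geodesic y w a" "geodesic x v b = geodesic y w b" "sin (a - b) \<noteq> 0"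
  shows "x = y" "v = w"
proof -
  define X where "X = x - y"
  define Y where "Y = v - w"
  have 1: "cos a *\<^sub>R X + sin a *\<^sub>R Y = 0" and 2: "cos b *\<^sub>R X + sin b *\<^sub>R Y = 0"
    using assms(1,2) by (simp_all add: X_def Y_def geodesic_def algebra_simps)
  have "sin (a - b) *\<^sub>R X = sin a *\<^sub>R (cos b *\<^sub>R X + sin b *\<^sub>R Y) - sin b *\<^sub>R (cos a *\<^sub>R X + sin a *\<^sub>R Y)"
    by (simp add: sin_diff algebra_simps)
  moreover have "sin (a - b) *\<^sub>R Y = cos b *\<^sub>R (cos a *\<^sub>R X + sin a *\<^sub>R Y) - cos a *\<^sub>R (cos b *\<^sub>R X + sin b *\<^sub>R Y)"
    by (simp add: sin_diff algebra_simps)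
  ultimately have "X = 0" "Y = 0" using 1 2 assms(3) by auto
  then show "x = y" "v = w" by (auto simp: X_def Y_def)
qed

lemma geodesic_eq_intervalD:
  assumes "a < b" "\<And>s. a < s \<Longrightarrow> s < b \<Longrightarrow> geodesic x v s = geodesic y w s"
  shows "x = y" "v = w"
proof -
  \<comment> \<open>Two times at distance \<open>c < pi\<close>, placed symmetrically inside the
    interval, so that \<open>sin c\<close> does not vanish.\<close>
  define c where "c = min (b - a) 1 / 2"
  have c: "0 < c" "c < b - a" "c < pi"
    using assms(1) pi_gt3 by (auto simp: c_def)
  define d where "d = (b - a - c) / 2"
  have *: "sin ((a + d + c) - (a + d)) \<noteq> 0" using sin_gt_zero[of c] c by simp
  have "geodesic x v (a + d + c) = geodesic y w (a + d + c)" "geodesic x v (a + d) = geodesic y w (a + d)"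
    using c by (auto intro!: assms(2) simp: d_def field_simps)
  from geodesic_eqD[OF this *] show "x = y" "v = w" .
qed

section \<open>Reflections and the folding map\<close>

definition reflect :: "real^3 \<Rightarrow> real^3 \<Rightarrow> real^3" where
  "reflect n y = y - (2 * (n \<bullet> y)) *\<^sub>R n"

text \<open>The folding of space along a plane: for a unit vector \<open>n\<close> a continuous
  retraction onto the half-space \<open>0 \<le> n \<bullet> y\<close>, for \<open>n = 0\<close> the
  identity. Continuity across the plane is what turns a broken orbit into the image of one smooth
  geodesic.\<close>

definition fold_along :: "real^3 \<Rightarrow> real^3 \<Rightarrow> real^3" where
  "fold_along n y = y + (2 * max 0 (- (n \<bullet> y))) *\<^sub>R n"

lemma fold_along_pos: "0 \<le> n \<bullet> y \<Longrightarrow> fold_along n y = y"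
  by (simp add: fold_along_def)

lemma fold_along_neg: "n \<bullet> y \<le> 0 \<Longrightarrow> fold_along n y = reflect n y"
  by (simp add: fold_along_def reflect_def)

lemma fold_along_0 [simp]: "fold_along 0 y = y"
  by (simp add: fold_along_def)

lemma continuous_on_fold_along [continuous_intros]:
  fixes f :: "'a::topological_space \<Rightarrow> real^3"
  shows "continuous_on A f \<Longrightarrow> continuous_on A (\<lambda>a. fold_along n (f a))"
  unfolding fold_along_def by (intro continuous_intros)

lemma linear_reflect: "linear (reflect n)"
  by (rule linearI) (auto simp: reflect_def inner_simps algebra_simps)

lemma reflect_0 [simp]: "reflect 0 y = y"
  by (simp add: reflect_def)

lemma orthogonal_reflect: "n = 0 \<or> norm n = 1 \<Longrightarrow> orthogonal_transformation (reflect n)"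
  unfolding orthogonal_transformation_def
  using linear_reflect[of n]
  by (auto simp: reflect_def inner_simps norm_eq_1 inner_commute algebra_simps)

lemma reflect_reflect: "n = 0 \<or> norm n = 1 \<Longrightarrow> reflect n (reflect n y) = y"
  by (auto simp: reflect_def inner_simps norm_eq_1 scaleR_add_left[symmetric] algebra_simps)

lemma inner_reflect: "norm n = 1 \<Longrightarrow> n \<bullet> reflect n y = - (n \<bullet> y)"
  by (simp add: reflect_def inner_simps norm_eq_1)

lemma reflect_fix: "n \<bullet> y = 0 \<Longrightarrow> reflect n y = y"
  by (simp add: reflect_def)

lemma inner_fold_along: "norm n = 1 \<Longrightarrow> n \<bullet> fold_along n y = \<bar>n \<bullet> y\<bar>"
  by (cases "0 \<le> n \<bullet> y") (auto simp: fold_along_pos fold_along_neg inner_reflect)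

lemma orthogonal_transformation_unit_tangent:
  assumes "orthogonal_transformation g"
  shows "unit_tangent (g x) (g v) \<longleftrightarrow> unit_tangent x v" "g x \<in> S2 \<longleftrightarrow> x \<in> S2"
  using assms orthogonal_transformation_norm[OF assms]
  by (auto simp: unit_tangent_def orthogonal_transformation_def)

lemma dist_orthogonal_transformation:
  "orthogonal_transformation g \<Longrightarrow> dist (g x) (g y) = dist x (y :: real^3)"
  by (simp add: dist_norm orthogonal_transformation_norm orthogonal_transformation_linear flip: linear_diff)

lemma unit_tangent_fold:
  assumes "n = 0 \<or> norm n = 1"
  shows "fold_along n y \<in> S2 \<longleftrightarrow> y \<in> S2"
proof (cases "0 \<le> n \<bullet> y")
  case False
  then show ?thesis
    using orthogonal_transformation_unit_tangent(2)[OF orthogonal_reflect[OF assms], of y]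
    by (simp add: fold_along_neg)
qed (simp add: fold_along_pos)

lemma dist_fold_along:
  assumes "n = 0 \<or> norm n = 1" "n \<bullet> p = 0"
  shows "dist p (fold_along n y) = dist p y"
proof (cases "0 \<le> n \<bullet> y")
  case False
  then show ?thesis
    using dist_orthogonal_transformation[OF orthogonal_reflect[OF assms(1)], of p y] assms(2)
    by (simp add: fold_along_neg reflect_fix)
qed (simp add: fold_along_pos)

section \<open>Cross products and the circle of directions\<close>

lemma cross_cross: "cross3 a (cross3 b c) = (a \<bullet> c) *\<^sub>R b - (a \<bullet> b) *\<^sub>R c"
  by (simp add: cross3_simps) (auto simp: forall_3 exhaust_3 algebra_simps)

lemma unit_tangent_cross:
  assumes "x \<in> S2" "unit_tangent x v"
  shows "unit_tangent x (cross3 x v)" "unit_tangent v (cross3 x v)"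
proof -
  have "(norm (cross3 x v))\<^sup>2 = 1"
    using norm_cross_dot[of x v] assms by (simp add: unit_tangent_def inner_commute)
  then have "norm (cross3 x v) = 1"
    using norm_ge_zero[of "cross3 x v"] by (auto simp: power2_eq_1_iff)
  then show "unit_tangent x (cross3 x v)" "unit_tangent v (cross3 x v)"
    by (simp_all add: unit_tangent_def dot_cross_self)
qed

text \<open>As \<open>m\<close> is orthogonal to \<open>x\<close> and \<open>v\<close>,
  \<open>cross3 m (cross3 x v)\<close> vanishes; expanding \<open>cross3 c (cross3 m c)\<close> for
  \<open>c = cross3 x v\<close> then leaves only the component of \<open>m\<close> along
  \<open>c\<close>.\<close>

lemma orthogonal_both_imp_cross:
  assumes "x \<in> S2" "unit_tangent x v" "m \<bullet> x = 0" "m \<bullet> v = 0"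
  shows "m = (m \<bullet> cross3 x v) *\<^sub>R cross3 x v"
proof -
  define c where "c = cross3 x v"
  have c1: "norm c = 1" "c \<bullet> c = 1"
    using unit_tangent_cross[OF assms(1,2)] by (auto simp: c_def unit_tangent_def norm_eq_1)
  have "cross3 c (cross3 m c) = m - (c \<bullet> m) *\<^sub>R c"
    using cross_cross[of c m c] c1 by simp
  moreover have "cross3 m c = 0"
    unfolding c_def by (subst cross_cross) (simp add: assms)
  ultimately show ?thesis by (simp add: c_def inner_commute)
qed

lemma circle_param:
  assumes "x \<in> S2" "unit_tangent x e" "unit_tangent x u"
  obtains \<theta> where "- pi \<le> \<theta>" "\<theta> \<le> pi" "u = geodesic e (cross3 x e) \<theta>"
proof -
  define f where "f = cross3 x e"
  have f: "unit_tangent x f" "unit_tangent e f" using unit_tangent_cross assms by (auto simp: f_def)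
  define d where "d = u - (u \<bullet> e) *\<^sub>R e"
  have "d \<bullet> x = 0" "d \<bullet> e = 0"
    using assms by (auto simp: d_def unit_tangent_def inner_simps norm_eq_1)
  from orthogonal_both_imp_cross[OF assms(1,2) this] have "d = (d \<bullet> f) *\<^sub>R f"
    by (simp add: f_def)
  also have "d \<bullet> f = u \<bullet> f"
    using f by (simp add: d_def inner_simps unit_tangent_def inner_commute)
  finally have u: "u = (u \<bullet> e) *\<^sub>R e + (u \<bullet> f) *\<^sub>R f" by (simp add: d_def algebra_simps)
  have "1 = u \<bullet> u" using assms by (simp add: unit_tangent_def norm_eq_1)
  also have "\<dots> = (u \<bullet> e)\<^sup>2 + (u \<bullet> f)\<^sup>2"
    by (subst u, subst inner_add_right) (simp add: power2_eq_square)
  finally have "(u \<bullet> e)\<^sup>2 + (u \<bullet> f)\<^sup>2 = 1" by simp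
  \<comment> \<open>\<open>sincos_total_pi\<close> only yields angles with nonnegative sine; the
    lower half circle is reached by negating the sine.\<close>
  from sincos_total_pi[OF _ this] sincos_total_pi[of "- (u \<bullet> f)" "u \<bullet> e"] this
  consider t where "0 \<le> t" "t \<le> pi" "u \<bullet> e = cos t" "u \<bullet> f = sin t"
    | t where "0 \<le> t" "t \<le> pi" "u \<bullet> e = cos t" "- (u \<bullet> f) = sin t"
    by (cases "0 \<le> u \<bullet> f") auto
  then show ?thesis
  proof cases
    case 1
    then show ?thesis using that[of t] u by (simp add: geodesic_def f_def)
  next
    case 2
    then have "u = geodesic e f (- t)" using u by (simp add: geodesic_def flip: 2(4))
    then show ?thesis using that[of "- t"] 2 by (simp add: f_def)
  qed
qed

lemma unit_tangent_circle:
  assumes "x \<in> S2" "unit_tangent x e"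
  shows "unit_tangent x (geodesic e (cross3 x e) \<theta>)"
proof -
  have "e \<in> S2" "unit_tangent e (cross3 x e)" "unit_tangent x (cross3 x e)"
    using unit_tangent_cross[OF assms] assms by (auto simp: unit_tangent_def)
  from unit_tangent_velocity(1)[OF this(1,2), of \<theta>] this(3) assms show ?thesis
    by (simp add: unit_tangent_def inner_geodesic inner_commute[of _ x])
qed

lemma exists_unit_tangent: "x \<in> S2 \<Longrightarrow> \<exists>e. unit_tangent x e"
proof -
  assume x: "x \<in> S2"
  obtain y :: "real^3" where y: "y \<noteq> 0" "orthogonal x y"
    using orthogonal_to_vector_exists[of x] by auto
  then have "unit_tangent x (y /\<^sub>R norm y)"
    by (simp add: unit_tangent_def orthogonal_def inner_commute)
  then show ?thesis by blast
qed

text \<open>Bisection (\<open>Bolzano\<close>) globalises the estimate. The guards in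
  \<open>p\<close> are there because the local step of \<open>Bolzano\<close> ranges over all short
  intervals around \<open>t\<close>, including those that stick out of \<open>{a..b}\<close>, where
  nothing is known about \<open>f\<close>.\<close>

lemma local_lipschitz_imp_lipschitz:
  fixes f :: "real \<Rightarrow> 'a::metric_space"
  assumes "a \<le> b"
    and "\<And>t. a \<le> t \<Longrightarrow> t \<le> b \<Longrightarrow> \<exists>e>0. \<forall>s\<in>{a..b}. \<bar>s - t\<bar> < e \<longrightarrow> dist (f s) (f t) \<le> \<bar>s - t\<bar>"
  shows "dist (f a) (f b) \<le> b - a"
proof -
  define p where "p x y \<longleftrightarrow> (a \<le> x \<longrightarrow> y \<le> b \<longrightarrow> dist (f x) (f y) \<le> y - x)" for x y
  have "p a b"
    using \<open>a \<le> b\<close>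
  proof (induction rule: Bolzano)
    case (trans x y z)
    then show ?case
      unfolding p_def using dist_triangle[of "f x" "f z" "f y"] by fastforce
  next
    case (local t)
    from assms(2)[OF this] obtain e where e: "e > 0" "\<forall>s\<in>{a..b}. \<bar>s - t\<bar> < e \<longrightarrow> dist (f s) (f t) \<le> \<bar>s - t\<bar>" by blast
    have "p x y" if "x \<le> t" "t \<le> y" "y - x < e" for x y
      unfolding p_def
    proof (intro impI)
      assume "a \<le> x" "y \<le> b"
      then have "dist (f x) (f t) \<le> \<bar>x - t\<bar>" "dist (f y) (f t) \<le> \<bar>y - t\<bar>"
        using e(2)[rule_format, of x] e(2)[rule_format, of y] \<open>a \<le> x\<close> \<open>y \<le> b\<close> that local by simp_all
      then have "dist (f x) (f t) \<le> t - x" "dist (f y) (f t) \<le> y - t"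
        using that by auto
      then show "dist (f x) (f y) \<le> y - x"
        using dist_triangle2[of "f x" "f y" "f t"] by linarith
    qed
    with e(1) show ?case by blast
  qed
  then show ?thesis using \<open>a \<le> b\<close> by (simp add: p_def)
qed

section \<open>Local structure of the polygon\<close>

locale billiard =
  fixes P V :: "(real^3) set"
  assumes polygon: "geodesic_polygon P V"
begin

abbreviation I :: "(real^3) set" where "I \<equiv> sphere_interior P"
abbreviation F :: "(real^3) set" where "F \<equiv> sphere_frontier P"

lemma P_subset: "P \<subseteq> S2" and closed_P: "closed P" and finite_V: "finite V" and V_subset: "V \<subseteq> F"
  using polygon by (auto simp: geodesic_polygon_def compact_imp_closed)

lemma I_subset: "I \<subseteq> P" and I_open: "\<exists>U. open U \<and> I = S2 \<inter> U"
  using interior_of_subset[of "top_of_set S2" P] openin_interior_of[of "top_of_set S2" P]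
  unfolding openin_open by blast+

lemma F_eq: "F = P - I"
proof -
  have "closedin (top_of_set S2) P"
    using P_subset closed_P closed_subset by blast
  then show ?thesis
    by (simp add: frontier_of_def closure_of_closedin)
qed

lemma I_ball: "x \<in> I \<Longrightarrow> \<exists>e>0. \<forall>y\<in>S2. dist x y < e \<longrightarrow> y \<in> I"
proof -
  assume x: "x \<in> I"
  obtain U where U: "open U" "I = S2 \<inter> U" using I_open by blast
  then obtain e where "e > 0" "ball x e \<subseteq> U"
    using x openE by blast
  then show ?thesis using U by (auto simp: subset_eq)
qed

lemma in_I: "0 < e \<Longrightarrow> y \<in> S2 \<Longrightarrow> (\<And>z. z \<in> S2 \<Longrightarrow> dist y z < e \<Longrightarrow> z \<in> P) \<Longrightarrow> y \<in> I"
proof -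
  assume *: "0 < e" "y \<in> S2" "\<And>z. z \<in> S2 \<Longrightarrow> dist y z < e \<Longrightarrow> z \<in> P"
  have "S2 \<inter> ball y e \<subseteq> I"
    using * by (intro interior_of_maximal) (auto simp: openin_open)
  then show "y \<in> I" using * by auto
qed

text \<open>\<open>cross3 x v\<close> is normal to the plane of a side. Finiteness of
  \<open>N\<close> gives the isolation arguments near a corner and near a starting point, and it
  makes the frontier a null set.\<close>

lemma great_circles_cover_frontier: "\<exists>N. finite N \<and> 0 \<notin> N \<and> (\<forall>y\<in>F. \<exists>n\<in>N. n \<bullet> y = 0)"
proof -
  obtain A where A: "finite A" "\<forall>S\<in>A. geodesic_segment S" "F = \<Union>A"
    using polygon by (auto simp: geodesic_polygon_def)
  have "\<exists>n. n \<noteq> 0 \<and> (\<forall>y\<in>S. n \<bullet> y = 0)" if S: "S \<in> A" for S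
  proof -
    obtain x v L where x: "x \<in> S2" "unit_tangent x v" "S = geodesic x v ` {0..L}"
      using A(2) S by (auto simp: geodesic_segment_def)
    let ?n = "cross3 x v"
    have "unit_tangent x ?n" "unit_tangent v ?n" using unit_tangent_cross x by auto
    then show ?thesis using x by (intro exI[of _ ?n]) (auto simp: inner_geodesic unit_tangent_def)
  qed
  then obtain nn where nn: "\<And>S. S \<in> A \<Longrightarrow> nn S \<noteq> 0 \<and> (\<forall>y\<in>S. nn S \<bullet> y = 0)" by metis
  show ?thesis
    by (rule exI[of _ "nn ` A"]) (use nn A in force)
qed

text \<open>Here \<open>n = 0\<close> stands for an interior point of \<open>P\<close>, so that reflection at \<open>n\<close> is the identity there.\<close>

definition chart :: "real^3 \<Rightarrow> real^3 \<Rightarrow> real \<Rightarrow> bool" where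
  "chart x n r \<longleftrightarrow> x \<in> S2 \<and> 0 < r \<and> (n = 0 \<or> unit_tangent x n) \<and>
     (\<forall>y\<in>S2. dist x y < r \<longrightarrow> y \<notin> V \<and> (y \<in> P \<longleftrightarrow> 0 \<le> n \<bullet> y))"

lemma chart_norm: "chart x n r \<Longrightarrow> n = 0 \<or> norm n = 1" and chart_inner: "chart x n r \<Longrightarrow> n \<bullet> x = 0"
  by (auto simp: chart_def unit_tangent_def)

lemma chart_iff: "chart x n r \<Longrightarrow> y \<in> S2 \<Longrightarrow> dist x y < r \<Longrightarrow> y \<in> P \<longleftrightarrow> 0 \<le> n \<bullet> y"
  unfolding chart_def by blast

lemma chart_mem: "chart x n r \<Longrightarrow> x \<in> P - V"
  using chart_inner[of x n r] by (force simp: chart_def)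

lemma chart_I:
  assumes c: "chart x n r" and y: "y \<in> S2" "dist x y < r"
  shows "y \<in> I \<longleftrightarrow> n = 0 \<or> 0 < n \<bullet> y" "y \<in> F \<longleftrightarrow> n \<noteq> 0 \<and> n \<bullet> y = 0"
proof -
  have inP: "z \<in> P \<longleftrightarrow> 0 \<le> n \<bullet> z" if "z \<in> S2" "dist y z < r - dist x y" for z
    using c that dist_triangle[of x z y] by (auto simp: chart_def)
  have pos: "0 < r - dist x y" using y by simp
  show *: "y \<in> I \<longleftrightarrow> n = 0 \<or> 0 < n \<bullet> y"
  proof
    assume "n = 0 \<or> 0 < n \<bullet> y"
    then show "y \<in> I"
    proof
      assume "n = 0"
      then show ?thesis using in_I[OF pos y(1)] inP by simp
    next
      assume ny: "0 < n \<bullet> y"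
      then have "norm n = 1" using chart_norm[OF c] by auto
      have "z \<in> P" if "z \<in> S2" "dist y z < min (r - dist x y) (n \<bullet> y)" for z
      proof -
        have "\<bar>n \<bullet> (y - z)\<bar> \<le> norm (y - z)"
          using Cauchy_Schwarz_ineq2[of n "y - z"] \<open>norm n = 1\<close> by simp
        then have "0 \<le> n \<bullet> z" using that by (auto simp: inner_simps dist_norm)
        then show ?thesis using inP that by auto
      qed
      then show ?thesis using in_I[of "min (r - dist x y) (n \<bullet> y)"] y pos ny by auto
    qed
  next
    assume yI: "y \<in> I"
    show "n = 0 \<or> 0 < n \<bullet> y"
    proof (rule ccontr)
      assume "\<not> (n = 0 \<or> 0 < n \<bullet> y)"
      then have n: "norm n = 1" "n \<bullet> y \<le> 0" using chart_norm[OF c] by auto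
      moreover have "0 \<le> n \<bullet> y" using inP[of y] y yI I_subset by auto
      ultimately have ny: "n \<bullet> y = 0" by simp
      then have ut: "unit_tangent y (- n)" using n by (simp add: unit_tangent_def)
      obtain e where e: "e > 0" "\<forall>z\<in>S2. dist y z < e \<longrightarrow> z \<in> I" using I_ball yI by blast
      \<comment> \<open>A short step from \<open>y\<close> against \<open>n\<close> stays in both
        balls and crosses the mirror, since \<open>0 < s < pi\<close> makes \<open>sin s\<close>
        positive; it leaves \<open>P\<close> although \<open>y\<close> is supposed to be
        interior.\<close>
      define s where "s = min (min e (r - dist x y)) 1 / 2"
      have s: "0 < s" "s < e" "s < r - dist x y" "s < pi" using e pos pi_gt3 by (auto simp: s_def)
      let ?z = "geodesic y (- n) s"
      have z: "?z \<in> S2" using unit_tangent_velocity ut y by blast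
      have "dist y ?z \<le> s" using dist_geodesic[OF y(1) ut, of 0 s] s by simp
      then have "?z \<in> P" "?z \<in> S2" "dist y ?z < r - dist x y" using e s z I_subset by auto
      then have "0 \<le> n \<bullet> ?z" using inP by blast
      then have "0 \<le> - sin s" using ny n by (simp add: inner_geodesic norm_eq_1)
      then show False using sin_gt_zero[of s] s by simp
    qed
  qed
  show "y \<in> F \<longleftrightarrow> n \<noteq> 0 \<and> n \<bullet> y = 0"
    unfolding F_eq using * inP[of y] y by auto
qed

lemma chart_interior: "x \<in> I \<Longrightarrow> \<exists>r. chart x 0 r"
  using I_ball[of x] I_subset P_subset V_subset F_eq by (fastforce simp: chart_def)

lemma chart_inner_normal:
  assumes "inner_normal P x n" "x \<in> S2" "x \<notin> V"
  shows "\<exists>r. chart x n r"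
proof -
  obtain e where e: "e > 0" "\<forall>y\<in>S2. dist x y < e \<longrightarrow> (y \<in> P \<longleftrightarrow> 0 \<le> n \<bullet> y)" "unit_tangent x n"
    using assms(1) by (auto simp: inner_normal_def)
  have "open (- V)" using finite_imp_closed[OF finite_V] by auto
  then obtain d where "d > 0" "ball x d \<subseteq> - V"
    using assms(3) openE[of "- V" x] by auto
  then have "chart x n (min d e)"
    using e assms(2) by (auto simp: chart_def)
  then show ?thesis by blast
qed

lemma chart_exists: "x \<in> P - V \<Longrightarrow> \<exists>n r. chart x n r"
proof (cases "x \<in> I")
  case True
  then show ?thesis using chart_interior by blast
next
  case False
  moreover assume "x \<in> P - V"
  ultimately have "x \<in> F - V" "x \<in> S2" using F_eq P_subset by auto
  moreover obtain n where "inner_normal P x n"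
    using polygon \<open>x \<in> F - V\<close> unfolding geodesic_polygon_def by blast
  ultimately show ?thesis using chart_inner_normal by blast
qed

lemma chart_F: "chart x n r \<Longrightarrow> x \<in> F \<longleftrightarrow> n \<noteq> 0" "chart x n r \<Longrightarrow> x \<in> I \<longleftrightarrow> n = 0"
  using chart_I[of x n r x] chart_inner[of x n r] by (auto simp: chart_def)

lemma chart_imp_inner_normal: "chart x n r \<Longrightarrow> n \<noteq> 0 \<Longrightarrow> inner_normal P x n"
  by (auto simp: chart_def inner_normal_def)

lemma chart_unique:
  assumes "chart x n r" "chart x m r'"
  shows "n = m"
proof (cases "n = 0")
  case True
  then show ?thesis using chart_F assms by blast
next
  case n0: False
  then have m0: "m \<noteq> 0" using chart_F assms by blast
  have n: "n \<bullet> n = 1" "n \<bullet> x = 0" "unit_tangent x n" and m: "m \<bullet> m = 1" "m \<bullet> x = 0" "unit_tangent x m" and x: "x \<in> S2"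
    using assms n0 m0 by (auto simp: chart_def unit_tangent_def norm_eq_1)
  show ?thesis
  proof (rule ccontr)
    assume nm: "n \<noteq> m"
    \<comment> \<open>The direction \<open>m - n\<close> separates the two half-spaces: since
      \<open>n \<bullet> m < 1\<close>, its product with \<open>m\<close> is positive and its
      product with \<open>n\<close> negative.\<close>
    define d where "d = m - n"
    define w where "w = d /\<^sub>R norm d"
    have d0: "norm d > 0" using nm by (simp add: d_def)
    have w: "unit_tangent x w"
      using d0 n m by (simp add: w_def unit_tangent_def d_def inner_simps)
    define s where "s = min (min r r') 1 / 2"
    have s: "0 < s" "s < r" "s < r'" "s < pi" using assms pi_gt3 by (auto simp: s_def chart_def)
    let ?z = "geodesic x w s"
    have z: "?z \<in> S2" using unit_tangent_velocity w x by blast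
    have dz: "dist x ?z \<le> s" using dist_geodesic[OF x w, of 0 s] s by simp
    have "?z \<in> P \<longleftrightarrow> 0 \<le> n \<bullet> ?z" "?z \<in> P \<longleftrightarrow> 0 \<le> m \<bullet> ?z"
      using assms[THEN chart_iff, OF z] dz s by simp_all
    then have "0 \<le> sin s * (n \<bullet> w) \<longleftrightarrow> 0 \<le> sin s * (m \<bullet> w)"
      using n m by (simp add: inner_geodesic)
    then have "0 \<le> n \<bullet> w \<longleftrightarrow> 0 \<le> m \<bullet> w"
      using sin_gt_zero[of s] s by (simp add: zero_le_mult_iff)
    then have "0 \<le> n \<bullet> d \<longleftrightarrow> 0 \<le> m \<bullet> d"
      using d0 by (simp add: w_def zero_le_mult_iff)
    moreover have "0 < (norm d)\<^sup>2" using d0 by simp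
    then have "n \<bullet> m < 1" using n m by (simp add: power2_norm_eq_inner d_def inner_simps inner_commute)
    ultimately show False using n m by (simp add: d_def inner_simps inner_commute)
  qed
qed

text \<open>\<open>v\<close> is the velocity just before \<open>t\<close>, \<open>reflect n v\<close> the velocity just after \<open>t\<close>.\<close>

definition bounce :: "real set \<Rightarrow> (real \<Rightarrow> real^3) \<Rightarrow> real \<Rightarrow> real^3 \<Rightarrow> real^3 \<Rightarrow> real \<Rightarrow> bool" where
  "bounce J \<gamma> t v n e \<longleftrightarrow> unit_tangent (\<gamma> t) v \<and> 0 < e \<and> (\<exists>r. chart (\<gamma> t) n r) \<and>
     (\<forall>s\<in>J. t - e < s \<and> s \<le> t \<longrightarrow> \<gamma> s = geodesic (\<gamma> t) v (s - t)) \<and>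
     (\<forall>s\<in>J. t \<le> s \<and> s < t + e \<longrightarrow> \<gamma> s = geodesic (\<gamma> t) (reflect n v) (s - t))"

definition bounces :: "real set \<Rightarrow> (real \<Rightarrow> real^3) \<Rightarrow> real \<Rightarrow> bool" where
  "bounces J \<gamma> t \<longleftrightarrow> (\<exists>v n e. bounce J \<gamma> t v n e)"

lemma bounce_tangent:
  assumes "bounce J \<gamma> t v n e"
  shows "\<gamma> t \<in> S2" "unit_tangent (\<gamma> t) v" "unit_tangent (\<gamma> t) (reflect n v)" "\<gamma> t \<in> P" "\<gamma> t \<notin> V"
proof -
  obtain r where r: "chart (\<gamma> t) n r" and v: "unit_tangent (\<gamma> t) v"
    using assms by (auto simp: bounce_def)
  show "\<gamma> t \<in> S2" "unit_tangent (\<gamma> t) v" "\<gamma> t \<in> P" "\<gamma> t \<notin> V"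
    using v r chart_mem[OF r] by (auto simp: chart_def)
  have "unit_tangent (reflect n (\<gamma> t)) (reflect n v)"
    using orthogonal_transformation_unit_tangent(1)[OF orthogonal_reflect[OF chart_norm[OF r]]] v by blast
  then show "unit_tangent (\<gamma> t) (reflect n v)"
    using reflect_fix[OF chart_inner[OF r]] by simp
qed

lemma bounce_left:
  "bounce J \<gamma> t v n e \<Longrightarrow> s \<in> J \<Longrightarrow> t - e < s \<Longrightarrow> s \<le> t \<Longrightarrow> \<gamma> s = geodesic (\<gamma> t) v (s - t)"
  and bounce_right:
  "bounce J \<gamma> t v n e \<Longrightarrow> s \<in> J \<Longrightarrow> t \<le> s \<Longrightarrow> s < t + e \<Longrightarrow> \<gamma> s = geodesic (\<gamma> t) (reflect n v) (s - t)"
  unfolding bounce_def by blast+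

lemma bounce_pos: "bounce J \<gamma> t v n e \<Longrightarrow> 0 < e"
  and bounce_chart: "bounce J \<gamma> t v n e \<Longrightarrow> \<exists>r. chart (\<gamma> t) n r"
  unfolding bounce_def by blast+

lemma bounce_dist:
  assumes "bounce J \<gamma> t v n e" "s \<in> J" "\<bar>s - t\<bar> < e"
  shows "dist (\<gamma> s) (\<gamma> t) \<le> \<bar>s - t\<bar>"
proof -
  have "\<gamma> s = geodesic (\<gamma> t) v (s - t) \<or> \<gamma> s = geodesic (\<gamma> t) (reflect n v) (s - t)"
    using assms unfolding bounce_def by (cases "s \<le> t") auto
  then show ?thesis
    using dist_geodesic[of "\<gamma> t" v "s - t" 0] dist_geodesic[of "\<gamma> t" "reflect n v" "s - t" 0]
      bounce_tangent[OF assms(1)] by auto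
qed

lemma bounce_cong:
  assumes "bounce J \<gamma> t v n e" "0 < d" "t \<in> J'"
    and "\<And>s. s \<in> J' \<Longrightarrow> \<bar>s - t\<bar> < d \<Longrightarrow> s \<in> J \<and> \<beta> s = \<gamma> s"
  shows "bounce J' \<beta> t v n (min d e)"
proof -
  have "\<beta> t = \<gamma> t" using assms(2,3,4) by simp
  then show ?thesis using assms(1,2,4) unfolding bounce_def by auto
qed

lemma bounces_cong:
  assumes "bounces J \<gamma> t" "0 < d" "t \<in> J'"
    and "\<And>s. s \<in> J' \<Longrightarrow> \<bar>s - t\<bar> < d \<Longrightarrow> s \<in> J \<and> \<beta> s = \<gamma> s"
  shows "bounces J' \<beta> t"
  using assms bounce_cong unfolding bounces_def by meson

text \<open>In reversed time the orbit comes in with \<open>- reflect n v\<close> and leaves with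
  \<open>- v\<close>, because reflection is an involution.\<close>

lemma bounce_reverse:
  assumes "bounce J \<gamma> t v n e"
  shows "bounce ((\<lambda>s. c - s) ` J) (\<lambda>s. \<gamma> (c - s)) (c - t) (- reflect n v) n e"
proof -
  obtain r where r: "chart (\<gamma> t) n r" using assms by (auto simp: bounce_def)
  have *: "reflect n (- reflect n v) = - v"
    using reflect_reflect[OF chart_norm[OF r]] linear_neg[OF linear_reflect] by metis
  have "unit_tangent (\<gamma> t) (- reflect n v)"
    using bounce_tangent(3)[OF assms] by (simp add: unit_tangent_def)
  then show ?thesis
    using assms unfolding bounce_def *
    by (auto simp: geodesic_minus)
qed

lemma bounces_reverse:
  "bounces J \<gamma> t \<Longrightarrow> bounces ((\<lambda>s. c - s) ` J) (\<lambda>s. \<gamma> (c - s)) (c - t)"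
  unfolding bounces_def using bounce_reverse by blast

text \<open>The clauses for interior and for frontier points merge into one, because the normal
  \<open>n = 0\<close> encodes an interior point and \<open>reflect 0\<close> is the
  identity.\<close>

lemma regular_orbit_iff_bounces: "regular_orbit P V l \<gamma> \<longleftrightarrow> (\<forall>t\<in>{0..l}. bounces {0..l} \<gamma> t)"
proof (intro iffI ballI)
  fix t assume a: "regular_orbit P V l \<gamma>" and t: "t \<in> {0..l}"
  from bspec[OF a[unfolded regular_orbit_def] t] obtain v w e where *: "\<gamma> t \<in> P - V" "unit_tangent (\<gamma> t) v" "e > 0"
      "\<forall>s\<in>{0..l}. t - e < s \<and> s \<le> t \<longrightarrow> \<gamma> s = geodesic (\<gamma> t) v (s - t)"
      "\<forall>s\<in>{0..l}. t \<le> s \<and> s < t + e \<longrightarrow> \<gamma> s = geodesic (\<gamma> t) w (s - t)"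
      "\<gamma> t \<in> I \<longrightarrow> w = v"
      "\<gamma> t \<in> F \<longrightarrow> (\<exists>n. inner_normal P (\<gamma> t) n \<and> w = v - (2 * (v \<bullet> n)) *\<^sub>R n)"
    by (elim exE conjE) (rule that)
  have "\<exists>n. (\<exists>r. chart (\<gamma> t) n r) \<and> w = reflect n v"
  proof (cases "\<gamma> t \<in> I")
    case True
    then show ?thesis using chart_interior *(6) by (metis reflect_0)
  next
    case False
    then have "\<gamma> t \<in> F" using F_eq * by auto
    then obtain n where n: "inner_normal P (\<gamma> t) n" "w = v - (2 * (v \<bullet> n)) *\<^sub>R n" using *(7) by blast
    moreover have "\<exists>r. chart (\<gamma> t) n r"
      using chart_inner_normal[OF n(1)] *(1) P_subset by blast
    moreover have "w = reflect n v" by (simp only: n(2) reflect_def inner_commute)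
    ultimately show ?thesis by blast
  qed
  then obtain n where n: "\<exists>r. chart (\<gamma> t) n r" "w = reflect n v" by blast
  have "bounce {0..l} \<gamma> t v n e" unfolding bounce_def n(2)[symmetric] by (intro conjI n(1) *)
  then show "bounces {0..l} \<gamma> t" unfolding bounces_def by blast
next
  assume a: "\<forall>t\<in>{0..l}. bounces {0..l} \<gamma> t"
  show "regular_orbit P V l \<gamma>"
    unfolding regular_orbit_def
  proof (intro ballI)
    fix t assume "t \<in> {0..l}"
    with a obtain v n e where b: "bounce {0..l} \<gamma> t v n e" unfolding bounces_def by blast
    then obtain r where r: "chart (\<gamma> t) n r" by (auto simp: bounce_def)
    show "\<gamma> t \<in> P - V \<and>
        (\<exists>v w. unit_tangent (\<gamma> t) v \<and> unit_tangent (\<gamma> t) w \<and>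
           (\<exists>\<epsilon>>0. (\<forall>s\<in>{0..l}. t - \<epsilon> < s \<and> s \<le> t \<longrightarrow> \<gamma> s = geodesic (\<gamma> t) v (s - t)) \<and>
                  (\<forall>s\<in>{0..l}. t \<le> s \<and> s < t + \<epsilon> \<longrightarrow> \<gamma> s = geodesic (\<gamma> t) w (s - t))) \<and>
           (\<gamma> t \<in> I \<longrightarrow> w = v) \<and>
           (\<gamma> t \<in> F \<longrightarrow>
              (\<exists>n. inner_normal P (\<gamma> t) n \<and> w = v - (2 * (v \<bullet> n)) *\<^sub>R n)))"
    proof (intro conjI exI)
      show "\<gamma> t \<in> P - V" "unit_tangent (\<gamma> t) v" "unit_tangent (\<gamma> t) (reflect n v)"
        using bounce_tangent[OF b] by auto
      show "e > 0" "\<forall>s\<in>{0..l}. t - e < s \<and> s \<le> t \<longrightarrow> \<gamma> s = geodesic (\<gamma> t) v (s - t)"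
        "\<forall>s\<in>{0..l}. t \<le> s \<and> s < t + e \<longrightarrow> \<gamma> s = geodesic (\<gamma> t) (reflect n v) (s - t)"
        using b unfolding bounce_def by blast+
      show "\<gamma> t \<in> I \<longrightarrow> reflect n v = v" using chart_F[OF r] by auto
      show "\<gamma> t \<in> F \<longrightarrow> (\<exists>n'. inner_normal P (\<gamma> t) n' \<and> reflect n v = v - (2 * (v \<bullet> n')) *\<^sub>R n')"
        using chart_F[OF r] chart_imp_inner_normal[OF r] by (auto simp: reflect_def inner_commute)
    qed
  qed
qed

text \<open>Folding one free geodesic produces the law of reflection: the path is smooth off the
  mirror and bounces where the geodesic crosses it. The assumption \<open>trans\<close> keeps the
  geodesic from lying in the mirror altogether.\<close>

lemma fold_along_bounces:
  assumes c: "chart p n r" and y: "y \<in> S2" "unit_tangent y v"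
    and dist: "dist p (geodesic y v t) < r"
    and trans: "n = 0 \<or> n \<bullet> geodesic y v t\<^sub>0 \<noteq> 0"
  shows "bounces J (\<lambda>s. fold_along n (geodesic y v s)) t"
proof -
  define c where "c = geodesic y v"
  define c' where "c' = velocity y v t"
  have nn: "n = 0 \<or> norm n = 1" using chart_norm[OF assms(1)] .
  have ct: "c t \<in> S2" "unit_tangent (c t) c'" using unit_tangent_velocity y by (auto simp: c_def c'_def)
  have cs: "c s = geodesic (c t) c' (s - t)" for s
    by (simp add: c_def c'_def geodesic_shift[symmetric])
  have cont: "continuous_on UNIV c" unfolding c_def by (intro continuous_intros)
  then have ncont: "isCont (\<lambda>s. n \<bullet> c s) t"
    by (intro continuous_intros) (simp add: continuous_on_eq_continuous_at)
  have fI: "fold_along n (c t) \<in> S2" "dist p (fold_along n (c t)) < r"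
    using unit_tangent_fold[OF nn] ct dist_fold_along[OF nn chart_inner[OF assms(1)]] dist
    by (auto simp: c_def)
  have nf: "n \<noteq> 0 \<Longrightarrow> n \<bullet> fold_along n (c t) = \<bar>n \<bullet> c t\<bar>"
    using inner_fold_along nn by auto
  consider "n = 0" | "0 < n \<bullet> c t" | "n \<bullet> c t < 0" | "n \<noteq> 0" "n \<bullet> c t = 0" by linarith
  then have "bounces J (\<lambda>s. fold_along n (c s)) t"
  proof cases
    case 1
    have "c t \<in> I" using fI chart_I[OF assms(1)] 1 by auto
    then have "bounce J (\<lambda>s. fold_along n (c s)) t c' 0 1"
      using chart_interior ct 1 by (auto simp: bounce_def simp flip: cs)
    then show ?thesis by (auto simp: bounces_def)
  next
    case 2
    have I: "c t \<in> I" using fI chart_I[OF assms(1)] 2 by (auto simp: fold_along_pos)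
    have "eventually (\<lambda>s. 0 < n \<bullet> c s) (nhds t)"
      using ncont 2 by (intro order_tendstoD) (auto simp: isCont_def tendsto_nhds_iff)
    then obtain e where e: "e > 0" "\<And>s. \<bar>s - t\<bar> < e \<Longrightarrow> 0 < n \<bullet> c s"
      by (auto simp: eventually_nhds_metric dist_real_def)
    then have "bounce J (\<lambda>s. fold_along n (c s)) t c' 0 e"
      using chart_interior[OF I] ct e 2 by (auto simp: bounce_def fold_along_pos less_imp_le simp flip: cs)
    then show ?thesis by (auto simp: bounces_def)
  next
    case 3
    then have n1: "n \<noteq> 0" by auto
    have "0 < n \<bullet> fold_along n (c t)" using nf n1 3 by simp
    then have I: "fold_along n (c t) \<in> I" using fI chart_I[OF assms(1)] by auto
    have "eventually (\<lambda>s. n \<bullet> c s < 0) (nhds t)"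
      using ncont 3 by (intro order_tendstoD) (auto simp: isCont_def tendsto_nhds_iff)
    then obtain e where e: "e > 0" "\<And>s. \<bar>s - t\<bar> < e \<Longrightarrow> n \<bullet> c s < 0"
      by (auto simp: eventually_nhds_metric dist_real_def)
    have R: "reflect n (c s) = geodesic (reflect n (c t)) (reflect n c') (s - t)" for s
      by (subst cs) (simp add: linear_geodesic linear_reflect)
    have "unit_tangent (reflect n (c t)) (reflect n c')"
      using orthogonal_transformation_unit_tangent(1)[OF orthogonal_reflect[OF nn]] ct by blast
    then have "bounce J (\<lambda>s. fold_along n (c s)) t (reflect n c') 0 e"
      using chart_interior[OF I] e 3 by (auto simp: bounce_def fold_along_neg less_imp_le simp flip: R)
    then show ?thesis by (auto simp: bounces_def)
  next
    case 4
    then have n1: "norm n = 1" using nn by auto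
    have ft: "fold_along n (c t) = c t" using 4 by (simp add: fold_along_pos)
    have F: "c t \<in> F" using fI chart_I(2)[OF assms(1)] 4 ft by auto
    have ch: "\<exists>r. chart (c t) n r"
    proof -
      have "unit_tangent (c t) n" using 4 n1 by (simp add: unit_tangent_def)
      moreover have "z \<notin> V \<and> (z \<in> P \<longleftrightarrow> 0 \<le> n \<bullet> z)" if "z \<in> S2" "dist (c t) z < r - dist p (c t)" for z
        using assms(1) that dist_triangle[of p z "c t"] by (auto simp: chart_def)
      moreover have "0 < r - dist p (c t)" using dist by (simp add: c_def)
      ultimately have "chart (c t) n (r - dist p (c t))" unfolding chart_def using ct(1) by blast
      then show ?thesis by blast
    qed
    have ncs: "n \<bullet> c s = sin (s - t) * (n \<bullet> c')" for s
      by (subst cs) (simp add: inner_geodesic 4)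
    \<comment> \<open>By the preceding formula a tangential velocity would put the whole great
      circle into the mirror, including the time \<open>t\<^sub>0\<close>.\<close>
    then have "n \<bullet> c' \<noteq> 0" using trans 4 by (auto simp: c_def)
    have R: "reflect n (c s) = geodesic (c t) (reflect n c') (s - t)" for s
      by (subst cs) (simp add: linear_geodesic linear_reflect reflect_fix 4)
    have RR: "reflect n (reflect n c') = c'" using reflect_reflect nn by blast
    have ut: "unit_tangent (c t) (reflect n c')"
      using orthogonal_transformation_unit_tangent(1)[OF orthogonal_reflect[OF nn], of "c t" c'] ct 4
      by (simp add: reflect_fix)
    have sn: "sin (s - t) \<ge> 0" if "t \<le> s" "s < t + 1" for s
      using that sin_ge_zero[of "s - t"] pi_gt3 by simp
    have sp: "sin (s - t) \<le> 0" if "t - 1 < s" "s \<le> t" for s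
      using that sin_ge_zero[of "t - s"] pi_gt3 sin_minus[of "t - s"] by simp
    \<comment> \<open>The sign tells from which side \<open>c\<close> meets the mirror. Coming from
      the positive side, the fold acts after \<open>t\<close> and the incoming velocity is
      \<open>c'\<close>; coming from the negative side, it acts before \<open>t\<close> and the
      incoming velocity is the mirror image of \<open>c'\<close>.\<close>
    consider "n \<bullet> c' < 0" | "n \<bullet> c' > 0" using \<open>n \<bullet> c' \<noteq> 0\<close> by linarith
    then show ?thesis
    proof cases
      case 1
      have "bounce J (\<lambda>s. fold_along n (c s)) t c' n 1"
        unfolding bounce_def ft
      proof (intro conjI ballI impI)
        fix s assume "t - 1 < s \<and> s \<le> t"
        then have "0 \<le> n \<bullet> c s" using sp[of s] 1 by (simp add: ncs mult_nonpos_nonpos)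
        then show "fold_along n (c s) = geodesic (c t) c' (s - t)" by (simp add: fold_along_pos flip: cs)
      next
        fix s assume "t \<le> s \<and> s < t + 1"
        then have "n \<bullet> c s \<le> 0" using sn[of s] 1 by (simp add: ncs mult_nonneg_nonpos)
        then show "fold_along n (c s) = geodesic (c t) (reflect n c') (s - t)" by (simp add: fold_along_neg flip: R)
      qed (use ct ch in auto)
      then show ?thesis by (auto simp: bounces_def)
    next
      case 2
      have "bounce J (\<lambda>s. fold_along n (c s)) t (reflect n c') n 1"
        unfolding bounce_def ft RR
      proof (intro conjI ballI impI)
        fix s assume "t - 1 < s \<and> s \<le> t"
        then have "n \<bullet> c s \<le> 0" using sp[of s] 2 by (simp add: ncs mult_nonpos_nonneg)
        then show "fold_along n (c s) = geodesic (c t) (reflect n c') (s - t)" by (simp add: fold_along_neg flip: R)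
      next
        fix s assume "t \<le> s \<and> s < t + 1"
        then have "0 \<le> n \<bullet> c s" using sn[of s] 2 by (simp add: ncs)
        then show "fold_along n (c s) = geodesic (c t) c' (s - t)" by (simp add: fold_along_pos flip: cs)
      qed (use ut ch in auto)
      then show ?thesis by (auto simp: bounces_def)
    qed
  qed
  then show ?thesis by (simp add: c_def)
qed

end

section \<open>Orbits\<close>

context billiard
begin

text \<open>
  Orbits that start at an interior point or at a corner, in a direction that stays in the interior
  for some time. The behaviour at the starting point itself is not constrained by \<open>bounces\<close>.
\<close>

definition ray_orbit :: "real^3 \<Rightarrow> real^3 \<Rightarrow> real \<Rightarrow> (real \<Rightarrow> real^3) \<Rightarrow> bool" where
  "ray_orbit x u T \<gamma> \<longleftrightarrow> x \<in> S2 \<and> unit_tangent x u \<and> 0 < T \<and>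
     (\<exists>e>0. (\<forall>s. 0 \<le> s \<and> s < e \<and> s \<le> T \<longrightarrow> \<gamma> s = geodesic x u s) \<and>
            (\<forall>s. 0 < s \<and> s < e \<longrightarrow> geodesic x u s \<in> I)) \<and>
     (\<forall>t. 0 < t \<and> t \<le> T \<longrightarrow> bounces {0..T} \<gamma> t)"

lemma ray_orbit_start:
  assumes "ray_orbit x u T \<gamma>"
  obtains e where "0 < e" "e \<le> T" "\<And>s. 0 \<le> s \<Longrightarrow> s < e \<Longrightarrow> \<gamma> s = geodesic x u s"
    "\<And>s. 0 < s \<Longrightarrow> s < e \<Longrightarrow> geodesic x u s \<in> I"
proof -
  obtain e where "e > 0" "\<forall>s. 0 \<le> s \<and> s < e \<and> s \<le> T \<longrightarrow> \<gamma> s = geodesic x u s"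
      "\<forall>s. 0 < s \<and> s < e \<longrightarrow> geodesic x u s \<in> I" "0 < T"
    using assms unfolding ray_orbit_def by blast
  then show ?thesis using that[of "min e T"] by simp
qed

lemma ray_orbit_basic:
  assumes "ray_orbit x u T \<gamma>"
  shows "0 < T" "x \<in> S2" "unit_tangent x u" "\<gamma> 0 = x"
  using assms ray_orbit_start[OF assms] unfolding ray_orbit_def by (force+)

lemma ray_orbit_bounces: "ray_orbit x u T \<gamma> \<Longrightarrow> 0 < t \<Longrightarrow> t \<le> T \<Longrightarrow> bounces {0..T} \<gamma> t"
  by (auto simp: ray_orbit_def)

lemma ray_orbit_cong:
  assumes "ray_orbit x u T \<gamma>" "0 < T'" "T' \<le> T" "\<And>s. 0 \<le> s \<Longrightarrow> s \<le> T' \<Longrightarrow> \<beta> s = \<gamma> s"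
  shows "ray_orbit x u T' \<beta>"
proof -
  obtain e where e: "e > 0" "\<And>s. 0 \<le> s \<Longrightarrow> s < e \<Longrightarrow> \<gamma> s = geodesic x u s"
      "\<And>s. 0 < s \<Longrightarrow> s < e \<Longrightarrow> geodesic x u s \<in> I"
    using ray_orbit_start[OF assms(1)] by metis
  have "bounces {0..T'} \<beta> t" if "0 < t" "t \<le> T'" for t
    by (rule bounces_cong[OF ray_orbit_bounces[OF assms(1)], of t 1]) (use that assms(3,4) in auto)
  moreover have "\<exists>e>0. (\<forall>s. 0 \<le> s \<and> s < e \<and> s \<le> T' \<longrightarrow> \<beta> s = geodesic x u s) \<and>
            (\<forall>s. 0 < s \<and> s < e \<longrightarrow> geodesic x u s \<in> I)"
    using e assms(4) by (intro exI[of _ e]) auto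
  ultimately show ?thesis
    using ray_orbit_basic[OF assms(1)] assms(2) unfolding ray_orbit_def by blast
qed

text \<open>Just before \<open>t\<close> an orbit is a geodesic arc. Any subinterval of it
  determines the point at \<open>t\<close>, the incoming velocity and, by
  \<open>chart_unique\<close>, the normal; hence also the way out.\<close>

lemma bounce_agree:
  assumes b: "bounce J \<gamma> t v n e" "bounce J' \<gamma>' t v' n' e'"
    and ab: "a < b" "b \<le> t" "t - e \<le> a" "t - e' \<le> a"
    and eq: "\<And>s. a < s \<Longrightarrow> s < b \<Longrightarrow> s \<in> J \<and> s \<in> J' \<and> \<gamma> s = \<gamma>' s"
  shows "\<gamma> t = \<gamma>' t" "v = v'" "n = n'"
proof -
  have *: "geodesic (\<gamma> t) v s = geodesic (\<gamma>' t) v' s" if "a - t < s" "s < b - t" for s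
  proof -
    have "\<gamma> (s + t) = geodesic (\<gamma> t) v (s + t - t)" "\<gamma>' (s + t) = geodesic (\<gamma>' t) v' (s + t - t)"
      by (rule bounce_left[OF b(1)] bounce_left[OF b(2)]; use that ab eq[of "s + t"] in simp)+
    then show ?thesis using eq[of "s + t"] that by simp
  qed
  show "\<gamma> t = \<gamma>' t" "v = v'"
    using geodesic_eq_intervalD[of "a - t" "b - t", OF _ *] ab by simp_all
  then show "n = n'" using bounce_chart[OF b(1)] bounce_chart[OF b(2)] chart_unique by auto
qed

lemma ray_orbit_unique_aux:
  assumes o: "ray_orbit x u T \<gamma>" "ray_orbit x u T \<gamma>'" and s: "0 \<le> s" "s \<le> T"
  shows "\<gamma> s = \<gamma>' s"
proof -
  define E where "E a \<longleftrightarrow> (\<forall>s. 0 \<le> s \<and> s \<le> a \<longrightarrow> \<gamma> s = \<gamma>' s)" for a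
  define p where "p a b \<longleftrightarrow> (0 < a \<longrightarrow> b \<le> T \<longrightarrow> E a \<longrightarrow> E b)" for a b
  obtain e1 where e1: "e1 > 0" "e1 \<le> T" "\<And>s. 0 \<le> s \<Longrightarrow> s < e1 \<Longrightarrow> \<gamma> s = geodesic x u s"
    using ray_orbit_start[OF o(1)] by metis
  obtain e2 where e2: "e2 > 0" "e2 \<le> T" "\<And>s. 0 \<le> s \<Longrightarrow> s < e2 \<Longrightarrow> \<gamma>' s = geodesic x u s"
    using ray_orbit_start[OF o(2)] by metis
  define h where "h = min e1 e2 / 2"
  have h: "0 < h" "h < e1" "h < e2" "h \<le> T" using e1 e2 by (auto simp: h_def)
  have "p h T"
    using h(4)
  proof (induction rule: Bolzano)
    case (trans a b c)
    then show ?case by (auto simp: p_def)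
  next
    case (local t)
    with h have t: "0 < t" "t \<le> T" by auto
    obtain v n e where b1: "bounce {0..T} \<gamma> t v n e"
      using ray_orbit_bounces[OF o(1) t] by (auto simp: bounces_def)
    obtain v' n' e' where b2: "bounce {0..T} \<gamma>' t v' n' e'"
      using ray_orbit_bounces[OF o(2) t] by (auto simp: bounces_def)
    \<comment> \<open>From \<open>t - a < d\<close> follows \<open>t - 2 * d < a\<close>, so that a
      whole interval of agreement remains before \<open>a\<close> to which
      \<open>bounce_agree\<close> applies.\<close>
    define d where "d = min (min e e') t / 2"
    have d: "0 < d" "2 * d \<le> e" "2 * d \<le> e'" "2 * d \<le> t"
      using bounce_pos[OF b1] bounce_pos[OF b2] t by (auto simp: d_def)
    have "p a b" if ab: "a \<le> t" "t \<le> b" "b - a < d" for a b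
      unfolding p_def E_def
    proof (intro impI allI)
      fix s assume *: "0 < a" "b \<le> T" "\<forall>s. 0 \<le> s \<and> s \<le> a \<longrightarrow> \<gamma> s = \<gamma>' s" "0 \<le> s \<and> s \<le> b"
      have "s \<in> {0..T} \<and> s \<in> {0..T} \<and> \<gamma> s = \<gamma>' s" if "t - 2 * d < s" "s < a" for s
        using that d *(3) ab t by simp
      from bounce_agree[OF b1 b2 _ _ _ _ this, of "t - 2 * d" a]
      have eq: "\<gamma> t = \<gamma>' t" "v = v'" "n = n'"
        using d ab by simp_all
      show "\<gamma> s = \<gamma>' s"
      proof (cases "s \<le> a")
        case True
        then show ?thesis using * by auto
      next
        case False
        then have s: "t - e < s" "s < t + e" "t - e' < s" "s < t + e'" "s \<in> {0..T}" using ab * d by auto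
        show ?thesis
        proof (cases "s \<le> t")
          case True
          from bounce_left[OF b1 s(5,1) True] bounce_left[OF b2 s(5,3) True] show ?thesis using eq by simp
        next
          case False
          then have "t \<le> s" by simp
          from bounce_right[OF b1 s(5) this s(2)] bounce_right[OF b2 s(5) this s(4)] show ?thesis using eq by simp
        qed
      qed
    qed
    then show ?case using d by blast
  qed
  moreover have "E h"
    unfolding E_def using e1(3) e2(3) h by simp
  ultimately have "E T" using h by (simp add: p_def)
  then show ?thesis using s by (simp add: E_def)
qed

lemma ray_orbit_unique:
  assumes "ray_orbit x u T \<gamma>" "ray_orbit x u T' \<gamma>'" and s: "0 \<le> s" "s \<le> T" "s \<le> T'"
  shows "\<gamma> s = \<gamma>' s"
proof -
  have T: "0 < T" "0 < T'" using assms ray_orbit_basic by auto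
  have "ray_orbit x u (min T T') \<gamma>" "ray_orbit x u (min T T') \<gamma>'"
    using assms(1,2) T by (auto intro: ray_orbit_cong)
  from ray_orbit_unique_aux[OF this] show ?thesis using s by simp
qed

lemma ray_orbit_dist:
  assumes o: "ray_orbit x u T \<gamma>" and s: "0 \<le> a" "a \<le> b" "b \<le> T"
  shows "dist (\<gamma> a) (\<gamma> b) \<le> b - a"
proof (rule local_lipschitz_imp_lipschitz[OF s(2)])
  fix t assume t: "a \<le> t" "t \<le> b"
  show "\<exists>e>0. \<forall>s\<in>{a..b}. \<bar>s - t\<bar> < e \<longrightarrow> dist (\<gamma> s) (\<gamma> t) \<le> \<bar>s - t\<bar>"
  proof (cases "t = 0")
    case True
    obtain e where e: "e > 0" "e \<le> T" "\<And>s. 0 \<le> s \<Longrightarrow> s < e \<Longrightarrow> \<gamma> s = geodesic x u s"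
      using ray_orbit_start[OF o] by metis
    show ?thesis
    proof (intro exI[of _ e] conjI ballI impI)
      fix s' assume "s' \<in> {a..b}" "\<bar>s' - t\<bar> < e"
      then show "dist (\<gamma> s') (\<gamma> t) \<le> \<bar>s' - t\<bar>"
        using e(3)[of s'] e(3)[of 0] dist_geodesic[of x u s' 0] ray_orbit_basic[OF o] e(1) s True by auto
    qed (use e in auto)
  next
    case False
    then have "0 < t" "t \<le> T" using s t by auto
    from ray_orbit_bounces[OF o this] obtain v n e where b: "bounce {0..T} \<gamma> t v n e"
      by (auto simp: bounces_def)
    then show ?thesis
      using bounce_dist[OF b] s bounce_pos[OF b] by (intro exI[of _ e]) auto
  qed
qed

lemma ray_orbit_mem:
  assumes "ray_orbit x u T \<gamma>" "0 < t" "t \<le> T"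
  shows "\<gamma> t \<in> P" "\<gamma> t \<notin> V" "\<gamma> t \<in> S2"
  using ray_orbit_bounces[OF assms] bounce_tangent(1,4,5) unfolding bounces_def by metis+

text \<open>
  An orbit tangent to a side would run along sides forever, also backwards in time; hence the set of
  times around which the orbit stays in the frontier is open and closed.
\<close>

lemma ray_orbit_punctured:
  assumes o: "ray_orbit x u T \<gamma>" and t: "0 < t" "t \<le> T"
  shows "\<exists>e>0. \<forall>s. 0 < s \<and> s \<le> T \<and> s \<noteq> t \<and> \<bar>s - t\<bar> < e \<longrightarrow> \<gamma> s \<in> I"
proof -
  define f where "f t \<longleftrightarrow> (\<exists>e>0. \<forall>s\<in>{0<..T}. \<bar>s - t\<bar> < e \<longrightarrow> \<gamma> s \<in> F)" for t
  have dichotomy: "f t \<or> (\<exists>e>0. \<forall>s\<in>{0<..T}. s \<noteq> t \<and> \<bar>s - t\<bar> < e \<longrightarrow> \<gamma> s \<notin> F)" if t: "0 < t" "t \<le> T" for t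
  proof -
    obtain v n e where b: "bounce {0..T} \<gamma> t v n e"
      using ray_orbit_bounces[OF o t] by (auto simp: bounces_def)
    then obtain r where r: "chart (\<gamma> t) n r" using bounce_chart by blast
    define d where "d = min (min e r) 1"
    have d: "0 < d" "d \<le> e" "d \<le> r" "d \<le> 1" using bounce_pos[OF b] r by (auto simp: d_def chart_def)
    have F: "\<gamma> s \<in> F \<longleftrightarrow> n \<noteq> 0 \<and> n \<bullet> \<gamma> s = 0" if s: "s \<in> {0<..T}" "\<bar>s - t\<bar> < d" for s
    proof -
      have "dist (\<gamma> s) (\<gamma> t) < r" using bounce_dist[OF b, of s] s d by auto
      then show ?thesis
        using chart_I(2)[OF r, of "\<gamma> s"] ray_orbit_mem[OF o, of s] s by (auto simp: dist_commute)
    qed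
    \<comment> \<open>Before and after \<open>t\<close> the modulus is the same, as reflection only
      changes the sign of \<open>n \<bullet> v\<close>. So near \<open>t\<close> the orbit is in the
      mirror either always or at \<open>t\<close> alone.\<close>
    have n: "\<bar>n \<bullet> \<gamma> s\<bar> = \<bar>sin (s - t)\<bar> * \<bar>n \<bullet> v\<bar>" if s: "s \<in> {0<..T}" "\<bar>s - t\<bar> < d" "n \<noteq> 0" for s
    proof -
      have "norm n = 1" "n \<bullet> \<gamma> t = 0" using chart_norm[OF r] chart_inner[OF r] s by auto
      moreover have "\<gamma> s = geodesic (\<gamma> t) v (s - t) \<or> \<gamma> s = geodesic (\<gamma> t) (reflect n v) (s - t)"
        using bounce_left[OF b, of s] bounce_right[OF b, of s] s d by fastforce
      ultimately show ?thesis by (auto simp: inner_geodesic inner_reflect abs_mult)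
    qed
    show ?thesis
    proof (cases "n = 0 \<or> n \<bullet> v \<noteq> 0")
      case True
      have "\<gamma> s \<notin> F" if s: "s \<in> {0<..T}" "s \<noteq> t" "\<bar>s - t\<bar> < d" for s
      proof -
        have "sin (s - t) \<noteq> 0"
          using s d pi_gt3 sin_gt_zero[of "s - t"] sin_gt_zero[of "t - s"] sin_minus[of "s - t"]
          by (cases "s < t") auto
        then show ?thesis using F n s True by force
      qed
      then show ?thesis using d by blast
    next
      case False
      then have "f t" unfolding f_def using F n d(1) by force
      then show ?thesis ..
    qed
  qed
  have const: "f a = f b" if "a \<in> {0<..T}" "b \<in> {0<..T}" for a b
  proof (rule connected_local_const[OF _ that])
    show "\<forall>a\<in>{0<..T}. \<forall>\<^sub>F b in at a within {0<..T}. f a = f b"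
    proof
      fix a assume a: "a \<in> {0<..T}"
      show "\<forall>\<^sub>F b in at a within {0<..T}. f a = f b"
      proof (cases "f a")
        case True
        then obtain e where e: "e > 0" "\<forall>s\<in>{0<..T}. \<bar>s - a\<bar> < e \<longrightarrow> \<gamma> s \<in> F" by (auto simp: f_def)
        have "f b" if "\<bar>b - a\<bar> < e" for b
          unfolding f_def using e that by (intro exI[of _ "e - \<bar>b - a\<bar>"]) auto
        then show ?thesis
          using True e(1) by (auto simp: eventually_at dist_real_def)
      next
        case False
        then obtain e where e: "e > 0" "\<forall>s\<in>{0<..T}. s \<noteq> a \<and> \<bar>s - a\<bar> < e \<longrightarrow> \<gamma> s \<notin> F"
          using dichotomy a by auto
        then have "\<not> f b" if "b \<in> {0<..T}" "b \<noteq> a" "\<bar>b - a\<bar> < e" for b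
          using that by (force simp: f_def)
        then show ?thesis
          using False e(1) by (auto simp: eventually_at dist_real_def)
      qed
    qed
  qed (simp add: connected_Ioc)
  obtain e where e: "e > 0" "e \<le> T" "\<And>s. 0 \<le> s \<Longrightarrow> s < e \<Longrightarrow> \<gamma> s = geodesic x u s"
      "\<And>s. 0 < s \<Longrightarrow> s < e \<Longrightarrow> geodesic x u s \<in> I"
    using ray_orbit_start[OF o] by metis
  then have "\<gamma> (e/2) \<notin> F" using F_eq by auto
  then have "\<not> f (e/2)" using e(1,2) by (auto simp: f_def intro!: bexI[of _ "e/2"])
  moreover have "f t = f (e/2)" using const[of t "e/2"] t e(1,2) by simp
  ultimately obtain e' where e': "e' > 0" "\<forall>s\<in>{0<..T}. s \<noteq> t \<and> \<bar>s - t\<bar> < e' \<longrightarrow> \<gamma> s \<notin> F"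
    using dichotomy[OF t] by auto
  then show ?thesis
    using ray_orbit_mem[OF o] F_eq by (intro exI[of _ e']) auto
qed

lemma ray_orbit_interior_before:
  assumes o: "ray_orbit x u T \<gamma>" and t: "0 < t" "t \<le> T" "d > 0"
  shows "\<exists>s. 0 < s \<and> t - d < s \<and> s < t \<and> \<gamma> s \<in> I"
proof -
  obtain e where e: "e > 0" "\<forall>s. 0 < s \<and> s \<le> T \<and> s \<noteq> t \<and> \<bar>s - t\<bar> < e \<longrightarrow> \<gamma> s \<in> I"
    using ray_orbit_punctured[OF o t(1,2)] by blast
  define h where "h = min (min e d) t / 2"
  have h: "0 < h" "h < e" "h < d" "h < t" using e t by (auto simp: h_def)
  then show ?thesis using e(2) t by (intro exI[of _ "t - h"]) auto
qed

text \<open>With a tangential velocity the last arc before \<open>t\<close> would lie in the mirror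
  and hence in the frontier, but interior times occur arbitrarily close before
  \<open>t\<close>.\<close>

lemma ray_orbit_transversal:
  assumes o: "ray_orbit x u T \<gamma>" and t: "0 < t" "t \<le> T"
    and b: "bounce {0..T} \<gamma> t v n e" "n \<noteq> 0"
  shows "n \<bullet> v \<noteq> 0"
proof
  assume nv: "n \<bullet> v = 0"
  obtain r where r: "chart (\<gamma> t) n r" using bounce_chart[OF b(1)] by blast
  have "0 < min e r" using bounce_pos[OF b(1)] r by (simp add: chart_def)
  then obtain s where s: "0 < s" "t - min e r < s" "s < t" "\<gamma> s \<in> I"
    using ray_orbit_interior_before[OF o t] by blast
  have "\<gamma> s = geodesic (\<gamma> t) v (s - t)" using s t by (intro bounce_left[OF b(1)]) auto
  then have "n \<bullet> \<gamma> s = 0" using nv chart_inner[OF r] by (simp add: inner_geodesic)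
  moreover have "t - s < min e r" using s(2) by linarith
  then have "dist (\<gamma> t) (\<gamma> s) < r"
    using bounce_dist[OF b(1), of s] s t by (simp add: dist_commute)
  ultimately show False
    using chart_I(1)[OF r, of "\<gamma> s"] s t b(2) ray_orbit_mem[OF o, of s] by auto
qed

section \<open>Prolongation of orbits\<close>

lemma ray_orbit_geodesic:
  assumes "x \<in> S2" "unit_tangent x u" "\<And>s. 0 < s \<Longrightarrow> s < e \<Longrightarrow> geodesic x u s \<in> I" "0 < T" "T < e"
  shows "ray_orbit x u T (geodesic x u)"
proof -
  have "bounces {0..T} (geodesic x u) t" if "0 < t" "t \<le> T" for t
  proof -
    have "bounce {0..T} (geodesic x u) t (velocity x u t) 0 1"
      unfolding bounce_def
      using chart_interior[OF assms(3)[of t]] unit_tangent_velocity[OF assms(1,2)] that assms(5)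
      by (simp add: geodesic_add)
    then show ?thesis by (auto simp: bounces_def)
  qed
  then show ?thesis
    unfolding ray_orbit_def using assms by (intro conjI exI[of _ e]) auto
qed

text \<open>Within one chart an orbit is continued by folding its current geodesic. That the orbit
  is interior at \<open>t\<^sub>1\<close> serves twice: there the fold is the identity, so that the
  two pieces fit, and the geodesic does not lie in the mirror.\<close>

lemma ray_orbit_extend:
  assumes o: "ray_orbit x u t\<^sub>1 \<gamma>" and I: "\<gamma> t\<^sub>1 \<in> I" and c: "chart p n r"
    and y: "y \<in> S2" "unit_tangent y v"
    and d: "0 < d" "\<And>s. t\<^sub>1 - d < s \<Longrightarrow> s \<le> t\<^sub>1 \<Longrightarrow> 0 \<le> s \<Longrightarrow> \<gamma> s = geodesic y v s"
    and T: "t\<^sub>1 \<le> T" "\<And>s. t\<^sub>1 \<le> s \<Longrightarrow> s \<le> T \<Longrightarrow> dist p (geodesic y v s) < r"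
  shows "ray_orbit x u T (\<lambda>s. if s \<le> t\<^sub>1 then \<gamma> s else fold_along n (geodesic y v s))"
    (is "ray_orbit x u T ?\<beta>")
proof -
  have t1: "0 < t\<^sub>1" using ray_orbit_basic[OF o] by simp
  have g1: "\<gamma> t\<^sub>1 = geodesic y v t\<^sub>1" using d t1 by simp
  then have pos: "n = 0 \<or> 0 < n \<bullet> geodesic y v t\<^sub>1"
    using chart_I(1)[OF c, of "\<gamma> t\<^sub>1"] T unit_tangent_velocity[OF y] I by simp
  have fold: "bounces {0..T} (\<lambda>s. fold_along n (geodesic y v s)) t" if "t\<^sub>1 \<le> t" "t \<le> T" for t
    using fold_along_bounces[OF c y, of t t\<^sub>1] T that pos by auto
  \<comment> \<open>On a two-sided neighbourhood of \<open>t\<^sub>1\<close> the fold does nothing,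
    so the glued path is a folded geodesic on both sides of the seam.\<close>
  obtain d' where d': "d' > 0" "\<And>s. \<bar>s - t\<^sub>1\<bar> < d' \<Longrightarrow> 0 \<le> n \<bullet> geodesic y v s"
  proof (cases "n = 0")
    case True
    then show ?thesis using that[of 1] by simp
  next
    case False
    have "isCont (\<lambda>s. n \<bullet> geodesic y v s) t\<^sub>1"
      unfolding geodesic_def by (intro continuous_intros)
    then have "eventually (\<lambda>s. 0 < n \<bullet> geodesic y v s) (nhds t\<^sub>1)"
      using pos False by (intro order_tendstoD) (auto simp: isCont_def tendsto_nhds_iff)
    then show ?thesis
      using that by (auto simp: eventually_nhds_metric dist_real_def less_imp_le)
  qed
  have b: "bounces {0..T} ?\<beta> t" if t: "0 < t" "t \<le> T" for t
  proof -
    consider "t < t\<^sub>1" | "t = t\<^sub>1" | "t\<^sub>1 < t" by linarith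
    then show ?thesis
    proof cases
      case 1
      then show ?thesis
        by (intro bounces_cong[OF ray_orbit_bounces[OF o, of t], of "t\<^sub>1 - t"]) (use t in auto)
    next
      case 2
      have "?\<beta> s = fold_along n (geodesic y v s)" if "s \<in> {0..T}" "\<bar>s - t\<^sub>1\<bar> < min d d'" for s
        using that d(2)[of s] d'(2)[of s] by (auto simp: fold_along_pos)
      then show ?thesis
        by (intro bounces_cong[OF fold[of t], of "min d d'"]) (use 2 t d(1) d'(1) in auto)
    next
      case 3
      then show ?thesis
        by (intro bounces_cong[OF fold[of t], of "t - t\<^sub>1"]) (use t in auto)
    qed
  qed
  obtain e where "e > 0" "e \<le> t\<^sub>1" "\<And>s. 0 \<le> s \<Longrightarrow> s < e \<Longrightarrow> \<gamma> s = geodesic x u s"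
      "\<And>s. 0 < s \<Longrightarrow> s < e \<Longrightarrow> geodesic x u s \<in> I"
    using ray_orbit_start[OF o] by metis
  then have "\<exists>e>0. (\<forall>s. 0 \<le> s \<and> s < e \<and> s \<le> T \<longrightarrow> ?\<beta> s = geodesic x u s) \<and>
            (\<forall>s. 0 < s \<and> s < e \<longrightarrow> geodesic x u s \<in> I)"
    by (intro exI[of _ e]) auto
  then show ?thesis
    unfolding ray_orbit_def using b t1 T ray_orbit_basic[OF o] by auto
qed

lemma ray_orbit_prolong:
  assumes o: "ray_orbit x u t\<^sub>1 \<gamma>" and I: "\<gamma> t\<^sub>1 \<in> I" and c: "chart p n r"
    and T: "t\<^sub>1 \<le> T" "dist p (\<gamma> t\<^sub>1) + (T - t\<^sub>1) < r"
  shows "\<exists>\<beta>. ray_orbit x u T \<beta>"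
proof -
  have t1: "0 < t\<^sub>1" using ray_orbit_basic[OF o] by simp
  obtain v m e where b: "bounce {0..t\<^sub>1} \<gamma> t\<^sub>1 v m e"
    using ray_orbit_bounces[OF o t1] by (auto simp: bounces_def)
  \<comment> \<open>The last arc is traced back to time 0, so that it reads
    \<open>geodesic y w s\<close> in the running time \<open>s\<close>.\<close>
  define y where "y = geodesic (\<gamma> t\<^sub>1) v (- t\<^sub>1)"
  define w where "w = velocity (\<gamma> t\<^sub>1) v (- t\<^sub>1)"
  have y: "y \<in> S2" "unit_tangent y w"
    using unit_tangent_velocity bounce_tangent[OF b] by (auto simp: y_def w_def)
  have yw: "geodesic y w s = geodesic (\<gamma> t\<^sub>1) v (s - t\<^sub>1)" for s
    by (simp add: y_def w_def geodesic_add)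
  have "dist p (geodesic y w s) < r" if "t\<^sub>1 \<le> s" "s \<le> T" for s
    using dist_geodesic[OF y, of t\<^sub>1 s] dist_triangle[of p "geodesic y w s" "\<gamma> t\<^sub>1"] that T
    by (simp add: yw)
  moreover have "\<gamma> s = geodesic y w s" if "t\<^sub>1 - e < s" "s \<le> t\<^sub>1" "0 \<le> s" for s
    unfolding yw by (rule bounce_left[OF b]) (use that in auto)
  ultimately show ?thesis
    using ray_orbit_extend[OF o I c y bounce_pos[OF b], of T] T(1) by blast
qed

text \<open>An orbit may end on a side. Bounces being isolated, a slightly longer one ends in the
  interior, as the stability argument requires.\<close>

lemma ray_orbit_continue:
  assumes o: "ray_orbit x u T \<gamma>"
  shows "\<exists>T'>T. \<exists>\<beta>. ray_orbit x u T' \<beta> \<and> \<beta> T' \<in> I"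
proof -
  have T: "0 < T" using ray_orbit_basic[OF o] by simp
  obtain n r where r: "chart (\<gamma> T) n r"
    using chart_exists ray_orbit_mem[OF o T] by blast
  have r0: "0 < r" using r by (simp add: chart_def)
  obtain s where s: "0 < s" "T - r / 3 < s" "s < T" "\<gamma> s \<in> I"
    using ray_orbit_interior_before[OF o T order_refl, of "r / 3"] r0 by auto
  have os: "ray_orbit x u s \<gamma>" using ray_orbit_cong[OF o, of s] s by auto
  \<comment> \<open>Less than \<open>r / 3\<close> back from \<open>T\<close> and
    \<open>r / 3\<close> beyond it: the distance is below \<open>r / 3\<close>, the time to cover
    below \<open>2 * r / 3\<close>.\<close>
  have "dist (\<gamma> T) (\<gamma> s) + (T + r / 3 - s) < r"
    using ray_orbit_dist[OF o, of s T] s by (simp add: dist_commute)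
  then obtain \<beta> where \<beta>: "ray_orbit x u (T + r / 3) \<beta>"
    using ray_orbit_prolong[OF os s(4) r, of "T + r / 3"] s r0 by auto
  obtain e where e: "e > 0" "\<forall>s. 0 < s \<and> s \<le> T + r / 3 \<and> s \<noteq> T \<and> \<bar>s - T\<bar> < e \<longrightarrow> \<beta> s \<in> I"
    using ray_orbit_punctured[OF \<beta> T] r0 by auto
  define h where "h = min e (r / 3) / 2"
  have h: "0 < h" "h < e" "h < r / 3" using e r0 by (auto simp: h_def)
  have "ray_orbit x u (T + h) \<beta>" "\<beta> (T + h) \<in> I"
    using ray_orbit_cong[OF \<beta>, of "T + h"] e h T by auto
  then show ?thesis using h by (intro exI[of _ "T + h"]) auto
qed

text \<open>Let \<open>c\<close> be the supremum of the times that orbits reach. Orbits are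
  1-Lipschitz, hence have a limit \<open>q\<close> at time \<open>c\<close>; if \<open>q\<close>
  were not a corner, the chart at \<open>q\<close> would carry the orbit beyond
  \<open>c\<close>.\<close>

lemma ray_orbit_blocked:
  assumes o: "ray_orbit x u T\<^sub>0 \<gamma>\<^sub>0" and l: "0 < l" and blocked: "\<nexists>\<gamma>. ray_orbit x u l \<gamma>"
  shows "\<exists>T \<Gamma>. 0 < T \<and> T \<le> l \<and> \<Gamma> T \<in> V \<and> (\<forall>t. 0 < t \<and> t < T \<longrightarrow> ray_orbit x u t \<Gamma>) \<and>
    (\<forall>s. 0 \<le> s \<and> s \<le> T \<longrightarrow> dist (\<Gamma> s) (\<Gamma> T) \<le> T - s)"
proof -
  define S where "S = {T. \<exists>\<gamma>. ray_orbit x u T \<gamma>}"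
  define c where "c = Sup S"
  have Sl: "T < l" if TS: "T \<in> S" for T
  proof (rule ccontr)
    assume "\<not> T < l"
    then show False using that l blocked ray_orbit_cong unfolding S_def by fastforce
  qed
  then have bdd: "bdd_above S" by (meson bdd_aboveI less_imp_le)
  have T0: "T\<^sub>0 \<in> S" "0 < T\<^sub>0" using o ray_orbit_basic[OF o] by (auto simp: S_def)
  have c: "0 < c" "c \<le> l"
    using cSup_upper[OF T0(1) bdd] T0 cSup_least[of S l] Sl unfolding c_def by (auto simp: less_imp_le)
  have below: "t \<in> S" if "0 < t" "t < c" for t
  proof -
    obtain T where "T \<in> S" "t < T" using \<open>t < c\<close> less_cSup_iff[OF _ bdd] T0 unfolding c_def by auto
    then show ?thesis using \<open>0 < t\<close> ray_orbit_cong unfolding S_def by fastforce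
  qed
  \<comment> \<open>Some orbit lives until \<open>(s + c) / 2\<close>, which is later than
    \<open>s\<close>. By uniqueness the value does not depend on the orbit chosen, so a single
    function serves all times below \<open>c\<close>.\<close>
  define \<Gamma>' where "\<Gamma>' s = (SOME \<gamma>. ray_orbit x u ((s + c) / 2) \<gamma>) s" for s
  have \<Gamma>': "ray_orbit x u t \<Gamma>'" if t: "0 < t" "t < c" for t
  proof -
    obtain \<gamma> where \<gamma>: "ray_orbit x u t \<gamma>" using below[OF t] by (auto simp: S_def)
    have "\<Gamma>' s = \<gamma> s" if s: "0 \<le> s" "s \<le> t" for s
    proof -
      have "(s + c) / 2 \<in> S" using below[of "(s + c) / 2"] s t by auto
      then have "ray_orbit x u ((s + c) / 2) (SOME \<gamma>. ray_orbit x u ((s + c) / 2) \<gamma>)"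
        unfolding S_def using someI_ex[of "\<lambda>\<gamma>. ray_orbit x u ((s + c) / 2) \<gamma>"] by blast
      from ray_orbit_unique[OF this \<gamma>, of s] show ?thesis
        using s t by (simp add: \<Gamma>'_def)
    qed
    then show ?thesis using ray_orbit_cong[OF \<gamma>] t by auto
  qed
  have lip: "dist (\<Gamma>' a) (\<Gamma>' b) \<le> \<bar>a - b\<bar>" if ab: "0 \<le> a" "a < c" "0 \<le> b" "b < c" for a b
  proof -
    have "ray_orbit x u ((max a b + c) / 2) \<Gamma>'" using \<Gamma>' c ab by auto
    from ray_orbit_dist[OF this, of a b] ray_orbit_dist[OF this, of b a] show ?thesis
      using ab by (cases "a \<le> b") (auto simp: dist_commute)
  qed
  \<comment> \<open>A sequence in \<open>{0<..<c}\<close> that tends to \<open>c\<close>; the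
    summand 2 keeps \<open>\<sigma> 0\<close> positive.\<close>
  define \<sigma> where "\<sigma> n = c - c / (real n + 2)" for n :: nat
  have \<sigma>: "0 < \<sigma> n" "\<sigma> n < c" for n
  proof -
    have "c / (real n + 2) < c / 1" using c by (intro divide_strict_left_mono) auto
    then show "0 < \<sigma> n" "\<sigma> n < c" using c by (auto simp: \<sigma>_def)
  qed
  have "(\<lambda>n. c / (real n + 2)) \<longlonglongrightarrow> 0"
    by (intro tendsto_divide_0[OF tendsto_const] filterlim_at_top_imp_at_infinity
        filterlim_tendsto_add_at_top[OF tendsto_const filterlim_real_sequentially, of 2, simplified add.commute])
  then have \<sigma>lim: "\<sigma> \<longlonglongrightarrow> c"
    unfolding \<sigma>_def using tendsto_diff[OF tendsto_const, of "\<lambda>n. c / (real n + 2)" 0] by force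
  have "Cauchy (\<lambda>n. \<Gamma>' (\<sigma> n))"
  proof (rule metric_CauchyI)
    fix e :: real assume "0 < e"
    then obtain M where "\<forall>m\<ge>M. \<forall>n\<ge>M. dist (\<sigma> m) (\<sigma> n) < e"
      using metric_CauchyD[OF LIMSEQ_imp_Cauchy[OF \<sigma>lim]] by blast
    moreover have "dist (\<Gamma>' (\<sigma> m)) (\<Gamma>' (\<sigma> n)) \<le> dist (\<sigma> m) (\<sigma> n)" for m n
      using lip[of "\<sigma> m" "\<sigma> n"] \<sigma>[of m] \<sigma>[of n] by (simp add: dist_real_def)
    ultimately show "\<exists>M. \<forall>m\<ge>M. \<forall>n\<ge>M. dist (\<Gamma>' (\<sigma> m)) (\<Gamma>' (\<sigma> n)) < e"
      by (meson le_less_trans)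
  qed
  then obtain q where q: "(\<lambda>n. \<Gamma>' (\<sigma> n)) \<longlonglongrightarrow> q"
    using Cauchy_convergent_iff convergent_def by blast
  have dq: "dist (\<Gamma>' s) q \<le> c - s" if s: "0 \<le> s" "s < c" for s
  proof (rule tendsto_le[OF sequentially_bot])
    show "(\<lambda>n. dist (\<Gamma>' s) (\<Gamma>' (\<sigma> n))) \<longlonglongrightarrow> dist (\<Gamma>' s) q" by (intro tendsto_intros q)
    show "(\<lambda>n. \<bar>s - \<sigma> n\<bar>) \<longlonglongrightarrow> c - s"
      using tendsto_rabs[OF tendsto_diff[OF tendsto_const[of s] \<sigma>lim]] s by simp
    show "\<forall>\<^sub>F n in sequentially. dist (\<Gamma>' s) (\<Gamma>' (\<sigma> n)) \<le> \<bar>s - \<sigma> n\<bar>"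
      using lip[of s] s \<sigma> by (simp add: less_imp_le)
  qed
  have "\<Gamma>' (\<sigma> n) \<in> P" for n using ray_orbit_mem(1)[OF \<Gamma>'[of "\<sigma> n"], of "\<sigma> n"] \<sigma>[of n] by auto
  then have qP: "q \<in> P" using closed_sequentially[OF closed_P, of "\<lambda>n. \<Gamma>' (\<sigma> n)" q] q by blast
  have qV: "q \<in> V"
  proof (rule ccontr)
    assume "q \<notin> V"
    then obtain n r where r: "chart q n r" using chart_exists qP by blast
    have r0: "0 < r" using r by (simp add: chart_def)
    \<comment> \<open>The point \<open>s\<close> found below satisfies \<open>c - s < r / 3\<close>,
      so the distance to \<open>q\<close> plus the time until \<open>c + r / 6\<close> stays below
      \<open>5 * r / 6\<close>. The bound \<open>c / 2\<close> keeps \<open>t\<close>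
      positive.\<close>
    define t where "t = c - min (r / 6) (c / 2)"
    have t: "0 < t" "t < c" "c - r / 6 \<le> t" using c r0 by (auto simp: t_def)
    obtain s where s: "0 < s" "t - r / 6 < s" "s < t" "\<Gamma>' s \<in> I"
      using ray_orbit_interior_before[OF \<Gamma>'[OF t(1,2)] t(1) order_refl, of "r / 6"] r0 by auto
    have os: "ray_orbit x u s \<Gamma>'" using \<Gamma>' s t by auto
    have "dist q (\<Gamma>' s) + (c + r / 6 - s) < r"
      using dq[of s] s t by (simp add: dist_commute)
    then obtain \<beta> where "ray_orbit x u (c + r / 6) \<beta>"
      using ray_orbit_prolong[OF os s(4) r, of "c + r / 6"] s t r0 by auto
    then have "c + r / 6 \<le> c" unfolding c_def by (intro cSup_upper[OF _ bdd]) (auto simp: S_def c_def)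
    then show False using r0 by simp
  qed
  define \<Gamma> where "\<Gamma> s = (if s < c then \<Gamma>' s else q)" for s
  show ?thesis
  proof (intro exI[of _ c] exI[of _ \<Gamma>] conjI allI impI)
    show "\<Gamma> c \<in> V" using qV by (simp add: \<Gamma>_def)
    fix t assume "0 < t \<and> t < c"
    then show "ray_orbit x u t \<Gamma>"
      by (intro ray_orbit_cong[OF \<Gamma>'[of t]]) (auto simp: \<Gamma>_def)
  next
    fix s assume "0 \<le> s \<and> s \<le> c"
    then show "dist (\<Gamma> s) (\<Gamma> c) \<le> c - s" using dq[of s] by (auto simp: \<Gamma>_def)
  qed (use c in auto)
qed

end

section \<open>Orbits running into a corner\<close>

text \<open>Bessel's inequality for the orthonormal pair \<open>x\<close>, \<open>v\<close>, with
  its defect. A vanishing defect puts \<open>q\<close> on the great circle that the geodesic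
  follows.\<close>

lemma bessel_defect:
  assumes "x \<in> S2" "unit_tangent x v" "q \<in> S2"
  shows "(norm (q - (q \<bullet> x) *\<^sub>R x - (q \<bullet> v) *\<^sub>R v))\<^sup>2 = 1 - ((q \<bullet> x)\<^sup>2 + (q \<bullet> v)\<^sup>2)"
proof -
  have xx: "x \<bullet> x = 1" "v \<bullet> v = 1" "x \<bullet> v = 0" "v \<bullet> x = 0" "q \<bullet> q = 1"
    using assms by (auto simp: unit_tangent_def norm_eq_1 inner_commute)
  show ?thesis
    unfolding power2_norm_eq_inner using xx
    by (simp add: inner_simps inner_commute[of x q] inner_commute[of v q] power2_eq_square algebra_simps)
qed

text \<open>Position and velocity are rotated within their plane, so the length of the projection of
  \<open>q\<close> to this plane is constant.\<close>

lemma geodesic_energy: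
  "(q \<bullet> geodesic x v t)\<^sup>2 + (q \<bullet> velocity x v t)\<^sup>2 = (q \<bullet> x)\<^sup>2 + (q \<bullet> v)\<^sup>2"
proof -
  have "(c * a + d * b)\<^sup>2 + (c * b - d * a)\<^sup>2 = (c\<^sup>2 + d\<^sup>2) * (a\<^sup>2 + b\<^sup>2)" for a b c d :: real
    by (simp add: power2_eq_square algebra_simps)
  from this[of "cos t" "q \<bullet> x" "sin t" "q \<bullet> v"] show ?thesis
    by (simp add: geodesic_def velocity_def inner_simps)
qed

lemma inner_sphere_dist:
  assumes "x \<in> S2" "q \<in> S2"
  shows "q \<bullet> x = 1 - (dist x q)\<^sup>2 / 2"
proof -
  have "x \<bullet> x = 1" "q \<bullet> q = 1" using assms by (auto simp: norm_eq_1)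
  then show ?thesis
    unfolding dist_norm power2_norm_eq_inner by (simp add: inner_simps inner_commute field_simps)
qed

context billiard
begin

text \<open>The frontier lies on finitely many great circles, and those that miss \<open>q\<close>
  stay away from it. The mirror at a nearby \<open>y\<close> turns out to be one of the listed
  circles; it passes through \<open>y\<close>, hence through \<open>q\<close>.\<close>

lemma corner_normals:
  "\<exists>e>0. \<forall>y n r. dist y q < e \<longrightarrow> chart y n r \<longrightarrow> n \<bullet> q = 0"
proof -
  obtain N where N: "finite N" "0 \<notin> N" "\<forall>y\<in>F. \<exists>n\<in>N. n \<bullet> y = 0"
    using great_circles_cover_frontier by blast
  have "\<forall>m\<in>N. eventually (\<lambda>y. m \<bullet> y = 0 \<longrightarrow> m \<bullet> q = 0) (nhds q)"
  proof
    fix m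
    show "eventually (\<lambda>y. m \<bullet> y = 0 \<longrightarrow> m \<bullet> q = 0) (nhds q)"
    proof (cases "m \<bullet> q = 0")
      case False
      have "((\<lambda>y. m \<bullet> y) \<longlongrightarrow> m \<bullet> q) (nhds q)"
        by (intro tendsto_intros filterlim_ident)
      from tendsto_imp_eventually_ne[OF this False] show ?thesis
        by (rule eventually_mono) simp
    qed simp
  qed
  from eventually_ball_finite[OF N(1) this]
  obtain e where e: "e > 0" "\<And>y m. dist y q < e \<Longrightarrow> m \<in> N \<Longrightarrow> m \<bullet> y = 0 \<Longrightarrow> m \<bullet> q = 0"
    unfolding eventually_nhds_metric by blast
  have "n \<bullet> q = 0" if y: "dist y q < e" and c: "chart y n r" for y n r
  proof (cases "n = 0")
    case False
    \<comment> \<open>\<open>w\<close> runs along the side, and \<open>c\<close> spans the normal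
      line of its plane. Infinitely many points of the side are spread over finitely many circles,
      so two of them share a circle \<open>m\<close>, which forces \<open>m\<close> to be parallel
      to \<open>c\<close>.\<close>
    define w where "w = cross3 y n"
    define c where "c = cross3 y w"
    have n: "unit_tangent y n" "y \<in> S2" "r > 0" using c False by (auto simp: chart_def)
    have w: "unit_tangent y w" "unit_tangent n w" using unit_tangent_cross n by (auto simp: w_def)
    define A where "A = {0<..<min r 1}"
    have "\<exists>m\<in>N. m \<bullet> geodesic y w s = 0" if "s \<in> A" for s
    proof -
      have "geodesic y w s \<in> S2" "dist y (geodesic y w s) < r"
        using unit_tangent_velocity n w dist_geodesic[of y w 0 s] that by (auto simp: A_def)
      then have "geodesic y w s \<in> F"
        using chart_I(2)[OF c] n w False by (auto simp: inner_geodesic unit_tangent_def inner_commute)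
      then show ?thesis using N by blast
    qed
    then obtain f where f: "\<And>s. s \<in> A \<Longrightarrow> f s \<in> N \<and> f s \<bullet> geodesic y w s = 0" by metis
    have "infinite A" "finite (f ` A)"
      using n(3) f N(1) by (auto simp: A_def intro: finite_subset[of _ N])
    from pigeonhole_infinite[OF this] obtain a where a: "a \<in> A" "infinite {s\<in>A. f s = f a}" by blast
    have "\<not> {s\<in>A. f s = f a} \<subseteq> {a}" using a(2) finite_subset[of _ "{a}"] by blast
    then obtain b where b: "b \<in> A" "f b = f a" "b \<noteq> a" by blast
    define m where "m = f a"
    have m: "m \<in> N" "m \<bullet> geodesic y w a = 0" "m \<bullet> geodesic y w b = 0" "m \<noteq> 0"
      using f[OF a(1)] f[OF b(1)] b N(2) by (auto simp: m_def)
    have sin: "sin (a - b) \<noteq> 0"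
      using a b pi_gt3 sin_gt_zero[of "a - b"] sin_gt_zero[of "b - a"] sin_minus[of "a - b"]
      by (cases "b < a") (auto simp: A_def)
    have 1: "cos a * (m \<bullet> y) + sin a * (m \<bullet> w) = 0" "cos b * (m \<bullet> y) + sin b * (m \<bullet> w) = 0"
      using m by (simp_all add: inner_geodesic)
    have "sin (a - b) * (m \<bullet> y) = sin a * (cos b * (m \<bullet> y) + sin b * (m \<bullet> w)) - sin b * (cos a * (m \<bullet> y) + sin a * (m \<bullet> w))"
      "sin (a - b) * (m \<bullet> w) = cos b * (cos a * (m \<bullet> y) + sin a * (m \<bullet> w)) - cos a * (cos b * (m \<bullet> y) + sin b * (m \<bullet> w))"
      by (simp_all add: sin_diff algebra_simps)
    then have my: "m \<bullet> y = 0" "m \<bullet> w = 0" using 1 sin by auto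
    have mc: "m = (m \<bullet> c) *\<^sub>R c" and nc: "n = (n \<bullet> c) *\<^sub>R c"
      using orthogonal_both_imp_cross[OF n(2) w(1)] my n w
      by (auto simp: c_def unit_tangent_def inner_commute)
    have "m \<bullet> q = 0" using e(2)[OF y m(1) my(1)] .
    then have "c \<bullet> q = 0" using mc m(4) by (metis inner_scaleR_left mult_eq_0_iff scale_zero_left)
    then show ?thesis using nc by (metis inner_scaleR_left mult_zero_right)
  qed simp
  then show ?thesis using e(1) by blast
qed

lemma bounce_velocity:
  assumes b: "bounce J \<gamma> s v n e" and a: "a < s"
    and g: "\<And>s'. a < s' \<Longrightarrow> s' \<le> s \<Longrightarrow> s' \<in> J \<and> \<gamma> s' = geodesic y w s'"
  shows "v = velocity y w s"
proof (rule geodesic_eq_intervalD(2))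
  show "max a (s - e) - s < 0" using a bounce_pos[OF b] by auto
  fix \<sigma> assume \<sigma>: "max a (s - e) - s < \<sigma>" "\<sigma> < 0"
  have "geodesic (\<gamma> s) v \<sigma> = \<gamma> (s + \<sigma>)"
    using bounce_left[OF b, of "s + \<sigma>"] \<sigma> g[of "s + \<sigma>"] by auto
  also have "\<dots> = geodesic (geodesic y w s) (velocity y w s) \<sigma>"
    using g[of "s + \<sigma>"] \<sigma> by (simp add: geodesic_add)
  finally show "geodesic (\<gamma> s) v \<sigma> = geodesic (geodesic y w s) (velocity y w s) \<sigma>" .
qed

text \<open>
  Near a corner \<open>q\<close> all sides pass through \<open>q\<close>, so a reflection does not change the component of the
  velocity along \<open>q\<close> and \<open>(q \<bullet> \<Gamma>)\<^sup>2 + (q \<bullet> \<Gamma>')\<^sup>2\<close> is conserved. For an orbit that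
  tends to \<open>q\<close> it equals 1, so that the orbit always heads straight to or from \<open>q\<close>. It would then be
  tangent to any side that it hits.
\<close>

lemma corner_radial:
  assumes o: "\<And>t. 0 < t \<Longrightarrow> t < T \<Longrightarrow> ray_orbit x u t \<Gamma>" and T: "0 < T" and qV: "\<Gamma> T \<in> V"
    and lim: "\<And>s. 0 \<le> s \<Longrightarrow> s \<le> T \<Longrightarrow> dist (\<Gamma> s) (\<Gamma> T) \<le> T - s"
  shows "\<exists>w e. unit_tangent (\<Gamma> T) w \<and> 0 < e \<and> e \<le> T \<and>
    (\<forall>s. 0 \<le> s \<and> s < e \<longrightarrow> \<Gamma> (T - s) = geodesic (\<Gamma> T) w s) \<and>
    (\<forall>s. 0 < s \<and> s < e \<longrightarrow> geodesic (\<Gamma> T) w s \<in> I)"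
proof -
  define q where "q = \<Gamma> T"
  have qS: "q \<in> S2" using qV V_subset F_eq P_subset by (auto simp: q_def)
  obtain e\<^sub>0 where e0: "e\<^sub>0 > 0" "\<And>y n r. dist y q < e\<^sub>0 \<Longrightarrow> chart y n r \<Longrightarrow> n \<bullet> q = 0"
    using corner_normals by blast
  \<comment> \<open>\<open>e\<^sub>0\<close> makes all normals met after \<open>a\<close> orthogonal
    to \<open>q\<close>, the bound 1 will tell \<open>q\<close> from \<open>-q\<close>, and the
    bound \<open>T\<close> keeps \<open>a\<close> nonnegative.\<close>
  define a where "a = T - min (min e\<^sub>0 1) T"
  have a: "0 \<le> a" "a < T" "T - a \<le> e\<^sub>0" "T - a \<le> 1" using e0 T by (auto simp: a_def)
  define A where "A = {a<..<T}"
  \<comment> \<open>No orbit is given up to the corner itself, hence a time domain that ends halfway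
    between \<open>s\<close> and \<open>T\<close>.\<close>
  have "\<exists>v n e. bounce {0..(s + T) / 2} \<Gamma> s v n e" if "s \<in> A" for s
    using ray_orbit_bounces[OF o[of "(s + T) / 2"], of s] that a by (auto simp: bounces_def A_def)
  then obtain v n e where b: "\<And>s. s \<in> A \<Longrightarrow> bounce {0..(s + T) / 2} \<Gamma> s (v s) (n s) (e s)"
    by metis
  have ut: "\<Gamma> s \<in> S2" "unit_tangent (\<Gamma> s) (v s)" "\<Gamma> s \<notin> V" if "s \<in> A" for s
    using bounce_tangent[OF b[OF that]] by auto
  have dq: "dist (\<Gamma> s) q \<le> T - s" if "s \<in> A" for s
    using lim[of s] that a by (auto simp: A_def q_def)
  have nq: "n s \<bullet> q = 0" if s: "s \<in> A" for s
  proof -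
    have "dist (\<Gamma> s) q < e\<^sub>0" using dq[OF s] s a by (auto simp: A_def)
    then show ?thesis using e0(2) bounce_chart[OF b[OF s]] by blast
  qed
  have left: "v s = velocity (\<Gamma> t) (v t) (s - t)" "\<Gamma> s = geodesic (\<Gamma> t) (v t) (s - t)"
    if t: "t \<in> A" and s: "s \<in> A" "t - e t < s" "s \<le> t" for s t
  proof -
    show "\<Gamma> s = geodesic (\<Gamma> t) (v t) (s - t)"
      by (rule bounce_left[OF b[OF t]]) (use s t a in \<open>auto simp: A_def\<close>)
    have "v s = velocity (geodesic (\<Gamma> t) (v t) (- t)) (velocity (\<Gamma> t) (v t) (- t)) s"
    proof (rule bounce_velocity[OF b[OF s(1)]])
      show "max a (t - e t) < s" using s by (auto simp: A_def)
      fix s' assume s': "max a (t - e t) < s'" "s' \<le> s"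
      have "\<Gamma> s' = geodesic (\<Gamma> t) (v t) (s' - t)"
        by (rule bounce_left[OF b[OF t]]) (use s s' t a in \<open>auto simp: A_def\<close>)
      then show "s' \<in> {0..(s + T) / 2} \<and> \<Gamma> s' = geodesic (geodesic (\<Gamma> t) (v t) (- t)) (velocity (\<Gamma> t) (v t) (- t)) s'"
        using s' s a by (auto simp: geodesic_add A_def)
    qed
    then show "v s = velocity (\<Gamma> t) (v t) (s - t)" by (simp add: velocity_add)
  qed
  have right: "v s = velocity (\<Gamma> t) (reflect (n t) (v t)) (s - t)"
      "\<Gamma> s = geodesic (\<Gamma> t) (reflect (n t) (v t)) (s - t)"
    if t: "t \<in> A" and s: "s \<in> A" "t < s" "s < t + min (e t) ((T - t) / 2)" for s t
  proof -
    define w where "w = reflect (n t) (v t)"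
    have s3: "s < t + e t" "s < t + (T - t) / 2" using s(3) by linarith+
    then have s4: "2 * s < t + T" by (simp add: field_simps)
    have R: "\<Gamma> s' = geodesic (\<Gamma> t) w (s' - t)" if "t < s'" "s' \<le> s" for s'
      unfolding w_def by (rule bounce_right[OF b[OF t]]) (use s s3 s4 t a that in \<open>auto simp: A_def\<close>)
    show "\<Gamma> s = geodesic (\<Gamma> t) (reflect (n t) (v t)) (s - t)" using R s by (simp add: w_def)
    have "v s = velocity (geodesic (\<Gamma> t) w (- t)) (velocity (\<Gamma> t) w (- t)) s"
    proof (rule bounce_velocity[OF b[OF s(1)] s(2)])
      fix s' assume s': "t < s'" "s' \<le> s"
      then show "s' \<in> {0..(s + T) / 2} \<and> \<Gamma> s' = geodesic (geodesic (\<Gamma> t) w (- t)) (velocity (\<Gamma> t) w (- t)) s'"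
        using R[OF s'] s s4 t a by (auto simp: geodesic_add A_def)
    qed
    then show "v s = velocity (\<Gamma> t) (reflect (n t) (v t)) (s - t)" by (simp add: velocity_add w_def)
  qed
  have near: "eventually (\<lambda>s. s \<in> A \<and> t - e t < s \<and> s < t + min (e t) ((T - t) / 2)) (at t within A)"
    if t: "t \<in> A" for t
  proof -
    have pos: "0 < min (e t) ((T - t) / 2)" using bounce_pos[OF b[OF t]] t by (auto simp: A_def)
    moreover have "t - e t < s \<and> s < t + min (e t) ((T - t) / 2)"
      if "\<bar>s - t\<bar> < min (e t) ((T - t) / 2)" for s
      using that unfolding abs_less_iff by linarith
    ultimately show ?thesis
      unfolding eventually_at dist_real_def by blast
  qed
  define E where "E s = (q \<bullet> \<Gamma> s)\<^sup>2 + (q \<bullet> v s)\<^sup>2" for s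
  have Econst: "E s = E t" if "s \<in> A" "t \<in> A" for s t
  proof (rule connected_local_const[OF _ that])
    show "connected A" by (simp add: A_def)
    show "\<forall>t\<in>A. \<forall>\<^sub>F s in at t within A. E t = E s"
    proof
      fix t assume t: "t \<in> A"
      have "q \<bullet> reflect (n t) (v t) = q \<bullet> v t"
        using nq[OF t] by (simp add: reflect_def inner_simps inner_commute)
      note qw = this
      have EE: "E t = E s" if s: "s \<in> A \<and> t - e t < s \<and> s < t + min (e t) ((T - t) / 2)" for s
      proof (cases "s \<le> t")
        case True
        note st = left[OF t conjunct1[OF s] conjunct1[OF conjunct2[OF s]] True]
        show ?thesis unfolding E_def st geodesic_energy ..
      next
        case False
        then have "t < s" by simp
        note st = right[OF t conjunct1[OF s] this conjunct2[OF conjunct2[OF s]]]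
        show ?thesis unfolding E_def st geodesic_energy qw ..
      qed
      show "\<forall>\<^sub>F s in at t within A. E t = E s"
        by (rule eventually_mono[OF near[OF t] EE])
    qed
  qed
  have Ege: "1 - E s \<le> (T - s)\<^sup>2" if s: "s \<in> A" for s
  proof -
    define d where "d = (dist (\<Gamma> s) q)\<^sup>2"
    have "1 - E s \<le> 1 - (q \<bullet> \<Gamma> s)\<^sup>2" by (simp add: E_def)
    also have "\<dots> = 1 - (1 - d / 2)\<^sup>2"
      using inner_sphere_dist[OF ut(1)[OF s] qS] by (simp add: d_def)
    also have "\<dots> \<le> d" by (simp add: power2_eq_square algebra_simps)
    also have "\<dots> \<le> (T - s)\<^sup>2" unfolding d_def using dq[OF s] by (intro power_mono) auto
    finally show ?thesis .
  qed
  \<comment> \<open>\<open>1 - E\<close> is constant and, by \<open>Ege\<close>, at most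
    \<open>(T - s)\<^sup>2\<close>, which tends to 0.\<close>
  have E1: "1 \<le> E s" if s: "s \<in> A" for s
  proof (rule ccontr)
    assume "\<not> 1 \<le> E s"
    then have \<delta>: "0 < 1 - E s" by simp
    define h where "h = min ((T - a) / 2) (sqrt (1 - E s) / 2)"
    have h: "0 < h" "h < T - a" "h < sqrt (1 - E s)" using \<delta> a by (auto simp: h_def min_less_iff_disj)
    have "T - h \<in> A" using h by (auto simp: A_def)
    from Ege[OF this] Econst[OF s this] have "1 - E s \<le> h\<^sup>2" by simp
    moreover have "h\<^sup>2 < (sqrt (1 - E s))\<^sup>2" using h by (intro power_strict_mono) auto
    ultimately show False using \<delta> by simp
  qed
  have span: "q = (q \<bullet> \<Gamma> s) *\<^sub>R \<Gamma> s + (q \<bullet> v s) *\<^sub>R v s" if s: "s \<in> A" for s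
  proof -
    have "(norm (q - (q \<bullet> \<Gamma> s) *\<^sub>R \<Gamma> s - (q \<bullet> v s) *\<^sub>R v s))\<^sup>2 \<le> 0"
      using bessel_defect[OF ut(1,2)[OF s] qS] E1[OF s] by (simp add: E_def)
    then show ?thesis by (simp add: algebra_simps)
  qed
  have n0: "n s = 0" if s: "s \<in> A" for s
  proof (rule ccontr)
    assume n: "n s \<noteq> 0"
    have os: "ray_orbit x u s \<Gamma>" "0 < s" using o[of s] s a by (auto simp: A_def)
    have "bounce {0..s} \<Gamma> s (v s) (n s) (min 1 (e s))"
      using bounce_cong[OF b[OF s], of 1 "{0..s}" \<Gamma>] s os(2) by (auto simp: A_def)
    from ray_orbit_transversal[OF os(1,2) order_refl this n] have nv: "n s \<bullet> v s \<noteq> 0" .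
    obtain r where r: "chart (\<Gamma> s) (n s) r" using bounce_chart[OF b[OF s]] by blast
    \<comment> \<open>\<open>n s\<close> is orthogonal to \<open>q\<close> and
      \<open>\<Gamma> s\<close> but not to \<open>v s\<close>, so by \<open>span\<close> the point
      \<open>q\<close> is a multiple of \<open>\<Gamma> s\<close>. Closeness excludes
      \<open>- \<Gamma> s\<close>, and \<open>\<Gamma> s = q\<close> is impossible because orbits
      avoid corners.\<close>
    have "n s \<bullet> q = (q \<bullet> \<Gamma> s) * (n s \<bullet> \<Gamma> s) + (q \<bullet> v s) * (n s \<bullet> v s)"
      by (subst span[OF s]) (simp add: inner_simps)
    then have "q \<bullet> v s = 0" using nq[OF s] chart_inner[OF r] nv by simp
    then have q: "q = (q \<bullet> \<Gamma> s) *\<^sub>R \<Gamma> s" using span[OF s] by simp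
    have "norm q = \<bar>q \<bullet> \<Gamma> s\<bar> * norm (\<Gamma> s)" by (subst q) simp
    then have "\<bar>q \<bullet> \<Gamma> s\<bar> = 1" using qS ut(1)[OF s] by simp
    moreover have "(dist (\<Gamma> s) q)\<^sup>2 \<le> 1"
      using dq[OF s] s a by (intro power_le_one) (auto simp: A_def)
    then have "q \<bullet> \<Gamma> s > 0" using inner_sphere_dist[OF ut(1)[OF s] qS] by simp
    ultimately have "q = \<Gamma> s" using q by simp
    then show False using ut(3)[OF s] qV by (simp add: q_def)
  qed
  \<comment> \<open>The current arc and its velocity, traced back to time 0. That this is constant
    means that all arcs over \<open>A\<close> belong to one geodesic.\<close>
  define X where "X s = (geodesic (\<Gamma> s) (v s) (- s), velocity (\<Gamma> s) (v s) (- s))" for s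
  have Xconst: "X s = X t" if "s \<in> A" "t \<in> A" for s t
  proof (rule connected_local_const[OF _ that])
    show "connected A" by (simp add: A_def)
    show "\<forall>t\<in>A. \<forall>\<^sub>F s in at t within A. X t = X s"
    proof
      fix t assume t: "t \<in> A"
      have XX: "X t = X s" if s: "s \<in> A \<and> t - e t < s \<and> s < t + min (e t) ((T - t) / 2)" for s
      proof (cases "s \<le> t")
        case True
        note st = left[OF t conjunct1[OF s] conjunct1[OF conjunct2[OF s]] True]
        show ?thesis unfolding X_def st geodesic_add velocity_add by simp
      next
        case False
        then have "t < s" by simp
        note st = right[OF t conjunct1[OF s] this conjunct2[OF conjunct2[OF s]]]
        show ?thesis unfolding X_def st geodesic_add velocity_add n0[OF t] by simp
      qed
      show "\<forall>\<^sub>F s in at t within A. X t = X s"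
        by (rule eventually_mono[OF near[OF t] XX])
    qed
  qed
  define m where "m = (a + T) / 2"
  have m: "m \<in> A" using a by (auto simp: m_def A_def)
  define y where "y = fst (X m)"
  define w where "w = snd (X m)"
  have yw: "y \<in> S2" "unit_tangent y w"
    using unit_tangent_velocity[OF ut(1,2)[OF m]] by (auto simp: y_def w_def X_def)
  have \<Gamma>: "\<Gamma> s = geodesic y w s" if s: "s \<in> A" for s
  proof -
    have "geodesic (\<Gamma> s) (v s) (- s) = y" "velocity (\<Gamma> s) (v s) (- s) = w"
      using Xconst[OF s m] by (auto simp: y_def w_def X_def)
    then show ?thesis using geodesic_add[of "\<Gamma> s" "v s" "- s" s] by simp
  qed
  have q: "geodesic y w T = q"
  proof (rule ccontr)
    assume "geodesic y w T \<noteq> q"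
    then have D: "0 < dist (geodesic y w T) q" (is "0 < ?D") by simp
    define h where "h = min ((T - a) / 3) (?D / 3)"
    have "h \<le> (T - a) / 3" "h \<le> ?D / 3" unfolding h_def by (rule min.cobounded1 min.cobounded2)+
    moreover have "0 < h" using D a by (simp add: h_def)
    ultimately have h: "0 < h" "h < T - a" "2 * h < ?D" using D a by simp_all
    have "T - h \<in> A" using h by (auto simp: A_def)
    then have "dist (geodesic y w (T - h)) q \<le> h" using dq[of "T - h"] \<Gamma> by auto
    moreover have "dist (geodesic y w T) (geodesic y w (T - h)) \<le> h"
      using dist_geodesic[OF yw, of T "T - h"] h by simp
    ultimately show False using h dist_triangle[of "geodesic y w T" q "geodesic y w (T - h)"] by linarith
  qed
  have G: "geodesic q (- velocity y w T) s = geodesic y w (T - s)" for s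
    by (simp add: geodesic_minus geodesic_add flip: q)
  show ?thesis
    unfolding q_def[symmetric]
  proof (intro exI[of _ "- velocity y w T"] exI[of _ "T - a"] conjI allI impI)
    show "unit_tangent q (- velocity y w T)"
      using unit_tangent_velocity(2)[OF yw, of T] by (simp add: q unit_tangent_def)
    fix s assume s: "0 \<le> s \<and> s < T - a"
    show "\<Gamma> (T - s) = geodesic q (- velocity y w T) s"
    proof (cases "s = 0")
      case False
      then have "T - s \<in> A" using s by (auto simp: A_def)
      then show ?thesis using \<Gamma> G by simp
    qed (simp add: q_def)
  next
    fix s assume s: "0 < s \<and> s < T - a"
    then have sA: "T - s \<in> A" by (auto simp: A_def)
    then have "\<Gamma> (T - s) \<in> I" using bounce_chart[OF b[OF sA]] n0[OF sA] chart_F(2) by metis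
    then show "geodesic q (- velocity y w T) s \<in> I" using \<Gamma>[OF sA] G by simp
  qed (use a in auto)
qed

text \<open>The reversed orbit needs a bounce at its end point, where the original one merely has a
  starting direction; \<open>x \<in> I\<close> supplies it, with normal 0.\<close>

lemma ray_orbit_reverse:
  assumes o: "\<And>t. 0 < t \<Longrightarrow> t < T \<Longrightarrow> ray_orbit x u t \<Gamma>" and T: "0 < T" and x: "x \<in> I"
    and w: "unit_tangent (\<Gamma> T) w" "\<Gamma> T \<in> S2"
    and e: "0 < e" "e \<le> T" "\<And>s. 0 \<le> s \<Longrightarrow> s < e \<Longrightarrow> \<Gamma> (T - s) = geodesic (\<Gamma> T) w s"
      "\<And>s. 0 < s \<Longrightarrow> s < e \<Longrightarrow> geodesic (\<Gamma> T) w s \<in> I"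
  shows "ray_orbit (\<Gamma> T) w T (\<lambda>s. \<Gamma> (T - s))"
proof -
  have "bounces {0..T} (\<lambda>s. \<Gamma> (T - s)) t" if t: "0 < t" "t \<le> T" for t
  proof (cases "t = T")
    case True
    have o2: "ray_orbit x u (T / 2) \<Gamma>" using o[of "T/2"] T by auto
    obtain d where d: "0 < d" "d \<le> T / 2" "\<And>s. 0 \<le> s \<Longrightarrow> s < d \<Longrightarrow> \<Gamma> s = geodesic x u s"
      using ray_orbit_start[OF o2] by metis
    have x0: "\<Gamma> 0 = x" "unit_tangent x u" using ray_orbit_basic[OF o2] by auto
    have "bounce {0..T} (\<lambda>s. \<Gamma> (T - s)) T (- u) 0 d"
      unfolding bounce_def
      using chart_interior[OF x] x0 d by (auto simp: geodesic_minus unit_tangent_def)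
    then show ?thesis using True by (auto simp: bounces_def)
  next
    case False
    then have "bounces {0..T - t / 2} \<Gamma> (T - t)"
      using ray_orbit_bounces[OF o[of "T - t / 2"], of "T - t"] t by auto
    from bounces_reverse[OF this, of T]
    have *: "bounces ((\<lambda>s. T - s) ` {0..T - t / 2}) (\<lambda>s. \<Gamma> (T - s)) t" by simp
    have "t \<le> s * 2" if "\<bar>s - t\<bar> * 2 < t" for s
      using that abs_ge_minus_self[of "s - t"] by (simp add: algebra_simps)
    then show ?thesis
      by (intro bounces_cong[OF *, of "t / 2"]) (use t in auto)
  qed
  then show ?thesis
    unfolding ray_orbit_def using w T e by auto
qed

end

section \<open>Continuous dependence on the initial direction\<close>

text \<open>The chord grows with the angle up to \<open>pi\<close>. This keeps the arc between two
  directions inside every ball around the first that contains the second.\<close>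

lemma circle_dist_mono:
  assumes "x \<in> S2" "unit_tangent x v" "0 \<le> \<tau>" "\<tau> \<le> 1" "- pi \<le> \<theta>" "\<theta> \<le> pi"
  shows "dist x (geodesic x v (\<tau> * \<theta>)) \<le> dist x (geodesic x v \<theta>)"
proof -
  have xx: "x \<bullet> x = 1" "x \<bullet> v = 0" using assms by (auto simp: unit_tangent_def norm_eq_1 inner_commute)
  have sq: "(dist x (geodesic x v \<phi>))\<^sup>2 = 2 * (1 - cos \<phi>)" for \<phi>
    using inner_sphere_dist[OF unit_tangent_velocity(1)[OF assms(1,2)] assms(1), of \<phi>] xx
    by (simp add: inner_geodesic dist_commute field_simps)
  have "\<bar>\<tau> * \<theta>\<bar> \<le> \<bar>\<theta>\<bar>" using assms by (simp add: abs_mult mult_left_le_one_le)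
  then have "cos \<bar>\<theta>\<bar> \<le> cos \<bar>\<tau> * \<theta>\<bar>" using assms by (intro cos_monotone_0_pi_le) auto
  then have "(dist x (geodesic x v (\<tau> * \<theta>)))\<^sup>2 \<le> (dist x (geodesic x v \<theta>))\<^sup>2"
    unfolding sq by simp
  then show ?thesis by (simp add: power2_le_iff_abs_le)
qed

context billiard
begin

text \<open>
  The sides that come close to \<open>x\<close> without passing through it are harmless. On a great circle
  through \<open>x\<close> there are only two directions, so that near \<open>u\<^sub>0\<close> only \<open>u\<^sub>0\<close> itself can
  run along it.
\<close>

lemma open_initial_directions:
  assumes x: "x \<in> S2" and u0: "unit_tangent x u\<^sub>0"
    and e0: "0 < e\<^sub>0" "\<And>s. 0 < s \<Longrightarrow> s < e\<^sub>0 \<Longrightarrow> geodesic x u\<^sub>0 s \<in> I"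
  shows "\<exists>d>0. \<forall>u s. unit_tangent x u \<and> dist u u\<^sub>0 < d \<and> 0 < s \<and> s < d \<longrightarrow> geodesic x u s \<in> I"
proof -
  obtain N where N: "finite N" "0 \<notin> N" "\<forall>y\<in>F. \<exists>n\<in>N. n \<bullet> y = 0"
    using great_circles_cover_frontier by blast
  \<comment> \<open>The exception \<open>u = u\<^sub>0\<close> allows for a great circle that
    contains the geodesic in direction \<open>u\<^sub>0\<close>; for this direction the assumption
    takes over.\<close>
  define Q where "Q d m \<longleftrightarrow> (\<forall>u s. unit_tangent x u \<and> dist u u\<^sub>0 < d \<and> 0 < s \<and> s < d \<longrightarrow>
    u = u\<^sub>0 \<or> m \<bullet> geodesic x u s \<noteq> 0)" for d m
  have "\<forall>m\<in>N. eventually (\<lambda>d. Q d m) (at_right (0::real))"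
  proof
    fix m assume "m \<in> N"
    then have m: "m \<noteq> 0" using N by auto
    have "\<exists>d>0. Q d m"
    proof -
      consider "m \<bullet> x \<noteq> 0" | "m \<bullet> x = 0" "m \<bullet> u\<^sub>0 \<noteq> 0" | "m \<bullet> x = 0" "m \<bullet> u\<^sub>0 = 0" by blast
      then show ?thesis
      proof cases
        case 1
        \<comment> \<open>The distance from \<open>x\<close> to the plane of the circle; a geodesic
          of unit speed does not reach it earlier.\<close>
        define d where "d = \<bar>m \<bullet> x\<bar> / norm m"
        have "0 < d" using 1 m by (simp add: d_def)
        moreover have "m \<bullet> geodesic x u s \<noteq> 0" if "unit_tangent x u" "0 < s" "s < d" for u s
        proof
          assume "m \<bullet> geodesic x u s = 0"
          then have "\<bar>m \<bullet> x\<bar> = \<bar>m \<bullet> (x - geodesic x u s)\<bar>" by (simp add: inner_simps)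
          also have "\<dots> \<le> norm m * dist x (geodesic x u s)"
            using Cauchy_Schwarz_ineq2 by (simp add: dist_norm)
          also have "\<dots> \<le> norm m * s"
            using dist_geodesic[OF x that(1), of 0 s] that by (intro mult_left_mono) auto
          also have "\<dots> < norm m * d" using that m by simp
          finally show False using m by (simp add: d_def)
        qed
        ultimately show ?thesis unfolding Q_def by blast
      next
        case 2
        define d where "d = min 1 (\<bar>m \<bullet> u\<^sub>0\<bar> / norm m)"
        have d: "0 < d" "d \<le> 1" "d \<le> \<bar>m \<bullet> u\<^sub>0\<bar> / norm m" using 2 m by (auto simp: d_def)
        have "m \<bullet> geodesic x u s \<noteq> 0" if "dist u u\<^sub>0 < d" "0 < s" "s < d" for u s
        proof
          assume "m \<bullet> geodesic x u s = 0"
          moreover have "sin s > 0" using that d pi_gt3 by (intro sin_gt_zero) auto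
          ultimately have "m \<bullet> u = 0" using 2 by (simp add: inner_geodesic)
          then have "\<bar>m \<bullet> u\<^sub>0\<bar> = \<bar>m \<bullet> (u\<^sub>0 - u)\<bar>" by (simp add: inner_simps)
          also have "\<dots> \<le> norm m * dist u u\<^sub>0"
            using Cauchy_Schwarz_ineq2 by (simp add: dist_norm norm_minus_commute)
          also have "\<dots> < norm m * d" using that m by simp
          also have "\<dots> \<le> norm m * (\<bar>m \<bullet> u\<^sub>0\<bar> / norm m)" using d by (intro mult_left_mono) auto
          finally show False using m by simp
        qed
        then show ?thesis using d(1) unfolding Q_def by blast
      next
        case 3
        have "u = u\<^sub>0 \<or> m \<bullet> geodesic x u s \<noteq> 0"
          if u: "unit_tangent x u" "dist u u\<^sub>0 < 1" "0 < s" "s < 1" for u s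
        proof (rule ccontr)
          assume a: "\<not> (u = u\<^sub>0 \<or> m \<bullet> geodesic x u s \<noteq> 0)"
          moreover have "sin s > 0" using that pi_gt3 by (intro sin_gt_zero) auto
          ultimately have mu: "m \<bullet> u = 0" using 3 by (simp add: inner_geodesic)
          define c where "c = cross3 x u\<^sub>0"
          define d where "d = u - (u \<bullet> u\<^sub>0) *\<^sub>R u\<^sub>0"
          have u0u0: "u\<^sub>0 \<bullet> u\<^sub>0 = 1" using u0 by (simp add: unit_tangent_def norm_eq_1)
          have "d \<bullet> x = 0" "d \<bullet> u\<^sub>0 = 0"
            using u0 u(1) u0u0 by (auto simp: d_def unit_tangent_def inner_simps)
          then have mc: "m = (m \<bullet> c) *\<^sub>R c" and dc: "d = (d \<bullet> c) *\<^sub>R c"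
            using orthogonal_both_imp_cross[OF x u0] 3 unfolding c_def by blast+
          \<comment> \<open>\<open>m\<close> and \<open>d\<close> are both multiples of
            \<open>c\<close> and orthogonal to each other. As \<open>m\<close> is not zero,
            \<open>d\<close> is, so \<open>u\<close> is a multiple of \<open>u\<^sub>0\<close>; the
            distance below 1 excludes \<open>- u\<^sub>0\<close>.\<close>
          have "m \<bullet> d = 0" using mu 3 by (simp add: d_def inner_simps)
          then have "(m \<bullet> c) * (d \<bullet> c) = 0"
            by (subst (asm) mc) (simp add: inner_commute)
          moreover have "m \<bullet> c \<noteq> 0" using mc m by (metis scale_zero_left)
          ultimately have "d = 0" using dc by simp
          then have ueq: "u = (u \<bullet> u\<^sub>0) *\<^sub>R u\<^sub>0" by (simp add: d_def)
          have "norm u = \<bar>u \<bullet> u\<^sub>0\<bar> * norm u\<^sub>0" by (subst ueq) simp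
          then have abs1: "\<bar>u \<bullet> u\<^sub>0\<bar> = 1" using u0 u(1) by (simp add: unit_tangent_def)
          have "u \<in> S2" "u\<^sub>0 \<in> S2" using u0 u(1) by (auto simp: unit_tangent_def)
          moreover have "(dist u u\<^sub>0)\<^sup>2 \<le> 1" using u(2) by (intro power_le_one) auto
          ultimately have "u \<bullet> u\<^sub>0 > 0" using inner_sphere_dist[of u u\<^sub>0] by (simp add: inner_commute)
          then show False using ueq abs1 a by simp
        qed
        then have "Q 1 m" unfolding Q_def by blast
        then show ?thesis using zero_less_one by blast
      qed
    qed
    then obtain d where d: "0 < d" "Q d m" by blast
    have "Q d' m" if "d' < d" for d' using d(2) that unfolding Q_def by (meson less_trans)
    then show "eventually (\<lambda>d. Q d m) (at_right 0)"
      using d(1) by (auto simp: eventually_at_right_field)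
  qed
  from eventually_ball_finite[OF N(1) this] obtain d' where d': "0 < d'" "\<And>d. 0 < d \<Longrightarrow> d < d' \<Longrightarrow> \<forall>m\<in>N. Q d m"
    by (auto simp: eventually_at_right_field)
  define d where "d = min d' e\<^sub>0 / 2"
  have d: "0 < d" "d < d'" "d < e\<^sub>0" using d'(1) e0(1) by (auto simp: d_def)
  have noF: "geodesic x u s \<notin> F" if u: "unit_tangent x u" "dist u u\<^sub>0 < d" "0 < s" "s < d" for u s
  proof (cases "u = u\<^sub>0")
    case True
    then have "geodesic x u s \<in> I" using e0(2) u d by simp
    then show ?thesis using F_eq by blast
  next
    case False
    then have "m \<bullet> geodesic x u s \<noteq> 0" if "m \<in> N" for m
      using d'(2)[OF d(1,2)] that u unfolding Q_def by blast
    then show ?thesis using N(3) by blast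
  qed
  have "geodesic x u s \<in> I" if u: "unit_tangent x u" "dist u u\<^sub>0 < d" "0 < s" "s < d" for u s
  proof -
    define f where "f = cross3 x u\<^sub>0"
    obtain \<theta> where \<theta>: "- pi \<le> \<theta>" "\<theta> \<le> pi" "u = geodesic u\<^sub>0 f \<theta>"
      using circle_param[OF x u0 u(1)] unfolding f_def by metis
    have uf: "u\<^sub>0 \<in> S2" "unit_tangent u\<^sub>0 f"
      using u0 unit_tangent_cross[OF x u0] by (auto simp: f_def unit_tangent_def)
    \<comment> \<open>Turning \<open>u\<^sub>0\<close> into \<open>u\<close> with \<open>s\<close>
      fixed sweeps out a connected set that avoids the frontier and meets \<open>P\<close>, and
      therefore stays in \<open>P\<close>.\<close>
    define C where "C = (\<lambda>\<tau>. geodesic x (geodesic u\<^sub>0 f (\<tau> * \<theta>)) s) ` {0..1}"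
    have conn: "connected C"
      unfolding C_def by (intro connected_continuous_image continuous_intros) auto
    have ut: "unit_tangent x (geodesic u\<^sub>0 f \<phi>)" for \<phi>
      using unit_tangent_circle[OF x u0] by (simp add: f_def)
    have "geodesic x (geodesic u\<^sub>0 f (\<tau> * \<theta>)) s \<notin> F" if "\<tau> \<in> {0..1}" for \<tau>
    proof (rule noF[OF ut _ u(3,4)])
      show "dist (geodesic u\<^sub>0 f (\<tau> * \<theta>)) u\<^sub>0 < d"
        using circle_dist_mono[OF uf, of \<tau> \<theta>] that \<theta> u(2) by (simp add: dist_commute)
    qed
    then have CF: "C \<inter> F = {}" by (auto simp: C_def)
    have CS: "C \<subseteq> S2" using unit_tangent_velocity(1)[OF x ut] by (auto simp: C_def)
    have "geodesic x u\<^sub>0 s \<in> C" unfolding C_def by (intro image_eqI[of _ _ 0]) auto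
    moreover have "geodesic x u\<^sub>0 s \<in> P" using e0(2) u d I_subset by auto
    ultimately have "C \<inter> P \<noteq> {}" by blast
    then have "C - P = {}"
      using connectedin_Int_frontier_of[of "top_of_set S2" C P] conn CS CF by (auto simp: connectedin_subtopology)
    moreover have "u = geodesic u\<^sub>0 f (1 * \<theta>)" using \<theta> by simp
    then have "geodesic x u s \<in> C" unfolding C_def by (intro image_eqI[of _ _ 1]) simp_all
    ultimately show ?thesis using CF F_eq by blast
  qed
  then show ?thesis using d(1) by blast
qed

text \<open>\<open>g\<close> stands for the composition of the reflections met before
  \<open>t\<close>. The time window around \<open>t\<close> is free of bounces and \<open>g\<close>
  is common to all nearby directions, which gives the isometries for the area count; joint
  continuity from time 0 on gives the homotopies.\<close>

definition orbit_family :: "real^3 \<Rightarrow> real^3 \<Rightarrow> real \<Rightarrow> real \<Rightarrow> (real^3 \<Rightarrow> real^3) \<Rightarrow> (real^3 \<Rightarrow> real \<Rightarrow> real^3) \<Rightarrow> bool" where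
  "orbit_family x u\<^sub>0 t d g \<Gamma> \<longleftrightarrow> 0 < d \<and> d < t \<and> orthogonal_transformation g \<and>
     continuous_on ({u. unit_tangent x u \<and> dist u u\<^sub>0 < d} \<times> {0..t + d}) (\<lambda>(u, s). \<Gamma> u s) \<and>
     (\<forall>u. unit_tangent x u \<and> dist u u\<^sub>0 < d \<longrightarrow> ray_orbit x u (t + d) (\<Gamma> u) \<and>
        (\<forall>s\<in>{t - d..t + d}. \<Gamma> u s = g (geodesic x u s) \<and> \<Gamma> u s \<in> I))"

definition stable_at :: "real^3 \<Rightarrow> real^3 \<Rightarrow> real \<Rightarrow> bool" where
  "stable_at x u\<^sub>0 t \<longleftrightarrow> (\<exists>d g \<Gamma>. orbit_family x u\<^sub>0 t d g \<Gamma>)"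

lemma stable_initial:
  assumes o: "ray_orbit x u\<^sub>0 T \<gamma>"
  shows "\<exists>h>0. \<forall>t. 0 < t \<and> t < h \<longrightarrow> stable_at x u\<^sub>0 t"
proof -
  obtain e where e: "0 < e" "\<And>s. 0 < s \<Longrightarrow> s < e \<Longrightarrow> geodesic x u\<^sub>0 s \<in> I"
    using ray_orbit_start[OF o] by metis
  have x: "x \<in> S2" "unit_tangent x u\<^sub>0" using ray_orbit_basic[OF o] by auto
  obtain d where d: "d > 0" "\<And>u s. unit_tangent x u \<Longrightarrow> dist u u\<^sub>0 < d \<Longrightarrow> 0 < s \<Longrightarrow> s < d \<Longrightarrow> geodesic x u s \<in> I"
    using open_initial_directions[OF x e] by blast
  have "stable_at x u\<^sub>0 t" if t: "0 < t" "t < d" for t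
  proof -
    define d' where "d' = min t (d - t) / 2"
    have d': "0 < d'" "d' < t" "t + d' < d" "d' < d" using t by (auto simp: d'_def min_def field_simps)
    have "orbit_family x u\<^sub>0 t d' (\<lambda>y. y) (\<lambda>u. geodesic x u)"
      unfolding orbit_family_def
    proof (intro conjI allI impI ballI)
      show "orthogonal_transformation (\<lambda>y::real^3. y)" by (rule orthogonal_transformation_id)
      show "continuous_on ({u. unit_tangent x u \<and> dist u u\<^sub>0 < d'} \<times> {0..t + d'}) (\<lambda>(u, s). geodesic x u s)"
        unfolding case_prod_unfold by (intro continuous_intros)
      fix u assume u: "unit_tangent x u \<and> dist u u\<^sub>0 < d'"
      show "ray_orbit x u (t + d') (geodesic x u)"
        using d(2)[of u] u d' by (intro ray_orbit_geodesic[of x u d]) (use x in auto)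
      fix s assume "s \<in> {t - d'..t + d'}"
      then show "geodesic x u s \<in> I" using d(2)[of u s] u d' by auto
    qed (use d' in auto)
    then show ?thesis unfolding stable_at_def by blast
  qed
  then show ?thesis using d(1) by blast
qed

text \<open>In the chart every nearby orbit is the fold of \<open>g\<close> applied to a free
  geodesic. As \<open>\<gamma> t\<^sub>2\<close> is interior, this geodesic is off the mirror at
  \<open>t\<^sub>2\<close> and nearby ones are on the same side; so the new isometry is
  \<open>g\<close> or \<open>g\<close> followed by the reflection.\<close>

lemma stable_step:
  assumes o: "ray_orbit x u\<^sub>0 T \<gamma>" and c: "chart p n r"
    and t: "t\<^sub>1 < t\<^sub>2" "t\<^sub>2 \<le> T" and near: "dist p (\<gamma> t\<^sub>1) + (t\<^sub>2 - t\<^sub>1) < r"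
    and I: "\<gamma> t\<^sub>2 \<in> I" and st: "stable_at x u\<^sub>0 t\<^sub>1"
  shows "stable_at x u\<^sub>0 t\<^sub>2"
proof -
  obtain d g \<Gamma> where fam: "orbit_family x u\<^sub>0 t\<^sub>1 d g \<Gamma>"
    using st unfolding stable_at_def by blast
  have d: "0 < d" "d < t\<^sub>1" and g: "orthogonal_transformation g"
    and cont: "continuous_on ({u. unit_tangent x u \<and> dist u u\<^sub>0 < d} \<times> {0..t\<^sub>1 + d}) (\<lambda>(u, s). \<Gamma> u s)"
    using fam unfolding orbit_family_def by blast+
  have \<Gamma>: "ray_orbit x u (t\<^sub>1 + d) (\<Gamma> u)" and
    \<Gamma>g: "\<And>s. t\<^sub>1 - d \<le> s \<Longrightarrow> s \<le> t\<^sub>1 + d \<Longrightarrow> \<Gamma> u s = g (geodesic x u s)" and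
    \<Gamma>I: "\<And>s. t\<^sub>1 - d \<le> s \<Longrightarrow> s \<le> t\<^sub>1 + d \<Longrightarrow> \<Gamma> u s \<in> I"
    if "unit_tangent x u" "dist u u\<^sub>0 < d" for u
    using fam that unfolding orbit_family_def by (blast, (meson atLeastAtMost_iff)+)
  have x: "x \<in> S2" "unit_tangent x u\<^sub>0" using ray_orbit_basic[OF o] by auto
  have lin: "linear g" using g by (simp add: orthogonal_transformation_linear)
  define c where "c u s = geodesic (g x) (g u) s" for u s
  have cg: "g (geodesic x u s) = c u s" for u s using linear_geodesic[OF lin] by (simp add: c_def)
  have gx: "g x \<in> S2" and gu: "unit_tangent x u \<Longrightarrow> unit_tangent (g x) (g u)" for u
    using orthogonal_transformation_unit_tangent[OF g] x by auto
  have cd: "dist (c u s) (c u\<^sub>0 s') \<le> dist u u\<^sub>0 + \<bar>s - s'\<bar>" for u s s'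
  proof -
    have "dist (c u s) (c u\<^sub>0 s) \<le> dist u u\<^sub>0"
      unfolding c_def using dist_geodesic_dir[of "g x" "g u" s "g u\<^sub>0"] dist_orthogonal_transformation[OF g] by simp
    moreover have "dist (c u\<^sub>0 s) (c u\<^sub>0 s') \<le> \<bar>s - s'\<bar>"
      unfolding c_def using dist_geodesic[OF gx gu[OF x(2)]] by blast
    ultimately show ?thesis using dist_triangle[of "c u s" "c u\<^sub>0 s'" "c u\<^sub>0 s"] by linarith
  qed
  have t1: "0 < t\<^sub>1" using d by simp
  have start: "c u\<^sub>0 t\<^sub>1 = \<gamma> t\<^sub>1"
    using ray_orbit_unique[OF \<Gamma>[OF x(2)] o, of t\<^sub>1] \<Gamma>g[OF x(2), of t\<^sub>1] d t by (simp add: cg)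
  \<comment> \<open>The slack in \<open>near\<close>. Changing the direction by less than
    \<open>k / 4\<close> and prolonging the time by \<open>k / 4\<close> does not leave the
    chart.\<close>
  define k where "k = r - (dist p (\<gamma> t\<^sub>1) + (t\<^sub>2 - t\<^sub>1))"
  have k: "k > 0" using near by (simp add: k_def)
  define d' where "d' = min d (k / 4)"
  have d': "0 < d'" "d' \<le> d" "d' \<le> k / 4"
    using d k by (auto simp: d'_def)
  have close: "dist p (c u s) < r" if "dist u u\<^sub>0 < d'" "t\<^sub>1 \<le> s" "s \<le> t\<^sub>2 + d'" for u s
  proof -
    have "dist p (c u s) \<le> dist p (\<gamma> t\<^sub>1) + (dist u u\<^sub>0 + \<bar>s - t\<^sub>1\<bar>)"
      using dist_triangle[of p "c u s" "\<gamma> t\<^sub>1"] cd[of u s t\<^sub>1] by (simp add: start dist_commute)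
    then show ?thesis using that d' k unfolding k_def by simp
  qed
  define \<Gamma>' where "\<Gamma>' u s = (if s \<le> t\<^sub>1 then \<Gamma> u s else fold_along n (c u s))" for u s
  have \<Gamma>': "ray_orbit x u (t\<^sub>2 + d') (\<Gamma>' u)" if u: "unit_tangent x u" "dist u u\<^sub>0 < d'" for u
  proof -
    have ud: "dist u u\<^sub>0 < d" using u d' by simp
    have "ray_orbit x u t\<^sub>1 (\<Gamma> u)" by (rule ray_orbit_cong[OF \<Gamma>[OF u(1) ud]]) (use t1 d in auto)
    moreover have "\<Gamma> u t\<^sub>1 \<in> I" using \<Gamma>I[OF u(1) ud, of t\<^sub>1] d by simp
    ultimately show ?thesis
      unfolding \<Gamma>'_def c_def
    proof (rule ray_orbit_extend[OF _ _ assms(2) gx gu[OF u(1)] d(1)])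
      fix s assume "t\<^sub>1 - d < s" "s \<le> t\<^sub>1"
      then show "\<Gamma> u s = geodesic (g x) (g u) s" using \<Gamma>g[OF u(1) ud, of s] d cg c_def by simp
    next
      fix s assume "t\<^sub>1 \<le> s" "s \<le> t\<^sub>2 + d'"
      then show "dist p (geodesic (g x) (g u) s) < r" using close u by (simp add: c_def)
    qed (use t d' in auto)
  qed
  have end0: "\<Gamma>' u\<^sub>0 t\<^sub>2 = \<gamma> t\<^sub>2"
    using ray_orbit_unique[OF \<Gamma>'[OF x(2)] o, of t\<^sub>2] d' t t1 by simp
  then have endI: "fold_along n (c u\<^sub>0 t\<^sub>2) \<in> I" using I t by (simp add: \<Gamma>'_def)
  have n: "n = 0 \<or> norm n = 1" using chart_norm[OF assms(2)] .
  have cS: "c u s \<in> S2" if "unit_tangent x u" for u s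
    unfolding c_def using unit_tangent_velocity(1)[OF gx gu[OF that]] .
  have foldI: "fold_along n (c u s) \<in> I \<longleftrightarrow> n = 0 \<or> n \<bullet> c u s \<noteq> 0"
    if "unit_tangent x u" "dist p (c u s) < r" for u s
    using chart_I(1)[OF assms(2), of "fold_along n (c u s)"] unit_tangent_fold[OF n, of "c u s"] cS[OF that(1)]
      dist_fold_along[OF n chart_inner[OF assms(2)], of "c u s"] that(2) n
    by (auto simp: inner_fold_along)
  have "dist p (c u\<^sub>0 t\<^sub>2) < r" using close[of u\<^sub>0 t\<^sub>2] d' t by simp
  then have nz: "n = 0 \<or> n \<bullet> c u\<^sub>0 t\<^sub>2 \<noteq> 0" using foldI x endI by blast
  obtain \<delta> g' where \<delta>: "0 < \<delta>" "orthogonal_transformation g'"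
    "\<And>u s. dist u u\<^sub>0 < \<delta> \<Longrightarrow> \<bar>s - t\<^sub>2\<bar> \<le> \<delta> \<Longrightarrow> fold_along n (c u s) = g' (geodesic x u s) \<and> (n = 0 \<or> n \<bullet> c u s \<noteq> 0)"
  proof (cases "n = 0")
    case True
    then show ?thesis using that[of 1 g] g by (simp add: cg)
  next
    case False
    then have n1: "norm n = 1" using n by simp
    \<comment> \<open>By \<open>cd\<close> the product with \<open>n\<close> changes by less than
      \<open>3 * \<delta>\<close>, so its sign persists.\<close>
    define \<delta> where "\<delta> = \<bar>n \<bullet> c u\<^sub>0 t\<^sub>2\<bar> / 3"
    have \<delta>: "\<delta> > 0" using nz False by (simp add: \<delta>_def)
    have diff: "\<bar>n \<bullet> c u s - n \<bullet> c u\<^sub>0 t\<^sub>2\<bar> < \<bar>n \<bullet> c u\<^sub>0 t\<^sub>2\<bar>" if "dist u u\<^sub>0 < \<delta>" "\<bar>s - t\<^sub>2\<bar> \<le> \<delta>" for u s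
    proof -
      have "\<bar>n \<bullet> (c u s - c u\<^sub>0 t\<^sub>2)\<bar> \<le> dist (c u s) (c u\<^sub>0 t\<^sub>2)"
        using Cauchy_Schwarz_ineq2[of n "c u s - c u\<^sub>0 t\<^sub>2"] n1 by (simp add: dist_norm)
      also have "\<dots> \<le> dist u u\<^sub>0 + \<bar>s - t\<^sub>2\<bar>" by (rule cd)
      also have "\<dots> < 3 * \<delta>" using that \<delta> by linarith
      finally show ?thesis by (simp add: \<delta>_def inner_simps)
    qed
    show ?thesis
    proof (cases "n \<bullet> c u\<^sub>0 t\<^sub>2 > 0")
      case True
      then have "n \<bullet> c u s > 0" if "dist u u\<^sub>0 < \<delta>" "\<bar>s - t\<^sub>2\<bar> \<le> \<delta>" for u s
        using diff[OF that] by linarith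
      then show ?thesis using that[of \<delta> g] \<delta> g by (force simp: cg fold_along_pos)
    next
      case neg: False
      then have "n \<bullet> c u s < 0" if "dist u u\<^sub>0 < \<delta>" "\<bar>s - t\<^sub>2\<bar> \<le> \<delta>" for u s
        using diff[OF that] by linarith
      then show ?thesis
        using that[of \<delta> "\<lambda>y. reflect n (g y)"] \<delta>
          orthogonal_transformation_compose[OF orthogonal_reflect[OF n] g]
        by (force simp: cg fold_along_neg o_def)
    qed
  qed
  define e where "e = min (min d' \<delta>) (t\<^sub>2 - t\<^sub>1) / 2"
  have e: "0 < e" "e < d'" "e < \<delta>" "e < t\<^sub>2 - t\<^sub>1" using d' \<delta>(1) t by (auto simp: e_def)
  have "orbit_family x u\<^sub>0 t\<^sub>2 e g' \<Gamma>'"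
    unfolding orbit_family_def
  proof (intro conjI allI impI ballI)
    show "0 < e" "e < t\<^sub>2" "orthogonal_transformation g'" using e t1 \<delta> by auto
    define U where "U = {u. unit_tangent x u \<and> dist u u\<^sub>0 < e}"
    \<comment> \<open>At the seam all nearby orbits are in the interior, where the fold is the
      identity; hence the glued family is continuous.\<close>
    have eq: "fold_along n (c u t\<^sub>1) = \<Gamma> u t\<^sub>1" if u: "u \<in> U" for u
    proof -
      have u': "unit_tangent x u" "dist u u\<^sub>0 < d" "dist u u\<^sub>0 < d'" using u e d' by (auto simp: U_def)
      have \<Gamma>t: "\<Gamma> u t\<^sub>1 = c u t\<^sub>1" "\<Gamma> u t\<^sub>1 \<in> I" using \<Gamma>g[OF u'(1,2), of t\<^sub>1] \<Gamma>I[OF u'(1,2), of t\<^sub>1] d cg by simp_all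
      then have "n = 0 \<or> 0 < n \<bullet> c u t\<^sub>1"
        using chart_I(1)[OF assms(2), of "c u t\<^sub>1"] cS[OF u'(1)] close[OF u'(3), of t\<^sub>1] t d' by auto
      then show ?thesis using \<Gamma>t by (auto simp: fold_along_pos)
    qed
    have 1: "U \<times> {0..t\<^sub>2 + e} = U \<times> {0..t\<^sub>1} \<union> U \<times> {t\<^sub>1..t\<^sub>2 + e}" using t e t1 by auto
    have c1: "continuous_on (U \<times> {0..t\<^sub>1}) (\<lambda>p. \<Gamma> (fst p) (snd p))"
      using cont unfolding case_prod_unfold
      by (rule continuous_on_subset) (use e d' d in \<open>auto simp: U_def\<close>)
    have c2: "continuous_on (U \<times> {t\<^sub>1..t\<^sub>2 + e}) (\<lambda>p. fold_along n (c (fst p) (snd p)))"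
      unfolding c_def
      by (intro continuous_intros linear_continuous_on_compose[OF _ lin])
    have "continuous_on (U \<times> {0..t\<^sub>1} \<union> U \<times> {t\<^sub>1..t\<^sub>2 + e})
        (\<lambda>p. if snd p \<le> t\<^sub>1 then \<Gamma> (fst p) (snd p) else fold_along n (c (fst p) (snd p)))"
    proof -
      have cl: "closedin (top_of_set (U \<times> {0..t\<^sub>2 + e})) (U \<times> {0..t\<^sub>1})"
        "closedin (top_of_set (U \<times> {0..t\<^sub>2 + e})) (U \<times> {t\<^sub>1..t\<^sub>2 + e})"
        using closedin_Times[of U U "{0..t\<^sub>2 + e}" "{0..t\<^sub>1}"] closedin_Times[of U U "{0..t\<^sub>2 + e}" "{t\<^sub>1..t\<^sub>2 + e}"]
          t e t1 closed_subset[of "{0..t\<^sub>1}" "{0..t\<^sub>2 + e}"] closed_subset[of "{t\<^sub>1..t\<^sub>2 + e}" "{0..t\<^sub>2 + e}"]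
        by auto
      show ?thesis
        by (rule continuous_on_cases_local[OF cl[unfolded 1] c1 c2]) (use eq in auto)
    qed
    then show "continuous_on ({u. unit_tangent x u \<and> dist u u\<^sub>0 < e} \<times> {0..t\<^sub>2 + e}) (\<lambda>(u, s). \<Gamma>' u s)"
      unfolding case_prod_unfold \<Gamma>'_def U_def[symmetric] 1 .
    fix u assume u: "unit_tangent x u \<and> dist u u\<^sub>0 < e"
    show "ray_orbit x u (t\<^sub>2 + e) (\<Gamma>' u)"
      by (rule ray_orbit_cong[OF \<Gamma>'[of u]]) (use u e t t1 in auto)
    fix s assume s: "s \<in> {t\<^sub>2 - e..t\<^sub>2 + e}"
    then have "\<bar>s - t\<^sub>2\<bar> \<le> \<delta>" "t\<^sub>1 < s" "s \<le> t\<^sub>2 + d'" using e by auto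
    then show "\<Gamma>' u s = g' (geodesic x u s)" "\<Gamma>' u s \<in> I"
      using \<delta>(3)[of u s] u e foldI[of u s] close[of u s] by (auto simp: \<Gamma>'_def)
  qed
  then show ?thesis unfolding stable_at_def by blast
qed

text \<open>At a bounce no single isometry describes the orbits, so the induction over time runs
  through interior times and crosses a bounce in one step from before it to after it.\<close>

lemma stable_orbit:
  assumes o: "ray_orbit x u\<^sub>0 T \<gamma>" and I: "\<gamma> T \<in> I"
  shows "stable_at x u\<^sub>0 T"
proof -
  have T: "0 < T" using ray_orbit_basic[OF o] by simp
  obtain h where h: "h > 0" "\<And>t. 0 < t \<Longrightarrow> t < h \<Longrightarrow> stable_at x u\<^sub>0 t"
    using stable_initial[OF o] by blast
  define E where "E a \<longleftrightarrow> (\<forall>t. 0 < t \<and> t \<le> a \<and> \<gamma> t \<in> I \<longrightarrow> stable_at x u\<^sub>0 t)" for a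
  define p where "p a b \<longleftrightarrow> (0 < a \<longrightarrow> b \<le> T \<longrightarrow> E a \<longrightarrow> E b)" for a b
  define t\<^sub>0 where "t\<^sub>0 = min h T / 2"
  have t0: "0 < t\<^sub>0" "t\<^sub>0 < h" "t\<^sub>0 \<le> T" using h T by (auto simp: t\<^sub>0_def)
  have "p t\<^sub>0 T"
    using t0(3)
  proof (induction rule: Bolzano)
    case (trans a b c)
    then show ?case by (auto simp: p_def)
  next
    case (local t)
    with t0 have t: "0 < t" "t \<le> T" by auto
    obtain n r where r: "chart (\<gamma> t) n r"
      using chart_exists ray_orbit_mem[OF o t] by blast
    have r0: "0 < r" using r by (simp add: chart_def)
    obtain e where e: "e > 0" "\<And>s. 0 < s \<Longrightarrow> s \<le> T \<Longrightarrow> s \<noteq> t \<Longrightarrow> \<bar>s - t\<bar> < e \<Longrightarrow> \<gamma> s \<in> I"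
      using ray_orbit_punctured[OF o t] by blast
    define d where "d = min (min e (r / 4)) t / 2"
    have "d \<le> min (min e (r / 4)) t / 2" by (simp add: d_def)
    then have d: "0 < d" "2 * d \<le> e" "8 * d \<le> r" "2 * d \<le> t" using e r0 t by (auto simp: d_def)
    have "p a b" if ab: "a \<le> t" "t \<le> b" "b - a < d" for a b
      unfolding p_def
    proof (intro impI)
      assume *: "0 < a" "b \<le> T" "E a"
      \<comment> \<open>An interior time shortly before \<open>t\<close>, inside the same chart, at
        which stability is already known. Near \<open>t\<close> a bounce can happen at
        \<open>t\<close> only, so \<open>a\<close> serves unless \<open>a = t\<close>.\<close>
      define t\<^sub>1 where "t\<^sub>1 = (if a < t then a else t - d)"
      have t1: "0 < t\<^sub>1" "t\<^sub>1 \<le> a" "t\<^sub>1 < t" "t - d \<le> t\<^sub>1" using ab * d t by (auto simp: t\<^sub>1_def)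
      then have "\<gamma> t\<^sub>1 \<in> I" using e(2)[of t\<^sub>1] d t by simp
      then have st: "stable_at x u\<^sub>0 t\<^sub>1" using *(3) t1 by (simp add: E_def)
      show "E b"
        unfolding E_def
      proof (intro allI impI)
        fix s assume s: "0 < s \<and> s \<le> b \<and> \<gamma> s \<in> I"
        show "stable_at x u\<^sub>0 s"
        proof (cases "s \<le> a")
          case True
          then show ?thesis using *(3) s by (simp add: E_def)
        next
          case False
          have "dist (\<gamma> t) (\<gamma> t\<^sub>1) + (s - t\<^sub>1) < r"
            using ray_orbit_dist[OF o, of t\<^sub>1 t] t1 t s d ab by (simp add: dist_commute)
          then show ?thesis
            using stable_step[OF o r, of t\<^sub>1 s] False t1 s *(2) st by auto
        qed
      qed
    qed
    then show ?case using d by blast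
  qed
  moreover have "E t\<^sub>0" using h(2) t0 by (simp add: E_def)
  ultimately have "E T" using t0 by (simp add: p_def)
  then show ?thesis using T I by (simp add: E_def)
qed

end

section \<open>Homotopy classes and blocked directions\<close>

context billiard
begin

lemma interior_geodesic:
  assumes z: "z \<in> I" and u: "unit_tangent z u"
  shows "\<exists>e>0. \<forall>s. 0 < s \<and> s < e \<longrightarrow> geodesic z u s \<in> I"
proof -
  have zS: "z \<in> S2" using z I_subset P_subset by blast
  obtain e where e: "e > 0" "\<forall>y\<in>S2. dist z y < e \<longrightarrow> y \<in> I" using I_ball[OF z] by blast
  have "geodesic z u s \<in> I" if "0 < s" "s < e" for s
  proof -
    have "dist z (geodesic z u s) < e" using dist_geodesic[OF zS u, of 0 s] that by simp
    then show ?thesis using e(2) unit_tangent_velocity(1)[OF zS u, of s] by blast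
  qed
  then show ?thesis using e(1) by blast
qed

lemma regular_orbit_cong:
  assumes "\<And>s. 0 \<le> s \<Longrightarrow> s \<le> l \<Longrightarrow> \<beta> s = \<gamma> s" "regular_orbit P V l \<gamma>"
  shows "regular_orbit P V l \<beta>"
  unfolding regular_orbit_iff_bounces
proof
  fix t assume t: "t \<in> {0..l}"
  then have "bounces {0..l} \<gamma> t" using assms(2) by (simp only: regular_orbit_iff_bounces)
  then show "bounces {0..l} \<beta> t"
    by (rule bounces_cong[of _ _ _ 1]) (use assms(1) t in auto)
qed

lemma regular_orbit_ray:
  assumes z: "z \<in> I" and l: "0 < l" and \<gamma>: "\<gamma> \<in> orbits_from P V z l"
  shows "\<exists>u. ray_orbit z u l \<gamma>"
proof -
  have b: "bounces {0..l} \<gamma> t" if "0 \<le> t" "t \<le> l" for t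
    using \<gamma> that by (simp add: orbits_from_def regular_orbit_iff_bounces)
  have \<gamma>0: "\<gamma> 0 = z" using \<gamma> by (simp add: orbits_from_def)
  obtain v n e where v: "bounce {0..l} \<gamma> 0 v n e" using b[of 0] l by (auto simp: bounces_def)
  have "n = 0" using bounce_chart[OF v] chart_F(2) z \<gamma>0 by metis
  then have g: "\<gamma> s = geodesic z v s" if "0 \<le> s" "s < e" "s \<le> l" for s
    using bounce_right[OF v, of s] that \<gamma>0 by simp
  have zv: "z \<in> S2" "unit_tangent z v" using bounce_tangent(1,2)[OF v] \<gamma>0 by auto
  obtain e' where e': "e' > 0" "\<forall>s. 0 < s \<and> s < e' \<longrightarrow> geodesic z v s \<in> I"
    using interior_geodesic[OF z zv(2)] by blast
  have "ray_orbit z v l \<gamma>"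
    unfolding ray_orbit_def
    using zv l b g e' bounce_pos[OF v] by (intro conjI exI[of _ "min e e'"]) auto
  then show ?thesis ..
qed

lemma ray_orbit_regular:
  assumes z: "z \<in> I" and o: "ray_orbit z u l \<gamma>"
  shows "\<gamma> \<in> orbits_from P V z l"
proof -
  have \<gamma>0: "\<gamma> 0 = z" and l: "0 < l" and u: "unit_tangent z u" using ray_orbit_basic[OF o] by auto
  obtain e where e: "0 < e" "e \<le> l" "\<And>s. 0 \<le> s \<Longrightarrow> s < e \<Longrightarrow> \<gamma> s = geodesic z u s"
    using ray_orbit_start[OF o] by metis
  have "bounce {0..l} \<gamma> 0 u 0 e"
    unfolding bounce_def using chart_interior[OF z] e u \<gamma>0 by auto
  then have "bounces {0..l} \<gamma> t" if "0 \<le> t" "t \<le> l" for t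
    using ray_orbit_bounces[OF o, of t] that unfolding bounces_def by (cases "t = 0") auto
  then show ?thesis using \<gamma>0 by (auto simp: orbits_from_def regular_orbit_iff_bounces)
qed

text \<open>Moving the angle linearly from \<open>\<theta>\<^sub>0\<close> to
  \<open>\<theta>\<close> moves the orbit through the continuous family around
  \<open>\<theta>\<^sub>0\<close>; uniqueness identifies both ends with the given orbits.\<close>

lemma homotopic_orbits_near:
  assumes z: "z \<in> I" and e: "unit_tangent z e" and o: "ray_orbit z (geodesic e (cross3 z e) \<theta>\<^sub>0) l \<gamma>\<^sub>0"
  shows "\<exists>d>0. \<forall>\<theta> \<gamma>. \<bar>\<theta> - \<theta>\<^sub>0\<bar> < d \<and> ray_orbit z (geodesic e (cross3 z e) \<theta>) l \<gamma> \<longrightarrow>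
    (\<gamma>\<^sub>0, \<gamma>) \<in> orbit_homotopy P V z l"
proof -
  define dir where "dir = geodesic e (cross3 z e)"
  have zS: "z \<in> S2" using z I_subset P_subset by blast
  have ef: "e \<in> S2" "unit_tangent e (cross3 z e)"
    using unit_tangent_cross[OF zS e] e by (auto simp: unit_tangent_def)
  have ut: "unit_tangent z (dir \<theta>)" for \<theta> unfolding dir_def by (rule unit_tangent_circle[OF zS e])
  have dd: "dist (dir \<theta>) (dir \<theta>') \<le> \<bar>\<theta> - \<theta>'\<bar>" for \<theta> \<theta>'
    unfolding dir_def by (rule dist_geodesic[OF ef])
  have l: "0 < l" using ray_orbit_basic[OF o] by simp
  obtain T \<beta> where T: "T > l" "ray_orbit z (dir \<theta>\<^sub>0) T \<beta>" "\<beta> T \<in> I"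
    using ray_orbit_continue[OF o] unfolding dir_def by blast
  obtain d g \<Gamma> where fam: "orbit_family z (dir \<theta>\<^sub>0) T d g \<Gamma>"
    using stable_orbit[OF T(2,3)] unfolding stable_at_def by blast
  have d: "0 < d" and
    cont: "continuous_on ({u. unit_tangent z u \<and> dist u (dir \<theta>\<^sub>0) < d} \<times> {0..T + d}) (\<lambda>(u, s). \<Gamma> u s)"
    using fam unfolding orbit_family_def by blast+
  have \<Gamma>: "ray_orbit z u (T + d) (\<Gamma> u)" if "unit_tangent z u" "dist u (dir \<theta>\<^sub>0) < d" for u
    using fam that unfolding orbit_family_def by blast
  have "(\<gamma>\<^sub>0, \<gamma>) \<in> orbit_homotopy P V z l" if \<theta>: "\<bar>\<theta> - \<theta>\<^sub>0\<bar> < d" and \<gamma>: "ray_orbit z (dir \<theta>) l \<gamma>" for \<theta> \<gamma>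
  proof -
    define \<phi> where "\<phi> \<tau> = \<theta>\<^sub>0 + \<tau> * (\<theta> - \<theta>\<^sub>0)" for \<tau>
    have \<phi>: "dist (dir (\<phi> \<tau>)) (dir \<theta>\<^sub>0) < d" if "\<tau> \<in> {0..1}" for \<tau>
    proof -
      have "\<bar>\<phi> \<tau> - \<theta>\<^sub>0\<bar> \<le> \<bar>\<theta> - \<theta>\<^sub>0\<bar>"
        using that by (simp add: \<phi>_def abs_mult mult_left_le_one_le)
      then show ?thesis using dd[of "\<phi> \<tau>" \<theta>\<^sub>0] \<theta> by linarith
    qed
    have orb: "ray_orbit z (dir (\<phi> \<tau>)) l (\<Gamma> (dir (\<phi> \<tau>)))" if "\<tau> \<in> {0..1}" for \<tau>
      using ray_orbit_cong[OF \<Gamma>[OF ut \<phi>[OF that]], of l] T(1) l d by auto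
    define h where "h = (\<lambda>p. \<Gamma> (dir (\<phi> (fst p))) (snd p))"
    have hc: "continuous_on ({0..1} \<times> {0..l}) h"
    proof -
      have "continuous_on ({0..1} \<times> {0..l}) (\<lambda>p. (dir (\<phi> (fst p)), snd p))"
        unfolding dir_def \<phi>_def by (intro continuous_intros)
      moreover have "(\<lambda>p. (dir (\<phi> (fst p)), snd p)) ` ({0..1} \<times> {0..l}) \<subseteq>
          {u. unit_tangent z u \<and> dist u (dir \<theta>\<^sub>0) < d} \<times> {0..T + d}"
        using ut \<phi> T(1) d by auto
      ultimately have "continuous_on ({0..1} \<times> {0..l}) (\<lambda>p. (\<lambda>(u, s). \<Gamma> u s) (dir (\<phi> (fst p)), snd p))"
        by (rule continuous_on_compose2[OF cont])
      then show ?thesis by (simp add: h_def)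
    qed
    have hP: "h (\<tau>, s) \<in> P" if "\<tau> \<in> {0..1}" "s \<in> {0..l}" for \<tau> s
    proof -
      have "\<Gamma> (dir (\<phi> \<tau>)) \<in> orbits_from P V z l" by (rule ray_orbit_regular[OF z orb[OF that(1)]])
      then show ?thesis using that(2) by (auto simp: h_def orbits_from_def regular_orbit_def)
    qed
    have cong: "f \<in> orbits_from P V z l \<longleftrightarrow> k \<in> orbits_from P V z l"
      if "\<And>s. s \<in> {0..l} \<Longrightarrow> f s = k s" for f k
      using regular_orbit_cong[of l f k] regular_orbit_cong[of l k f] that l
      by (auto simp: orbits_from_def)
    have "homotopic_with_canon (\<lambda>\<beta>. \<beta> \<in> orbits_from P V z l) {0..l} P \<gamma>\<^sub>0 \<gamma>"
    proof (subst homotopic_with)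
      show "\<exists>h. continuous_map (prod_topology (top_of_set {0..1::real}) (top_of_set {0..l})) (top_of_set P) h \<and>
        (\<forall>x\<in>topspace (top_of_set {0..l}). h (0, x) = \<gamma>\<^sub>0 x) \<and>
        (\<forall>x\<in>topspace (top_of_set {0..l}). h (1, x) = \<gamma> x) \<and>
        (\<forall>t\<in>{0..1}. (\<lambda>x. h (t, x)) \<in> orbits_from P V z l)"
      proof (intro exI[of _ h] conjI ballI)
        show "continuous_map (prod_topology (top_of_set {0..1}) (top_of_set {0..l})) (top_of_set P) h"
          using hc hP by (auto simp: prod_topology_subtopology_eu continuous_map_subtopology_eu)
        fix s assume s: "s \<in> topspace (top_of_set {0..l})"
        show "h (0, s) = \<gamma>\<^sub>0 s"
          using ray_orbit_unique[OF orb[of 0], of l \<gamma>\<^sub>0 s] o s by (simp add: h_def \<phi>_def dir_def)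
        show "h (1, s) = \<gamma> s"
          using ray_orbit_unique[OF orb[of 1], of l \<gamma> s] \<gamma> s by (simp add: h_def \<phi>_def)
      next
        fix \<tau> :: real assume "\<tau> \<in> {0..1}"
        from ray_orbit_regular[OF z orb[OF this]]
        show "(\<lambda>x. h (\<tau>, x)) \<in> orbits_from P V z l" by (simp add: h_def)
      qed
    qed (rule cong, simp)
    then show ?thesis by (simp add: orbit_homotopy_def)
  qed
  then show ?thesis using d unfolding dir_def by blast
qed

section \<open>Counting homotopy classes by blocked angles\<close>

definition blocked_angles :: "real^3 \<Rightarrow> real^3 \<Rightarrow> real \<Rightarrow> real set" where
  "blocked_angles z e l = {\<theta>\<in>{-pi..<pi}. \<nexists>\<gamma>. ray_orbit z (geodesic e (cross3 z e) \<theta>) l \<gamma>}"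

text \<open>The blocked angles cut the interval of angles into at most \<open>card B + 1\<close>
  gaps, labelled by the number \<open>k\<close> of blocked angles below; within a gap all orbits are
  homotopic. The cut at \<open>- pi\<close> may split one class in two, which an upper bound can
  afford.\<close>

lemma position_complexity_le:
  assumes z: "z \<in> I" and e: "unit_tangent z e" and l: "0 < l" and fin: "finite (blocked_angles z e l)"
  shows "position_complexity P V z l \<le> enat (card (blocked_angles z e l) + 1)"
proof -
  define dir where "dir = geodesic e (cross3 z e)"
  define B where "B = blocked_angles z e l"
  define H where "H = orbit_homotopy P V z l"
  define orbs where "orbs = orbits_from P V z l"
  have zS: "z \<in> S2" using z I_subset P_subset by blast
  have sym: "(\<gamma>', \<gamma>) \<in> H" if "(\<gamma>, \<gamma>') \<in> H" for \<gamma> \<gamma>'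
    using that homotopic_with_symD by (auto simp: H_def orbit_homotopy_def)
  have trans: "(\<gamma>, \<gamma>'') \<in> H" if "(\<gamma>, \<gamma>') \<in> H" "(\<gamma>', \<gamma>'') \<in> H" for \<gamma> \<gamma>' \<gamma>''
    using that homotopic_with_trans by (auto simp: H_def orbit_homotopy_def)
  have ex: "\<exists>\<theta>\<in>{-pi..<pi} - B. ray_orbit z (dir \<theta>) l \<gamma>" if \<gamma>: "\<gamma> \<in> orbs" for \<gamma>
  proof -
    obtain u where u: "ray_orbit z u l \<gamma>"
      using regular_orbit_ray[OF z l] \<gamma> unfolding orbs_def by blast
    have "unit_tangent z u" using ray_orbit_basic[OF u] by simp
    then obtain \<theta> where \<theta>: "- pi \<le> \<theta>" "\<theta> \<le> pi" "u = dir \<theta>"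
      using circle_param[OF zS e] unfolding dir_def by metis
    have "dir pi = dir (- pi)" by (simp add: dir_def geodesic_def)
    then have "\<exists>\<theta>\<in>{-pi..<pi}. u = dir \<theta>"
      using \<theta> by (cases "\<theta> = pi") (auto intro: bexI[of _ "-pi"] bexI[of _ \<theta>])
    then show ?thesis using u by (auto simp: B_def blocked_angles_def dir_def)
  qed
  define \<alpha> where "\<alpha> \<gamma> = (SOME \<theta>. \<theta> \<in> {-pi..<pi} - B \<and> ray_orbit z (dir \<theta>) l \<gamma>)" for \<gamma>
  have \<alpha>: "\<alpha> \<gamma> \<in> {-pi..<pi}" "\<alpha> \<gamma> \<notin> B" "ray_orbit z (dir (\<alpha> \<gamma>)) l \<gamma>" if "\<gamma> \<in> orbs" for \<gamma>
    using someI_ex[of "\<lambda>\<theta>. \<theta> \<in> {-pi..<pi} - B \<and> ray_orbit z (dir \<theta>) l \<gamma>"] ex[OF that]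
    unfolding \<alpha>_def by blast+
  define k where "k \<theta> = card {b\<in>B. b < \<theta>}" for \<theta>
  have hom: "(\<gamma>, \<gamma>') \<in> H"
    if \<theta>: "- pi \<le> \<theta>" "\<theta> \<le> \<theta>'" "\<theta>' < pi" "\<theta>' \<notin> B" "k \<theta> = k \<theta>'"
      and \<gamma>: "ray_orbit z (dir \<theta>) l \<gamma>" "ray_orbit z (dir \<theta>') l \<gamma>'" for \<theta> \<theta>' \<gamma> \<gamma>'
  proof -
    have same: "{b\<in>B. b < \<theta>} = {b\<in>B. b < \<theta>'}"
      using \<theta> fin by (intro card_subset_eq) (auto simp: k_def B_def)
    have "b \<notin> B" if b: "\<theta> \<le> b" "b \<le> \<theta>'" for b
    proof
      assume "b \<in> B"
      then have "b \<in> {b\<in>B. b < \<theta>'}" using \<theta>(4) b by (cases "b = \<theta>'") auto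
      then have "b \<in> {b\<in>B. b < \<theta>}" by (simp only: same)
      then show False using b(1) by simp
    qed
    then have ex': "\<exists>\<gamma>. ray_orbit z (dir \<psi>) l \<gamma>" if "\<psi> \<in> {\<theta>..\<theta>'}" for \<psi>
      using that \<theta> unfolding B_def blocked_angles_def dir_def by auto
    \<comment> \<open>All pairs of orbits are compared, so transitivity uses that the middle angle
      has an orbit.\<close>
    define R where "R a b \<longleftrightarrow> (\<forall>\<gamma> \<gamma>'. ray_orbit z (dir a) l \<gamma> \<longrightarrow> ray_orbit z (dir b) l \<gamma>' \<longrightarrow> (\<gamma>, \<gamma>') \<in> H)" for a b
    have "R \<theta> \<theta>'"
    proof (rule connected_equivalence_relation[of "{\<theta>..\<theta>'}"])
      show "R b a" if "R a b" for a b using that sym by (auto simp: R_def)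
      show "R a c" if "R a b" "R b c" "b \<in> {\<theta>..\<theta>'}" for a b c
        using that ex'[OF that(3)] trans unfolding R_def by blast
      fix a assume a: "a \<in> {\<theta>..\<theta>'}"
      obtain \<gamma>\<^sub>0 where o: "ray_orbit z (dir a) l \<gamma>\<^sub>0" using ex'[OF a] by blast
      obtain d where d: "d > 0" "\<And>b \<gamma>. \<bar>b - a\<bar> < d \<Longrightarrow> ray_orbit z (dir b) l \<gamma> \<Longrightarrow> (\<gamma>\<^sub>0, \<gamma>) \<in> H"
        using homotopic_orbits_near[OF z e o[unfolded dir_def]] unfolding dir_def H_def by blast
      have "R a b" if "b \<in> {\<theta>..\<theta>'} \<inter> ball a d" for b
        unfolding R_def
      proof (intro allI impI)
        fix \<gamma> \<gamma>' assume *: "ray_orbit z (dir a) l \<gamma>" "ray_orbit z (dir b) l \<gamma>'"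
        have "(\<gamma>\<^sub>0, \<gamma>) \<in> H" using d(2)[of a \<gamma>] d(1) * by simp
        moreover have "(\<gamma>\<^sub>0, \<gamma>') \<in> H" using d(2)[of b \<gamma>'] that * by (simp add: dist_real_def abs_minus_commute)
        ultimately show "(\<gamma>, \<gamma>') \<in> H" using sym trans by blast
      qed
      then show "\<exists>T. openin (top_of_set {\<theta>..\<theta>'}) T \<and> a \<in> T \<and> (\<forall>x\<in>T. R a x)"
        using a d(1) by (intro exI[of _ "{\<theta>..\<theta>'} \<inter> ball a d"]) (auto simp: openin_open_Int)
    qed (use \<theta> in auto)
    then show ?thesis using \<gamma> by (simp add: R_def)
  qed
  have class_eq: "H `` {\<gamma>} = H `` {\<gamma>'}" if "\<gamma> \<in> orbs" "\<gamma>' \<in> orbs" "k (\<alpha> \<gamma>) = k (\<alpha> \<gamma>')" for \<gamma> \<gamma>'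
  proof -
    have "(\<gamma>, \<gamma>') \<in> H"
    proof (cases "\<alpha> \<gamma> \<le> \<alpha> \<gamma>'")
      case True
      then show ?thesis using hom[of "\<alpha> \<gamma>" "\<alpha> \<gamma>'"] \<alpha>[OF that(1)] \<alpha>[OF that(2)] that(3) by auto
    next
      case False
      then show ?thesis using sym hom[of "\<alpha> \<gamma>'" "\<alpha> \<gamma>"] \<alpha>[OF that(1)] \<alpha>[OF that(2)] that(3) by auto
    qed
    then show ?thesis using sym trans by blast
  qed
  define rep where "rep c = (SOME \<gamma>. \<gamma> \<in> orbs \<and> c = H `` {\<gamma>})" for c
  have rep: "rep c \<in> orbs \<and> c = H `` {rep c}" if "c \<in> orbs // H" for c
  proof -
    have "\<exists>\<gamma>. \<gamma> \<in> orbs \<and> c = H `` {\<gamma>}" using that by (auto simp: quotient_def)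
    then show ?thesis unfolding rep_def by (rule someI_ex)
  qed
  define idx where "idx c = k (\<alpha> (rep c))" for c
  have inj: "inj_on idx (orbs // H)"
  proof (rule inj_onI)
    fix c c' assume "c \<in> orbs // H" "c' \<in> orbs // H" "idx c = idx c'"
    then show "c = c'" using class_eq[of "rep c" "rep c'"] rep[of c] rep[of c'] by (simp add: idx_def)
  qed
  have "k \<theta> \<le> card B" for \<theta> unfolding k_def using fin by (intro card_mono) (auto simp: B_def)
  then have im: "idx ` (orbs // H) \<subseteq> {..card B}" by (auto simp: idx_def)
  have "finite (orbs // H)" "card (orbs // H) \<le> card B + 1"
    using inj_on_finite[OF inj im] card_inj_on_le[OF inj im] by simp_all
  then show ?thesis by (simp add: position_complexity_def Let_def orbs_def[symmetric] H_def[symmetric] B_def[symmetric])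
qed

section \<open>Blocked orbits read backwards and their unfoldings\<close>

definition arrives :: "real^3 \<Rightarrow> real^3 \<Rightarrow> real^3 \<Rightarrow> real^3 \<Rightarrow> real \<Rightarrow> bool" where
  "arrives z u q w T \<longleftrightarrow> (\<exists>\<beta>. ray_orbit q w T \<beta> \<and> \<beta> T = z \<and>
     (\<exists>e>0. \<forall>s. 0 \<le> s \<and> s < e \<longrightarrow> \<beta> (T - s) = geodesic z u s))"

text \<open>\<open>q\<close>, \<open>w\<close> and \<open>T\<close> determine the orbit, and its
  last arc determines \<open>u\<close>. So distinct blocked directions come from distinct data at
  the corners, which is what the count rests on.\<close>

lemma arrives_unique:
  assumes "arrives z u q w T" "arrives z u' q w T"
  shows "u = u'"
proof -
  obtain \<beta> e where b: "ray_orbit q w T \<beta>" "e > 0" "\<And>s. 0 \<le> s \<Longrightarrow> s < e \<Longrightarrow> \<beta> (T - s) = geodesic z u s"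
    using assms(1) unfolding arrives_def by blast
  obtain \<beta>' e' where b': "ray_orbit q w T \<beta>'" "e' > 0" "\<And>s. 0 \<le> s \<Longrightarrow> s < e' \<Longrightarrow> \<beta>' (T - s) = geodesic z u' s"
    using assms(2) unfolding arrives_def by blast
  have T: "0 < T" using ray_orbit_basic[OF b(1)] by simp
  show ?thesis
  proof (rule geodesic_eq_intervalD(2))
    show "0 < min (min e e') T" using T b b' by simp
    fix s assume s: "0 < s" "s < min (min e e') T"
    then show "geodesic z u s = geodesic z u' s"
      using b(3)[of s] b'(3)[of s] ray_orbit_unique[OF b(1) b'(1), of "T - s"] by simp
  qed
qed

lemma blocked_imp_arrives:
  assumes z: "z \<in> I" and u: "unit_tangent z u" and l: "0 < l" and blocked: "\<nexists>\<gamma>. ray_orbit z u l \<gamma>"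
  shows "\<exists>q\<in>V. \<exists>w T. T \<le> l \<and> arrives z u q w T"
proof -
  have zS: "z \<in> S2" using z I_subset P_subset by blast
  obtain e where e: "e > 0" "\<And>s. 0 < s \<Longrightarrow> s < e \<Longrightarrow> geodesic z u s \<in> I"
    using interior_geodesic[OF z u] by blast
  have "ray_orbit z u (e / 2) (geodesic z u)"
    using ray_orbit_geodesic[OF zS u e(2), of e "e / 2"] e(1) by simp
  from ray_orbit_blocked[OF this l blocked] obtain T \<Gamma> where T: "0 < T" "T \<le> l" "\<Gamma> T \<in> V"
    and \<Gamma>: "\<And>t. 0 < t \<Longrightarrow> t < T \<Longrightarrow> ray_orbit z u t \<Gamma>"
    and lim: "\<And>s. 0 \<le> s \<Longrightarrow> s \<le> T \<Longrightarrow> dist (\<Gamma> s) (\<Gamma> T) \<le> T - s"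
    by blast
  obtain w d where w: "unit_tangent (\<Gamma> T) w" "0 < d" "d \<le> T"
      "\<And>s. 0 \<le> s \<Longrightarrow> s < d \<Longrightarrow> \<Gamma> (T - s) = geodesic (\<Gamma> T) w s"
      "\<And>s. 0 < s \<Longrightarrow> s < d \<Longrightarrow> geodesic (\<Gamma> T) w s \<in> I"
    using corner_radial[OF \<Gamma> T(1,3) lim] by blast
  have qS: "\<Gamma> T \<in> S2" using T(3) V_subset F_eq P_subset by auto
  have rev: "ray_orbit (\<Gamma> T) w T (\<lambda>s. \<Gamma> (T - s))"
    by (rule ray_orbit_reverse[OF \<Gamma> T(1) z w(1) qS w(2-5)])
  have o2: "ray_orbit z u (T / 2) \<Gamma>" using \<Gamma>[of "T/2"] T by auto
  obtain c where "0 < c" "\<And>s. 0 \<le> s \<Longrightarrow> s < c \<Longrightarrow> \<Gamma> s = geodesic z u s"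
    using ray_orbit_start[OF o2] by metis
  then have "arrives z u (\<Gamma> T) w T"
    unfolding arrives_def using rev ray_orbit_basic(4)[OF o2]
    by (intro exI[of _ "\<lambda>s. \<Gamma> (T - s)"]) auto
  then show ?thesis using T by blast
qed

text \<open>By \<open>stable_orbit\<close>, one isometry serves a whole neighbourhood of each pair
  of direction and length with interior end point. A countable base of the space of pairs reduces
  these neighbourhoods to countably many, as sums and null sets require.\<close>

lemma local_unfolding:
  "\<exists>(b :: nat \<Rightarrow> ((real^3) \<times> real) set) g. (\<forall>i. open (b i)) \<and> (\<forall>i. orthogonal_transformation (g i)) \<and>
    (\<forall>i w T \<beta>. (w, T) \<in> b i \<and> ray_orbit q w T \<beta> \<longrightarrow> \<beta> T = g i (geodesic q w T)) \<and>
    (\<forall>w T \<beta>. ray_orbit q w T \<beta> \<and> \<beta> T \<in> I \<longrightarrow> (\<exists>i. (w, T) \<in> b i))"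
proof -
  obtain \<B> :: "((real^3) \<times> real) set set" where \<B>: "countable \<B>" "topological_basis \<B>"
    using ex_countable_basis by blast
  define p where "p S g \<longleftrightarrow> orthogonal_transformation g \<and>
    (\<forall>w T \<beta>. (w, T) \<in> S \<and> ray_orbit q w T \<beta> \<longrightarrow> \<beta> T = g (geodesic q w T))" for S and g :: "real^3 \<Rightarrow> real^3"
  \<comment> \<open>The empty set is added so that the collection is not empty and
    \<open>from_nat_into\<close> enumerates exactly its members.\<close>
  define \<C> where "\<C> = insert {} {S\<in>\<B>. \<exists>g. p S g}"
  have "p {} (\<lambda>y. y)" by (simp add: p_def orthogonal_transformation_id)
  then have C: "\<exists>g. p S g" "open S" if "S \<in> \<C>" for S
    using that topological_basis_open[OF \<B>(2)] by (auto simp: \<C>_def)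
  then obtain G where G: "\<And>S. S \<in> \<C> \<Longrightarrow> p S (G S)" by metis
  define b where "b = from_nat_into \<C>"
  have bC: "b i \<in> \<C>" for i unfolding b_def by (rule from_nat_into) (auto simp: \<C>_def)
  have "countable \<C>" using \<B>(1) by (simp add: \<C>_def)
  then have range: "range b = \<C>" unfolding b_def by (intro range_from_nat_into) (auto simp: \<C>_def)
  have cover: "\<exists>i. (w, T) \<in> b i" if o: "ray_orbit q w T \<beta>" "\<beta> T \<in> I" for w T \<beta>
  proof -
    obtain d g \<Gamma> where fam: "orbit_family q w T d g \<Gamma>"
      using stable_orbit[OF o] unfolding stable_at_def by blast
    have d: "0 < d" "d < T" and g: "orthogonal_transformation g"
      using fam unfolding orbit_family_def by blast+
    obtain S where S: "S \<in> \<B>" "(w, T) \<in> S" "S \<subseteq> ball w d \<times> ball T d"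
    proof (rule topological_basisE[OF \<B>(2), of "ball w d \<times> ball T d" "(w, T)"])
      show "open (ball w d \<times> ball T d)" by (intro open_Times open_ball)
    qed (use d in auto)
    have "p S g"
      unfolding p_def
    proof (intro conjI allI impI g)
      fix w' T' \<beta>' assume *: "(w', T') \<in> S \<and> ray_orbit q w' T' \<beta>'"
      then have near: "dist w' w < d" "\<bar>T' - T\<bar> < d"
        using S(3) by (auto simp: dist_commute dist_real_def)
      have "0 < T'" and "unit_tangent q w'" using * ray_orbit_basic by blast+
      moreover have "T' \<in> {T - d..T + d}" using near(2) by (simp add: abs_less_iff)
      ultimately have fam': "ray_orbit q w' (T + d) (\<Gamma> w')" "\<Gamma> w' T' = g (geodesic q w' T')"
        using fam near(1) unfolding orbit_family_def by blast+
      have "\<beta>' T' = \<Gamma> w' T'"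
        using ray_orbit_unique[of q w' T' \<beta>' "T + d" "\<Gamma> w'" T'] * fam'(1) near \<open>0 < T'\<close> by auto
      then show "\<beta>' T' = g (geodesic q w' T')" using fam'(2) by simp
    qed
    then have "S \<in> \<C>" using S(1) by (auto simp: \<C>_def)
    then show ?thesis using range S(2) by (metis imageE)
  qed
  show ?thesis
    by (rule exI[of _ b], rule exI[of _ "\<lambda>i. G (b i)"])
      (use C(2) bC G cover in \<open>simp add: p_def, blast\<close>)
qed

end

section \<open>Counting by area\<close>

lemma S2_borel: "S2 \<in> sets borel"
  by (intro borel_closed closed_sphere)

lemma space_sphere_measure: "space sphere_measure = S2"
  by (simp add: sphere_measure_def space_scale_measure)

lemma sets_sphere_measure: "A \<in> sets sphere_measure \<longleftrightarrow> A \<in> sets borel \<and> A \<subseteq> S2"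
  by (auto simp: sphere_measure_def sets_restrict_space_iff S2_borel)

definition sphere_cone :: "(real^3) set \<Rightarrow> (real^3) set" where
  "sphere_cone A = {x \<in> ball 0 1 - {0}. x /\<^sub>R norm x \<in> A}"

lemma normalise_measurable:
  "(\<lambda>x. x /\<^sub>R norm x) \<in> restrict_space lborel (ball 0 1 - {0}) \<rightarrow>\<^sub>M restrict_space borel (S2)"
proof (rule measurable_restrict_space2)
  show "(\<lambda>x::real^3. x /\<^sub>R norm x) \<in> space (restrict_space lborel (ball 0 1 - {0})) \<rightarrow> S2"
    by (auto simp: space_restrict_space)
  show "(\<lambda>x::real^3. x /\<^sub>R norm x) \<in> borel_measurable (restrict_space lborel (ball 0 1 - {0}))"
    by (intro measurable_restrict_space1) simp
qed

lemma sphere_cone_borel: "A \<in> sets borel \<Longrightarrow> A \<subseteq> S2 \<Longrightarrow> sphere_cone A \<in> sets borel"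
  and emeasure_sphere: "A \<in> sets borel \<Longrightarrow> A \<subseteq> S2 \<Longrightarrow>
    emeasure sphere_measure A = 3 * emeasure lborel (sphere_cone A)"
proof -
  assume A: "A \<in> sets borel" "A \<subseteq> S2"
  then have A': "A \<in> sets (restrict_space borel S2)"
    by (simp add: sets_restrict_space_iff S2_borel)
  have O: "ball 0 1 - {0::real^3} \<in> sets borel" by simp
  have eq: "(\<lambda>x. x /\<^sub>R norm x) -` A \<inter> space (restrict_space lborel (ball 0 1 - {0})) = sphere_cone A"
    by (auto simp: sphere_cone_def space_restrict_space)
  have "sphere_cone A \<in> sets (restrict_space lborel (ball 0 1 - {0}))"
    using measurable_sets[OF normalise_measurable A'] by (simp only: eq)
  then show "sphere_cone A \<in> sets borel"
    using O by (simp add: sets_restrict_space_iff)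
  show "emeasure sphere_measure A = 3 * emeasure lborel (sphere_cone A)"
    unfolding sphere_measure_def
    by (subst emeasure_scale_measure, subst emeasure_distr[OF normalise_measurable A'], unfold eq,
        subst emeasure_restrict_space) (use O in \<open>auto simp: sphere_cone_def\<close>)
qed

lemma borel_orthogonal_image:
  assumes g: "orthogonal_transformation (g :: real^3 \<Rightarrow> real^3)" and A: "A \<in> sets borel"
  shows "g ` A \<in> sets borel"
proof -
  have g': "orthogonal_transformation (inv g)"
    using orthogonal_transformation_inv[OF g] .
  have "bij g" using orthogonal_transformation_bij[OF g] .
  then have "g ` A = inv g -` A" by (simp add: bij_vimage_eq_inv_image bij_imp_bij_inv inv_inv_eq)
  moreover have "inv g \<in> borel_measurable borel"
    using g' by (intro borel_measurable_continuous_onI linear_continuous_on)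
      (simp add: orthogonal_transformation_linear linear_conv_bounded_linear[symmetric])
  ultimately show ?thesis using measurable_sets[of "inv g" borel borel A] A by simp
qed

text \<open>\<open>g\<close> commutes with taking cones and preserves Lebesgue measure. Cones are
  bounded, so the invariance of \<open>measure\<close> carries over to
  \<open>emeasure\<close>.\<close>

lemma emeasure_sphere_orthogonal_image:
  assumes g: "orthogonal_transformation g" and A: "A \<in> sets borel" "A \<subseteq> S2"
  shows "emeasure sphere_measure (g ` A) = emeasure sphere_measure A"
proof -
  have gS: "g ` A \<subseteq> S2" using A orthogonal_transformation_norm[OF g] by auto
  have lin: "linear g" using g by (simp add: orthogonal_transformation_linear)
  have surj: "surj g" using orthogonal_transformation_surj[OF g] .
  have inj: "inj g" using orthogonal_transformation_inj[OF g] .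
  have cone: "sphere_cone (g ` A) = g ` sphere_cone A"
  proof -
    have "g x \<in> sphere_cone (g ` A) \<longleftrightarrow> x \<in> sphere_cone A" for x
      using orthogonal_transformation_norm[OF g] inj_image_mem_iff[OF inj]
        inj_eq[OF inj, of x 0] linear_0[OF lin]
      by (auto simp: sphere_cone_def linear_cmul[OF lin, symmetric])
    then show ?thesis using surj by (auto simp: set_eq_iff image_iff) metis+
  qed
  have C: "sphere_cone A \<in> sets borel" using sphere_cone_borel A by blast
  have gC: "g ` sphere_cone A \<in> sets borel" using borel_orthogonal_image[OF g C] .
  have "sphere_cone A \<in> lmeasurable"
    using C by (intro bounded_set_imp_lmeasurable bounded_subset[OF bounded_ball[of 0 1]])
      (auto simp: sphere_cone_def)
  then have lm: "sphere_cone A \<in> lmeasurable" "g ` sphere_cone A \<in> lmeasurable"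
      "measure lebesgue (g ` sphere_cone A) = measure lebesgue (sphere_cone A)"
    using measurable_orthogonal_image[OF g] measure_orthogonal_image[OF g] by auto
  have "emeasure lborel (g ` sphere_cone A) = emeasure lebesgue (g ` sphere_cone A)"
    using gC by simp
  also have "\<dots> = emeasure lebesgue (sphere_cone A)"
    using lm by (simp add: emeasure_eq_measure2)
  also have "\<dots> = emeasure lborel (sphere_cone A)" using C by simp
  finally show ?thesis
    using emeasure_sphere[OF borel_orthogonal_image[OF g A(1)] gS] emeasure_sphere[OF A] by (simp add: cone)
qed

lemma emeasure_sphere_finite: "emeasure sphere_measure S2 < \<infinity>"
proof -
  have "emeasure lborel (sphere_cone S2) \<le> emeasure lborel (ball 0 (1::real) :: (real^3) set)"
    by (intro emeasure_mono) (auto simp: sphere_cone_def)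
  also have "\<dots> < \<infinity>" by (rule emeasure_lborel_ball_finite)
  finally show ?thesis
    using emeasure_sphere[OF S2_borel order_refl] by (simp add: ennreal_mult_less_top)
qed

text \<open>The cone over a great circle lies in a plane.\<close>

lemma great_circle_null:
  assumes "n \<noteq> 0"
  shows "{y\<in>S2. n \<bullet> y = 0} \<in> null_sets sphere_measure"
proof -
  have A: "{y\<in>S2. n \<bullet> y = 0} \<in> sets borel" "{y\<in>S2. n \<bullet> y = 0} \<subseteq> S2"
  proof -
    have "closed (S2 \<inter> {y. n \<bullet> y = 0})" by (intro closed_Int closed_sphere closed_hyperplane)
    moreover have "{y\<in>S2. n \<bullet> y = 0} = S2 \<inter> {y. n \<bullet> y = 0}" by auto
    ultimately show "{y\<in>S2. n \<bullet> y = 0} \<in> sets borel" by simp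
  qed auto
  have H: "{y. n \<bullet> y = 0} \<in> sets borel" by (intro borel_closed closed_hyperplane)
  have "negligible {y. n \<bullet> y = 0}" using assms by (intro negligible_hyperplane) auto
  then have "{y. n \<bullet> y = 0} \<in> null_sets lebesgue" by (simp add: negligible_iff_null_sets)
  then have "{y. n \<bullet> y = 0} \<in> null_sets lborel" using H by (simp add: null_sets_def)
  then have "emeasure lborel {y. n \<bullet> y = 0} = 0" by auto
  moreover have "emeasure lborel (sphere_cone {y\<in>S2. n \<bullet> y = 0}) \<le> emeasure lborel {y. n \<bullet> y = 0}"
    using H by (intro emeasure_mono) (auto simp: sphere_cone_def)
  ultimately have "emeasure sphere_measure {y\<in>S2. n \<bullet> y = 0} = 0"
    using emeasure_sphere[OF A] by simp
  then show ?thesis using A by (auto simp: null_sets_def sets_sphere_measure)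
qed

lemma countable_null_sphere:
  assumes "countable Z" "Z \<subseteq> S2"
  shows "Z \<in> null_sets sphere_measure"
proof -
  have "{p} \<in> null_sets sphere_measure" if p: "p \<in> S2" for p
  proof -
    obtain n where n: "unit_tangent p n" using exists_unit_tangent[OF p] by blast
    then have "n \<noteq> 0" by (auto simp: unit_tangent_def)
    from great_circle_null[OF this] show ?thesis
      by (rule null_sets_subset) (use n p in \<open>auto simp: unit_tangent_def sets_sphere_measure\<close>)
  qed
  then have "(\<Union>p\<in>Z. {p}) \<in> null_sets sphere_measure"
    using assms by (intro null_sets_UN') auto
  then show ?thesis by simp
qed

text \<open>The images may overlap, but their multiplicity integrates to the total area of the
  pieces, which are disjoint before they are moved.\<close>

lemma nn_integral_overlap_le:
  assumes g: "\<And>i::nat. orthogonal_transformation (g i)" and A: "\<And>i. A i \<in> sets borel" "\<And>i. A i \<subseteq> S2"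
    and disj: "disjoint_family A"
  shows "(\<lambda>z. \<Sum>i. indicator (g i ` A i) z :: ennreal) \<in> borel_measurable sphere_measure"
    and "(\<integral>\<^sup>+z. (\<Sum>i. indicator (g i ` A i) z) \<partial>sphere_measure) \<le> emeasure sphere_measure S2"
proof -
  have gA: "g i ` A i \<in> sets sphere_measure" for i
    using borel_orthogonal_image[OF g A(1)] A(2)[of i] orthogonal_transformation_norm[OF g]
    by (auto simp: sets_sphere_measure subset_eq)
  have AA: "A i \<in> sets sphere_measure" for i using A by (simp add: sets_sphere_measure)
  show "(\<lambda>z. \<Sum>i. indicator (g i ` A i) z :: ennreal) \<in> borel_measurable sphere_measure"
    by (intro borel_measurable_suminf_order borel_measurable_indicator gA)
  have "(\<integral>\<^sup>+z. (\<Sum>i. indicator (g i ` A i) z) \<partial>sphere_measure)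
      = (\<Sum>i. \<integral>\<^sup>+z. indicator (g i ` A i) z \<partial>sphere_measure)"
    by (intro nn_integral_suminf borel_measurable_indicator gA)
  also have "\<dots> = (\<Sum>i. emeasure sphere_measure (A i))"
    using gA emeasure_sphere_orthogonal_image[OF g A] by simp
  also have "\<dots> = emeasure sphere_measure (\<Union>i. A i)"
    using AA by (intro suminf_emeasure disj) auto
  also have "\<dots> \<le> emeasure sphere_measure S2"
    using A S2_borel by (intro emeasure_mono) (auto simp: sets_sphere_measure)
  finally show "(\<integral>\<^sup>+z. (\<Sum>i. indicator (g i ` A i) z) \<partial>sphere_measure) \<le> emeasure sphere_measure S2" .
qed

text \<open>The inverse of the exponential map \<open>(u, t) \<mapsto> geodesic q u t\<close> on \<open>k * pi < t < (k + 1) * pi\<close>.\<close>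

definition geodesic_inv :: "real^3 \<Rightarrow> nat \<Rightarrow> real^3 \<Rightarrow> (real^3) \<times> real" where
  "geodesic_inv q k x =
     ((((-1)^k) / norm (x - (q \<bullet> x) *\<^sub>R q)) *\<^sub>R (x - (q \<bullet> x) *\<^sub>R q),
      real k * pi + arccos ((-1)^k * (q \<bullet> x)))"

text \<open>For such \<open>t\<close> the sign of \<open>sin t\<close> is \<open>(-1)^k\<close> and
  \<open>cos t\<close> is monotone. So \<open>u\<close> is, up to that sign, the normalised
  component orthogonal to \<open>q\<close>, and \<open>arccos\<close> recovers
  \<open>t\<close>.\<close>

lemma geodesic_inv:
  assumes q: "q \<in> S2" and u: "unit_tangent q u" and t: "real k * pi < t" "t < (real k + 1) * pi"
  shows "geodesic_inv q k (geodesic q u t) = (u, t)" "geodesic q u t \<noteq> q" "geodesic q u t \<noteq> - q"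
proof -
  define x where "x = geodesic q u t"
  define \<tau> where "\<tau> = t - real k * pi"
  have \<tau>: "0 < \<tau>" "\<tau> < pi" using t by (auto simp: \<tau>_def algebra_simps)
  have t_eq: "t = \<tau> + real k * pi" by (simp add: \<tau>_def)
  have sk: "sin (real k * pi) = 0" "cos (real k * pi) = (-1)^k"
    by (simp_all add: cos_npi sin_npi)
  have ct: "cos t = (-1)^k * cos \<tau>" and st: "sin t = (-1)^k * sin \<tau>"
    by (simp_all only: t_eq cos_add sin_add sk) simp_all
  have sp: "sin \<tau> > 0" using \<tau> by (intro sin_gt_zero)
  have qx: "q \<bullet> x = cos t"
    using q u by (simp add: x_def inner_geodesic unit_tangent_def norm_eq_1 inner_commute)
  have y: "x - (q \<bullet> x) *\<^sub>R q = sin t *\<^sub>R u"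
    unfolding qx by (simp add: x_def geodesic_def)
  have pm: "(-1::real)^k * (-1)^k = 1" by (simp flip: power_mult_distrib)
  have ab: "\<bar>(-1::real)^k\<bar> = 1" by (simp add: power_abs)
  have ny: "norm (sin t *\<^sub>R u) = sin \<tau>"
    using u sp by (simp add: unit_tangent_def st abs_mult ab)
  have "(-1)^k * (q \<bullet> x) = cos \<tau>" unfolding qx ct using pm by (simp flip: mult.assoc)
  then have a: "arccos ((-1)^k * (q \<bullet> x)) = \<tau>" using \<tau> by (simp add: arccos_cos)
  have b: "((-1)^k / sin \<tau> * sin t) = 1" unfolding st using sp pm by (simp add: field_simps)
  show "geodesic_inv q k (geodesic q u t) = (u, t)"
    unfolding x_def[symmetric] geodesic_inv_def y ny a scaleR_scaleR b by (simp add: \<tau>_def)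
  have "sin t \<noteq> 0" unfolding st using sp by simp
  then have "sin t *\<^sub>R u \<noteq> 0" using u by (auto simp: unit_tangent_def)
  then have ne: "x - (q \<bullet> x) *\<^sub>R q \<noteq> 0" by (simp add: y)
  have "q \<bullet> q = 1" using q by (simp add: norm_eq_1)
  then show "geodesic q u t \<noteq> q" "geodesic q u t \<noteq> - q"
    unfolding x_def[symmetric] using ne by auto
qed

lemma continuous_on_geodesic_inv:
  assumes q: "q \<in> S2"
  shows "continuous_on (S2 - {q, -q}) (geodesic_inv q k)"
proof -
  have ne: "x - (q \<bullet> x) *\<^sub>R q \<noteq> 0" if x: "x \<in> S2 - {q, -q}" for x
  proof
    assume "x - (q \<bullet> x) *\<^sub>R q = 0"
    then have e: "x = (q \<bullet> x) *\<^sub>R q" by simp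
    have "norm x = \<bar>q \<bullet> x\<bar> * norm q" by (subst e) simp
    then have "\<bar>q \<bullet> x\<bar> = 1" using x q by simp
    then show False using e x by (cases "q \<bullet> x \<ge> 0") auto
  qed
  have qx: "\<bar>(-1)^k * (q \<bullet> x)\<bar> \<le> 1" if x: "x \<in> S2 - {q, -q}" for x
    using Cauchy_Schwarz_ineq2[of q x] x q by (simp add: abs_mult power_abs)
  have "continuous_on (S2 - {q, -q}) (\<lambda>x. ((-1)^k / norm (x - (q \<bullet> x) *\<^sub>R q)) *\<^sub>R (x - (q \<bullet> x) *\<^sub>R q))"
    using ne by (intro continuous_intros) auto
  moreover have "continuous_on (S2 - {q, -q}) (\<lambda>x. real k * pi + arccos ((-1)^k * (q \<bullet> x)))"
    using qx by (intro continuous_intros) (auto simp: abs_le_iff)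
  ultimately show ?thesis unfolding geodesic_inv_def by (intro continuous_on_Pair)
qed

lemma geodesic_inv_borel:
  assumes q: "q \<in> S2" and b: "open b"
  shows "{x \<in> S2 - {q, -q}. geodesic_inv q k x \<in> b} \<in> sets borel"
proof -
  obtain U where U: "open U" "(S2 - {q, -q}) \<inter> geodesic_inv q k -` b = (S2 - {q, -q}) \<inter> U"
    using continuous_openin_preimage_gen[OF continuous_on_geodesic_inv[OF q] b, of k] by (auto simp: openin_open)
  have "{x \<in> S2 - {q, -q}. geodesic_inv q k x \<in> b} = (S2 - {q, -q}) \<inter> geodesic_inv q k -` b" by blast
  also note U(2)
  finally have "{x \<in> S2 - {q, -q}. geodesic_inv q k x \<in> b} = (S2 - {q, -q}) \<inter> U" .
  moreover have "(S2 - {q, -q}) \<inter> U \<in> sets borel" using S2_borel U(1) by auto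
  ultimately show ?thesis by simp
qed

section \<open>Averaging over the sphere and Fatou's lemma\<close>

context billiard
begin

lemma AE_blocked_angles_linear:
  "AE z in sphere_measure. z \<in> P \<longrightarrow> z \<in> I \<and> (\<exists>C::real. \<forall>N. \<exists>n\<ge>N. \<forall>e. unit_tangent z e \<longrightarrow>
     finite (blocked_angles z e (real n * pi)) \<and> real (card (blocked_angles z e (real n * pi))) \<le> C * real (Suc n))"
proof -
  have VS: "q \<in> S2" if "q \<in> V" for q using that V_subset F_eq P_subset by auto
  obtain b g where bg:
    "\<And>q i. open (b q i :: ((real^3) \<times> real) set)"
    "\<And>q i. orthogonal_transformation (g q i :: real^3 \<Rightarrow> real^3)"
    "\<And>q (i::nat) w T \<beta>. (w, T) \<in> b q i \<Longrightarrow> ray_orbit q w T \<beta> \<Longrightarrow> \<beta> T = g q i (geodesic q w T)"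
    "\<And>q w T \<beta>. ray_orbit q w T \<beta> \<Longrightarrow> \<beta> T \<in> I \<Longrightarrow> \<exists>i. (w, T) \<in> b q i"
    using local_unfolding by metis
  \<comment> \<open>The free end points whose data in the \<open>k\<close>-th length interval lie in
    \<open>b q i\<close>. These sets overlap for different \<open>i\<close>;
    \<open>disjointed\<close> assigns each free end point to a single unfolding, so that it is
    counted once.\<close>
  define E where "E q k i = {x \<in> S2 - {q, -q}. geodesic_inv q k x \<in> b q i}" for q k i
  define A where "A q k = disjointed (E q k)" for q k
  have E: "E q k i \<in> sets borel" if "q \<in> V" for q k i
    unfolding E_def by (rule geodesic_inv_borel[OF VS[OF that] bg(1)])
  have A: "A q k i \<in> sets borel" if "q \<in> V" for q k i
    using sets.range_disjointed_sets[of "E q k" borel] E[OF that] unfolding A_def by blast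
  have AE_sub: "A q k i \<subseteq> E q k i" for q k i unfolding A_def by (rule disjointed_subset)
  have AS: "A q k i \<subseteq> S2" for q k i using AE_sub[of q k i] by (auto simp: E_def)
  have disj: "disjoint_family (A q k)" for q k unfolding A_def by (rule disjoint_family_disjointed)
  define f where "f q k z = (\<Sum>i. indicator (g q i ` A q k i) z :: ennreal)" for q k z
  have f: "f q k \<in> borel_measurable sphere_measure"
      "(\<integral>\<^sup>+z. f q k z \<partial>sphere_measure) \<le> emeasure sphere_measure S2" if "q \<in> V" for q k
    unfolding f_def using nn_integral_overlap_le[of "g q" "A q k", OF bg(2) A[OF that] AS disj] by blast+
  define c where "c n z = (\<Sum>q\<in>V. \<Sum>k<n. f q k z)" for n z
  have c_meas: "c n \<in> borel_measurable sphere_measure" for n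
    unfolding c_def using f(1) by measurable
  define M where "M = ennreal (card V) * emeasure sphere_measure S2"
  have M: "M < \<infinity>" using emeasure_sphere_finite by (simp add: M_def ennreal_mult_less_top)
  have c_int: "(\<integral>\<^sup>+z. c n z \<partial>sphere_measure) \<le> ennreal (Suc n) * M" for n
  proof -
    have "(\<integral>\<^sup>+z. c n z \<partial>sphere_measure) = (\<Sum>q\<in>V. \<Sum>k<n. \<integral>\<^sup>+z. f q k z \<partial>sphere_measure)"
      unfolding c_def using f(1) by (simp add: nn_integral_sum)
    also have "\<dots> \<le> (\<Sum>q\<in>V. \<Sum>k<n. emeasure sphere_measure S2)"
      by (intro sum_mono f(2))
    also have "\<dots> = ennreal n * M"
      by (simp add: M_def ennreal_of_nat_eq_real_of_nat mult_ac)
    also have "\<dots> \<le> ennreal (Suc n) * M" by (intro mult_right_mono) auto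
    finally show ?thesis .
  qed
  \<comment> \<open>Dividing by \<open>Suc n\<close> instead of \<open>n\<close> avoids an exception
    for \<open>n = 0\<close>.\<close>
  define a where "a n z = ennreal (1 / real (Suc n)) * c n z" for n z
  have a_meas: "a n \<in> borel_measurable sphere_measure" for n unfolding a_def using c_meas by measurable
  have a_int: "(\<integral>\<^sup>+z. a n z \<partial>sphere_measure) \<le> M" for n
  proof -
    have "(\<integral>\<^sup>+z. a n z \<partial>sphere_measure) = ennreal (1 / real (Suc n)) * (\<integral>\<^sup>+z. c n z \<partial>sphere_measure)"
      unfolding a_def by (rule nn_integral_cmult[OF c_meas])
    also have "\<dots> \<le> ennreal (1 / real (Suc n)) * (ennreal (Suc n) * M)"
      by (intro mult_left_mono c_int) auto
    also have "\<dots> = M"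
      by (subst mult.assoc[symmetric], subst ennreal_mult[symmetric]) auto
    finally show ?thesis .
  qed
  have "(\<integral>\<^sup>+z. liminf (\<lambda>n. a n z) \<partial>sphere_measure) \<le> liminf (\<lambda>n. \<integral>\<^sup>+z. a n z \<partial>sphere_measure)"
    by (rule nn_integral_liminf[OF a_meas])
  also have "\<dots> \<le> liminf (\<lambda>n. M)" by (intro Liminf_mono) (simp add: a_int)
  also have "\<dots> = M" by (simp add: Liminf_const)
  finally have "(\<integral>\<^sup>+z. liminf (\<lambda>n. a n z) \<partial>sphere_measure) \<noteq> \<infinity>" using M by auto
  then have AE_fin: "AE z in sphere_measure. liminf (\<lambda>n. a n z) \<noteq> \<infinity>"
    using a_meas by (intro nn_integral_PInf_AE) measurable
  \<comment> \<open>The possible interior end points of orbits from corners whose length is a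
    multiple of \<open>pi\<close>: there all free geodesics focus at \<open>q\<close> or
    \<open>- q\<close>, and direction and length cannot be recovered.\<close>
  define Z where "Z = (\<Union>q\<in>V. \<Union>i. {g q i q, g q i (- q)})"
  have "countable Z" unfolding Z_def using finite_V by (intro countable_UN) (auto simp: countable_finite)
  moreover have "Z \<subseteq> S2" using VS orthogonal_transformation_norm[OF bg(2)] by (auto simp: Z_def)
  ultimately have AE_Z: "AE z in sphere_measure. z \<notin> Z" by (intro AE_not_in countable_null_sphere)
  obtain N where N: "finite N" "0 \<notin> N" "\<forall>y\<in>F. \<exists>n\<in>N. n \<bullet> y = 0"
    using great_circles_cover_frontier by blast
  have "(\<Union>n\<in>N. {y\<in>S2. n \<bullet> y = 0}) \<in> null_sets sphere_measure"
    using N by (intro null_sets_UN' countable_finite great_circle_null) auto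
  then have AE_F: "AE z in sphere_measure. z \<notin> (\<Union>n\<in>N. {y\<in>S2. n \<bullet> y = 0})" by (rule AE_not_in)
  have main: "\<exists>C::real. \<forall>N. \<exists>n\<ge>N. \<forall>e. unit_tangent z e \<longrightarrow>
     finite (blocked_angles z e (real n * pi)) \<and> real (card (blocked_angles z e (real n * pi))) \<le> C * real (Suc n)"
    if z: "z \<in> I" "z \<notin> Z" "liminf (\<lambda>n. a n z) \<noteq> \<infinity>" for z
  proof -
    have zS: "z \<in> S2" using z I_subset P_subset by blast
    have "liminf (\<lambda>n. a n z) < top" using z(3) by (simp add: less_top)
    then obtain m :: nat where m: "liminf (\<lambda>n. a n z) < of_nat m"
      using ennreal_Ex_less_of_nat by blast
    \<comment> \<open>A lower limit below \<open>m\<close> means that \<open>a n z < m\<close>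
      infinitely often. The condition \<open>1 \<le> n\<close> makes the length
      \<open>n * pi\<close> positive, as \<open>blocked_imp_arrives\<close> requires.\<close>
    have "\<exists>n\<ge>N. 1 \<le> n \<and> a n z < ennreal m" for N
    proof (rule ccontr)
      assume "\<not> (\<exists>n\<ge>N. 1 \<le> n \<and> a n z < ennreal m)"
      then have "\<forall>n\<ge>max N 1. ennreal m \<le> a n z" by (auto simp: not_less)
      then have "eventually (\<lambda>n. ennreal m \<le> a n z) sequentially"
        unfolding eventually_sequentially by blast
      then have "ennreal m \<le> liminf (\<lambda>n. a n z)" by (rule Liminf_bounded)
      then show False using m by (simp add: ennreal_of_nat_eq_real_of_nat)
    qed
    moreover have "finite (blocked_angles z e (real n * pi)) \<and> real (card (blocked_angles z e (real n * pi))) \<le> real m * real (Suc n)"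
      if n1: "1 \<le> n" and n: "a n z < ennreal m" and e: "unit_tangent z e" for n e
    proof -
      have "c n z = ennreal (Suc n) * a n z"
        unfolding a_def by (subst mult.assoc[symmetric], subst ennreal_mult[symmetric]) auto
      also have "\<dots> \<le> ennreal (Suc n) * ennreal m" using n by (intro mult_left_mono) auto
      also have "\<dots> = ennreal (real m * real (Suc n))" by (subst ennreal_mult[symmetric]) (auto simp: mult.commute)
      finally have cn: "c n z \<le> ennreal (real m * real (Suc n))" .
      define K where "K q k = {i. z \<in> g q i ` A q k i}" for q k
      have fK: "f q k z = emeasure (count_space UNIV) (K q k)" for q k
      proof -
        have "f q k z = (\<Sum>i. indicator (K q k) i)"
          unfolding f_def K_def by (intro suminf_cong) (simp add: indicator_def)
        also have "\<dots> = (\<integral>\<^sup>+i. indicator (K q k) i \<partial>count_space UNIV)"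
          by (rule nn_integral_count_space_nat[symmetric])
        finally show ?thesis by simp
      qed
      have finK: "finite (K q k)" if "q \<in> V" "k < n" for q k
      proof (rule ccontr)
        assume "infinite (K q k)"
        then have "f q k z = \<infinity>" by (simp add: fK)
        moreover have "f q k z \<le> (\<Sum>k<n. f q k z)" using that by (intro member_le_sum) auto
        moreover have "(\<Sum>k<n. f q k z) \<le> c n z"
          unfolding c_def using that finite_V by (intro member_le_sum[where f = "\<lambda>q. \<Sum>k<n. f q k z"]) auto
        ultimately have "c n z = \<infinity>" by (metis infinity_ennreal_def top.extremum_uniqueI)
        then show False using cn by (simp add: top_unique)
      qed
      \<comment> \<open>The triples of corner, length interval and unfolding that reach
        \<open>z\<close>. Their number is \<open>c n z\<close>, and every blocked angle will be
        charged to one of them.\<close>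
      define W where "W = (SIGMA q:V. SIGMA k:{..<n}. K q k)"
      have finW: "finite W" unfolding W_def using finite_V finK by auto
      have cW: "c n z = ennreal (card W)"
      proof -
        have "c n z = (\<Sum>q\<in>V. \<Sum>k<n. ennreal (card (K q k)))"
          unfolding c_def by (intro sum.cong refl) (simp add: fK finK ennreal_of_nat_eq_real_of_nat)
        also have "\<dots> = ennreal (\<Sum>q\<in>V. \<Sum>k<n. real (card (K q k)))"
          by (subst sum_ennreal[symmetric], simp add: sum_nonneg, subst sum_ennreal) auto
        also have "(\<Sum>q\<in>V. \<Sum>k<n. real (card (K q k))) = real (card W)"
        proof -
          have "card (SIGMA k:{..<n}. K q k) = (\<Sum>k<n. card (K q k))" if "q \<in> V" for q
            using finK[OF that] by (intro card_SigmaI) auto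
          moreover have "card W = (\<Sum>q\<in>V. card (SIGMA k:{..<n}. K q k))"
            unfolding W_def using finite_V finK by (intro card_SigmaI) auto
          ultimately show ?thesis by simp
        qed
        finally show ?thesis .
      qed
      then have cardW: "real (card W) \<le> real m * real (Suc n)" using cn by (simp add: ennreal_le_iff)
      define dir where "dir = geodesic e (cross3 z e)"
      define B where "B = blocked_angles z e (real n * pi)"
      define r where "r \<theta> j \<longleftrightarrow> (case j of (q, k, i) \<Rightarrow> \<exists>w T. arrives z (dir \<theta>) q w T \<and>
        real k * pi < T \<and> T < (real k + 1) * pi \<and> z = g q i (geodesic q w T))" for \<theta> j
      have "\<exists>j\<in>W. r \<theta> j" if \<theta>: "\<theta> \<in> B" for \<theta>
      proof -
        have noray: "\<nexists>\<gamma>. ray_orbit z (dir \<theta>) (real n * pi) \<gamma>"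
          using \<theta> by (simp add: B_def blocked_angles_def dir_def)
        have ut: "unit_tangent z (dir \<theta>)" unfolding dir_def by (rule unit_tangent_circle[OF zS e])
        have n0: "0 < real n * pi" using n1 by simp
        obtain q w T where q: "q \<in> V" "T \<le> real n * pi" and ar: "arrives z (dir \<theta>) q w T"
          using blocked_imp_arrives[OF z(1) ut n0 noray] by blast
        obtain \<beta> where \<beta>: "ray_orbit q w T \<beta>" "\<beta> T = z" using ar by (auto simp: arrives_def)
        have T: "0 < T" and w: "unit_tangent q w" using ray_orbit_basic[OF \<beta>(1)] by auto
        \<comment> \<open>Excluding multiples of \<open>pi\<close> makes the bounds on
          \<open>T\<close> strict, so that \<open>T \<le> n * pi\<close> even gives
          \<open>k < n\<close>.\<close>
        have npi: "T \<noteq> real j * pi" for j :: nat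
        proof
          assume Tj: "T = real j * pi"
          have "geodesic q w T = q \<or> geodesic q w T = - q"
            unfolding Tj geodesic_def by (cases "even j") (simp_all add: sin_npi cos_npi)
          moreover obtain i where "(w, T) \<in> b q i" using bg(4)[OF \<beta>(1)] \<beta>(2) z(1) by auto
          then have "z = g q i (geodesic q w T)" using bg(3)[OF _ \<beta>(1)] \<beta>(2) by simp
          ultimately have "z \<in> {g q i q, g q i (- q)}" by auto
          then have "z \<in> Z" unfolding Z_def using q(1) by blast
          then show False using z(2) by simp
        qed
        define k where "k = nat \<lfloor>T / pi\<rfloor>"
        have k: "real k * pi < T" "T < (real k + 1) * pi"
        proof -
          have "real k = of_int \<lfloor>T / pi\<rfloor>" using T by (simp add: k_def)
          then have "real k \<le> T / pi" "T / pi < real k + 1" by linarith+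
          then have "real k * pi \<le> T" "T < (real k + 1) * pi" by (simp_all add: field_simps)
          then show "real k * pi < T" "T < (real k + 1) * pi" using npi[of k] by auto
        qed
        have "real k * pi < real n * pi" using k(1) q(2) by linarith
        then have kn: "k < n" by simp
        define x where "x = geodesic q w T"
        have x: "geodesic_inv q k x = (w, T)" "x \<in> S2 - {q, -q}"
          using geodesic_inv[OF VS[OF q(1)] w k] unit_tangent_velocity(1)[OF VS[OF q(1)] w] by (auto simp: x_def)
        \<comment> \<open>After \<open>disjointed\<close> the index \<open>i\<close> of
          \<open>x\<close> may differ from \<open>i'\<close>. Still
          \<open>(w, T) \<in> b q i\<close>, since \<open>x \<in> E q k i\<close> and
          \<open>geodesic_inv\<close> recovers the data from \<open>x\<close>.\<close>
        obtain i' where "(w, T) \<in> b q i'" using bg(4)[OF \<beta>(1)] \<beta>(2) z(1) by auto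
        then have "x \<in> E q k i'" using x by (simp add: E_def)
        then have "x \<in> (\<Union>i. A q k i)" unfolding A_def UN_disjointed_eq by blast
        then obtain i where i: "x \<in> A q k i" by blast
        then have "(w, T) \<in> b q i" using AE_sub x(1) by (force simp: E_def)
        then have zx: "z = g q i x" using bg(3)[OF _ \<beta>(1)] \<beta>(2) by (simp add: x_def)
        have "(q, k, i) \<in> W" using q(1) kn zx i by (auto simp: W_def K_def)
        moreover have "r \<theta> (q, k, i)" using ar k zx by (auto simp: r_def x_def)
        ultimately show ?thesis by blast
      qed
      then obtain J where J: "\<And>\<theta>. \<theta> \<in> B \<Longrightarrow> J \<theta> \<in> W \<and> r \<theta> (J \<theta>)" by metis
      \<comment> \<open>The triple and \<open>z\<close> determine the free end point, because
        \<open>g q i\<close> is injective; this determines \<open>(w, T)\<close>, and by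
        \<open>arrives_unique\<close> the direction at \<open>z\<close>. Angles are unique in a
        half-open interval of length \<open>2 * pi\<close>.\<close>
      have "inj_on J B"
      proof (rule inj_onI)
        fix \<theta> \<theta>' assume \<theta>: "\<theta> \<in> B" "\<theta>' \<in> B" "J \<theta> = J \<theta>'"
        obtain q k i where j: "J \<theta> = (q, k, i)" by (metis prod_cases3)
        obtain w T where 1: "arrives z (dir \<theta>) q w T" "real k * pi < T" "T < (real k + 1) * pi" "z = g q i (geodesic q w T)"
          using J[OF \<theta>(1)] j by (auto simp: r_def)
        obtain w' T' where 2: "arrives z (dir \<theta>') q w' T'" "real k * pi < T'" "T' < (real k + 1) * pi" "z = g q i (geodesic q w' T')"
          using J[OF \<theta>(2)] \<theta>(3) j by (auto simp: r_def)
        have u: "q \<in> S2" "unit_tangent q w" "unit_tangent q w'"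
          using 1(1) 2(1) ray_orbit_basic unfolding arrives_def by metis+
        have same: "geodesic q w T = geodesic q w' T'"
          by (rule injD[OF orthogonal_transformation_inj[OF bg(2)[of q i]]]) (use 1(4) 2(4) in simp)
        have "(w, T) = geodesic_inv q k (geodesic q w T)"
          by (rule geodesic_inv(1)[OF u(1,2) 1(2,3), symmetric])
        also have "\<dots> = geodesic_inv q k (geodesic q w' T')" by (rule arg_cong[OF same])
        also have "\<dots> = (w', T')" by (rule geodesic_inv(1)[OF u(1,3) 2(2,3)])
        finally have dir: "dir \<theta> = dir \<theta>'" using arrives_unique[OF 1(1)] 2(1) by simp
        have ee: "e \<bullet> e = 1" "cross3 z e \<bullet> cross3 z e = 1" "e \<bullet> cross3 z e = 0" "cross3 z e \<bullet> e = 0"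
          using e unit_tangent_cross[OF zS e] by (auto simp: unit_tangent_def norm_eq_1 inner_commute)
        have "e \<bullet> dir \<theta> = e \<bullet> dir \<theta>'" "cross3 z e \<bullet> dir \<theta> = cross3 z e \<bullet> dir \<theta>'" using dir by simp_all
        then have "cos \<theta> = cos \<theta>'" "sin \<theta> = sin \<theta>'" by (simp_all add: dir_def inner_geodesic ee)
        then obtain s :: int where s: "\<theta> = \<theta>' + 2 * pi * s" using sin_cos_eq_iff[of \<theta> \<theta>'] by auto
        have "\<bar>\<theta> - \<theta>'\<bar> < 2 * pi" using \<theta> by (auto simp: B_def blocked_angles_def)
        then have "\<bar>of_int s :: real\<bar> < 1" using s by (simp add: abs_mult)
        then have "s = 0" by linarith
        then show "\<theta> = \<theta>'" using s by simp
      qed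
      moreover have "J ` B \<subseteq> W" using J by blast
      ultimately have "finite B" "card B \<le> card W"
        using finW inj_on_finite card_inj_on_le by blast+
      then show ?thesis using cardW by (simp add: B_def)
    qed
    ultimately show ?thesis by (intro exI[of _ "real m"]) blast
  qed
  show ?thesis
    using AE_fin AE_Z AE_F AE_space
  proof eventually_elim
    case (elim z)
    then have "z \<notin> F" using N(3) by (auto simp: space_sphere_measure)
    then show ?case using main[of z] elim F_eq by blast
  qed
qed

end

theorem corollary10:
  fixes P V :: "(real^3) set"
  assumes "geodesic_polygon P V"
  shows "AE z in sphere_measure. z \<in> P \<longrightarrow>
           (\<exists>C::real. \<forall>L::real. \<exists>l\<ge>L. ereal_of_enat (position_complexity P V z l) \<le> ereal (C * l))"
proof -
  interpret billiard P V by (rule billiard.intro) (rule assms)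
  show ?thesis
    using AE_blocked_angles_linear
  proof eventually_elim
    case (elim z)
    show ?case
    proof
      assume "z \<in> P"
      with elim obtain C :: real where z: "z \<in> I"
        and C: "\<And>N. \<exists>n\<ge>N. \<forall>e. unit_tangent z e \<longrightarrow> finite (blocked_angles z e (real n * pi)) \<and>
          real (card (blocked_angles z e (real n * pi))) \<le> C * real (Suc n)"
        by blast
      obtain e where e: "unit_tangent z e"
        using exists_unit_tangent z I_subset P_subset by blast
      show "\<exists>C::real. \<forall>L::real. \<exists>l\<ge>L. ereal_of_enat (position_complexity P V z l) \<le> ereal (C * l)"
      \<comment> \<open>For \<open>n \<ge> 1\<close> and \<open>l = n * pi \<ge> n\<close> the bound
        \<open>C * (n + 1) + 1\<close> is at most \<open>2 * C * n + n\<close>, hence at most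
        \<open>(2 * C + 1) * l\<close>.\<close>
      proof (rule exI[of _ "2 * C + 1"], rule allI)
        fix L :: real
        define N where "N = max 1 (nat \<lceil>L\<rceil>)"
        obtain n where n: "N \<le> n" and fin: "finite (blocked_angles z e (real n * pi))"
          and card: "real (card (blocked_angles z e (real n * pi))) \<le> C * real (Suc n)"
          using C[of N] e by blast
        have n1: "1 \<le> real n" and "L \<le> real n" using n unfolding N_def by linarith+
        define l where "l = real n * pi"
        have nl: "real n \<le> l" using n1 pi_gt3 by (simp add: l_def)
        have l: "L \<le> l" "0 < l" using \<open>L \<le> real n\<close> nl n1 by linarith+
        have "0 \<le> C * real (Suc n)" using card by linarith
        then have C0: "0 \<le> C" by (simp add: zero_le_mult_iff)
        have "real (card (blocked_angles z e l) + 1) \<le> C * (real n + 1) + 1"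
          using card by (simp add: l_def add.commute)
        also have "\<dots> \<le> C * (2 * real n) + real n"
          using n1 C0 by (intro add_mono mult_left_mono) auto
        also have "\<dots> = (2 * C + 1) * real n" by (simp add: algebra_simps)
        also have "\<dots> \<le> (2 * C + 1) * l" using nl C0 by (intro mult_left_mono) auto
        finally have le: "real (card (blocked_angles z e l) + 1) \<le> (2 * C + 1) * l" .
        have "ereal_of_enat (position_complexity P V z l) \<le> ereal_of_enat (enat (card (blocked_angles z e l) + 1))"
          using position_complexity_le[OF z e l(2)] fin by (simp only: ereal_of_enat_le_iff l_def)
        also have "\<dots> = ereal (real (card (blocked_angles z e l) + 1))" by simp
        also have "\<dots> \<le> ereal ((2 * C + 1) * l)" using le by (simp only: ereal_less_eq)
        finally show "\<exists>l\<ge>L. ereal_of_enat (position_complexity P V z l) \<le> ereal ((2 * C + 1) * l)"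
          using l(1) by blast
      qed
    qed
  qed
qed

end
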